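(* Let $p>q$ be positive integers, let $\alpha=\log_2(2p/q)$, and let $$B_{pq}=\langle a,b,s,t\mid [a,b]=1,\ s^{-1}a^qs=a^pb,\ t^{-1}a^qt=a^pb^{-1}\rangle.$$ Then $\mathrm{Ann}_{B_{pq}}(n)\simeq n^{2\alpha}$.
   Context: $[x,y]=x^{-1}y^{-1}xy$. Let $G=\langle A\mid R\rangle$ be a finite presentation. For a word $u$ in $A^{\pm1}$ representing $1\in G$, $\mathrm{Area}(u)$ is the least integer $N$ such that $u$ equals, in the free group $F(A)$, a product of $N$ conjugates of elements of $R^{\pm1}$. For words $u,v$, $u\sim v$ means they represent conjugate elements of $G$; in that case $\mathrm{Ann}(u,v)$ is the minimal $N$ for which there is a word $w$ with $uw=wv$ in $G$ and $\mathrm{Area}(w^{-1}uwv^{-1})=N$. The annular Dehn function is $\mathrm{Ann}_G(n)=\max\{\mathrm{Ann}(u,v)\mid |u|+|v|\le n,\ u\sim v\}$, where $|\cdot|$ is word length; up to $\simeq$ it is independent of the finite presentation. For functions $f,g:\mathbb{N}\to[0,\infty)$, $f\lesssim g$ means there is a positive integer constant $C$ with $f(n)\le C\,g(Cn+n)+Cn+C$ for all $n$; $f\simeq g$ means $f\lesssim g$ and $g\lesssim f$. *)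

theory Defs
  imports Complex_Main "HOL-Algebra.Group"
begin

text \<open>The generating set is the whole type \<open>'a\<close>. A letter \<open>(x, True)\<close> stands for the generator
  \<open>x\<close>, and \<open>(x, False)\<close> for its formal inverse. Words need not be freely reduced.\<close>

type_synonym 'a letter = "'a \<times> bool"
type_synonym 'a wrd = "'a letter list"

definition flip :: "'a letter \<Rightarrow> 'a letter"
  where "flip x = (fst x, \<not> snd x)"

definition winv :: "'a wrd \<Rightarrow> 'a wrd"
  where "winv u = rev (map flip u)"

text \<open>\<open>word_equiv R u v\<close>: the words \<open>u\<close> and \<open>v\<close> represent the same element of the group
  presented by the relators \<open>R\<close>; in particular \<open>word_equiv {}\<close> is equality in the free group.\<close>

inductive word_equiv :: "'a wrd set \<Rightarrow> 'a wrd \<Rightarrow> 'a wrd \<Rightarrow> bool" for R where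
  refl: "word_equiv R u u"
| sym: "word_equiv R u v \<Longrightarrow> word_equiv R v u"
| trans: "word_equiv R u v \<Longrightarrow> word_equiv R v w \<Longrightarrow> word_equiv R u w"
| cancel: "word_equiv R (u @ [x, flip x] @ v) (u @ v)"
| relator: "r \<in> R \<Longrightarrow> word_equiv R (u @ r @ v) (u @ v)"

definition word_class :: "'a wrd set \<Rightarrow> 'a wrd \<Rightarrow> 'a wrd set"
  where "word_class R u = {v. word_equiv R u v}"

definition presented_group :: "'a wrd set \<Rightarrow> 'a wrd set monoid"
  where "presented_group R =
    \<lparr>carrier = range (word_class R),
     mult = (\<lambda>X Y. \<Union>u\<in>X. \<Union>v\<in>Y. word_class R (u @ v)),
     one = word_class R []\<rparr>"

lemma flip_flip [simp]: "flip (flip x) = x"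
  by (simp add: flip_def)

lemma winv_simps [simp]:
  "winv [] = []" "winv (x # u) = winv u @ [flip x]" "winv (u @ v) = winv v @ winv u"
  "winv (winv u) = u"
  by (simp_all add: winv_def rev_map o_def)

lemma word_equiv_context:
  "word_equiv R u v \<Longrightarrow> word_equiv R (x @ u @ y) (x @ v @ y)"
proof (induction rule: word_equiv.induct)
  case (cancel u z v)
  show ?case using word_equiv.cancel[of R "x @ u" z "v @ y"] by simp
next
  case (relator r u v)
  then show ?case using word_equiv.relator[of r R "x @ u" "v @ y"] by simp
qed (use word_equiv.refl word_equiv.sym word_equiv.trans in metis)+

lemma word_equiv_append:
  assumes "word_equiv R u u'" "word_equiv R v v'"
  shows "word_equiv R (u @ v) (u' @ v')"
  using word_equiv_context[OF assms(1), of "[]" v] word_equiv_context[OF assms(2), of u' "[]"]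
  by (simp add: word_equiv.trans[where v = "u' @ v"])

lemma word_equiv_right_inverse: "word_equiv R (u @ winv u) []"
proof (induction u)
  case Nil
  show ?case by (simp add: word_equiv.refl)
next
  case (Cons x u)
  have "word_equiv R (x # u @ winv u @ [flip x]) [x, flip x]"
    using word_equiv_context[OF Cons.IH, of "[x]" "[flip x]"] by simp
  moreover have "word_equiv R [x, flip x] []"
    using word_equiv.cancel[of R "[]" x "[]"] by simp
  ultimately show ?case by (simp add: word_equiv.trans[where v = "[x, flip x]"])
qed

lemma word_equiv_left_inverse: "word_equiv R (winv u @ u) []"
  using word_equiv_right_inverse[of R "winv u"] by simp

lemma word_class_eq_iff: "word_class R u = word_class R v \<longleftrightarrow> word_equiv R u v"
  unfolding word_class_def set_eq_iff mem_Collect_eq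
  by (meson word_equiv.refl word_equiv.sym word_equiv.trans)

lemma mult_word_class:
  "word_class R u \<otimes>\<^bsub>presented_group R\<^esub> word_class R v = word_class R (u @ v)"
proof -
  have "word_class R (u' @ v') = word_class R (u @ v)"
    if "u' \<in> word_class R u" "v' \<in> word_class R v" for u' v'
  proof -
    have "word_equiv R u u'" "word_equiv R v v'" using that by (simp_all add: word_class_def)
    then show ?thesis
      unfolding word_class_eq_iff by (intro word_equiv.sym[OF word_equiv_append])
  qed
  moreover have "u \<in> word_class R u" "v \<in> word_class R v"
    by (auto simp: word_class_def word_equiv.refl)
  ultimately have
    "(\<Union>u'\<in>word_class R u. \<Union>v'\<in>word_class R v. word_class R (u' @ v')) = word_class R (u @ v)"
    by blast
  then show ?thesis by (simp add: presented_group_def)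
qed

lemma one_presented_group: "\<one>\<^bsub>presented_group R\<^esub> = word_class R []"
  by (simp add: presented_group_def)

lemma carrier_presented_group: "carrier (presented_group R) = range (word_class R)"
  by (simp add: presented_group_def)

lemma group_presented_group: "group (presented_group R)"
proof (rule groupI)
  fix X assume "X \<in> carrier (presented_group R)"
  then obtain u where "X = word_class R u" by (auto simp: carrier_presented_group)
  then have "word_class R (winv u) \<otimes>\<^bsub>presented_group R\<^esub> X = \<one>\<^bsub>presented_group R\<^esub>"
    by (simp add: mult_word_class one_presented_group word_class_eq_iff word_equiv_left_inverse)
  then show "\<exists>Y\<in>carrier (presented_group R). Y \<otimes>\<^bsub>presented_group R\<^esub> X = \<one>\<^bsub>presented_group R\<^esub>"
    by (auto simp: carrier_presented_group)
qed (auto simp: carrier_presented_group one_presented_group mult_word_class)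

definition conj_prod :: "('a wrd \<times> 'a wrd) list \<Rightarrow> 'a wrd"
  where "conj_prod cs = concat (map (\<lambda>(w, r). winv w @ r @ w) cs)"

definition is_conj_prod :: "'a wrd set \<Rightarrow> nat \<Rightarrow> 'a wrd \<Rightarrow> bool"
  where "is_conj_prod R N u \<longleftrightarrow>
    (\<exists>cs. length cs = N \<and> snd ` set cs \<subseteq> R \<union> winv ` R \<and>
          word_class {} u = word_class {} (conj_prod cs))"

text \<open>Only meaningful for words representing the identity of \<open>presented_group R\<close>.\<close>

definition area :: "'a wrd set \<Rightarrow> 'a wrd \<Rightarrow> nat"
  where "area R u = (LEAST N. is_conj_prod R N u)"

definition conjugate_in :: "'a wrd set \<Rightarrow> 'a wrd \<Rightarrow> 'a wrd \<Rightarrow> bool"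
  where "conjugate_in R u v \<longleftrightarrow>
    (\<exists>g\<in>carrier (presented_group R).
       inv\<^bsub>presented_group R\<^esub> g \<otimes>\<^bsub>presented_group R\<^esub> word_class R u \<otimes>\<^bsub>presented_group R\<^esub> g
         = word_class R v)"

text \<open>Only meaningful for words satisfying \<^term>\<open>conjugate_in R\<close>.\<close>

definition ann :: "'a wrd set \<Rightarrow> 'a wrd \<Rightarrow> 'a wrd \<Rightarrow> nat"
  where "ann R u v =
    (LEAST N. \<exists>w. word_class R (u @ w) = word_class R (w @ v)
                \<and> area R (winv w @ u @ w @ winv v) = N)"

definition annular_dehn :: "('a::finite) wrd set \<Rightarrow> nat \<Rightarrow> nat"
  where "annular_dehn R n =
    Max {ann R u v | u v. length u + length v \<le> n \<and> conjugate_in R u v}"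

text \<open>The minima and the maximum above range over nonempty sets, and the latter is finite.\<close>

lemma word_class_one_iff:
  "word_class R u = \<one>\<^bsub>presented_group R\<^esub> \<longleftrightarrow> (\<exists>N. is_conj_prod R N u)"
proof -
  have inv_prod: "\<exists>ds. snd ` set ds \<subseteq> R \<union> winv ` R \<and> conj_prod ds = winv (conj_prod cs)"
    if "snd ` set cs \<subseteq> R \<union> winv ` R" for cs :: "('a wrd \<times> 'a wrd) list"
    using that
  proof (induction cs)
    case Nil
    show ?case by (intro exI[of _ "[]"]) (simp add: conj_prod_def)
  next
    case (Cons c cs)
    then obtain ds where ds: "snd ` set ds \<subseteq> R \<union> winv ` R" "conj_prod ds = winv (conj_prod cs)"
      by auto
    obtain w r where c: "c = (w, r)" by force
    have "winv r \<in> R \<union> winv ` R" using Cons.prems c by auto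
    with ds c show ?case
      by (intro exI[of _ "ds @ [(w, winv r)]"]) (auto simp: conj_prod_def)
  qed
  have append_prod: "conj_prod (cs @ ds) = conj_prod cs @ conj_prod ds"
    for cs ds :: "('a wrd \<times> 'a wrd) list"
    by (simp add: conj_prod_def)
  have "\<exists>cs. snd ` set cs \<subseteq> R \<union> winv ` R \<and> word_equiv {} u (conj_prod cs @ v)"
    if "word_equiv R u v" for u v
    using that
  proof (induction rule: word_equiv.induct)
    case (refl u)
    show ?case by (intro exI[of _ "[]"]) (simp add: conj_prod_def word_equiv.refl)
  next
    case (sym u v)
    then obtain cs where cs: "snd ` set cs \<subseteq> R \<union> winv ` R" "word_equiv {} u (conj_prod cs @ v)"
      by blast
    obtain ds where ds: "snd ` set ds \<subseteq> R \<union> winv ` R" "conj_prod ds = winv (conj_prod cs)"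
      using inv_prod cs(1) by blast
    have "word_equiv {} (conj_prod ds @ u) (conj_prod ds @ conj_prod cs @ v)"
      by (rule word_equiv_append[OF word_equiv.refl cs(2)])
    moreover have "word_equiv {} (conj_prod ds @ conj_prod cs @ v) v"
      using word_equiv_append[OF word_equiv_left_inverse word_equiv.refl, of "{}" "conj_prod cs" v] ds
      by simp
    ultimately show ?case using ds(1) by (meson word_equiv.sym word_equiv.trans)
  next
    case (trans u v w)
    then obtain cs ds where "snd ` set cs \<subseteq> R \<union> winv ` R" "word_equiv {} u (conj_prod cs @ v)"
      "snd ` set ds \<subseteq> R \<union> winv ` R" "word_equiv {} v (conj_prod ds @ w)"
      by blast
    then show ?case
      using word_equiv.trans[of "{}" u "conj_prod cs @ v" "conj_prod cs @ conj_prod ds @ w"]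
        word_equiv_append[OF word_equiv.refl, of "{}" v "conj_prod ds @ w" "conj_prod cs"]
      by (intro exI[of _ "cs @ ds"]) (simp add: append_prod image_Un)
  next
    case (cancel u x v)
    show ?case
      using word_equiv.cancel[of "{}" u x v] by (intro exI[of _ "[]"]) (simp add: conj_prod_def)
  next
    case (relator r u v)
    have "word_equiv {} ((u @ r) @ winv u @ u @ v) ((u @ r) @ v)"
      using word_equiv_context[OF word_equiv_left_inverse, of "{}" "u @ r" u v] by simp
    then show ?case using relator
      by (intro exI[of _ "[(winv u, r)]"]) (simp add: conj_prod_def word_equiv.sym)
  qed
  from this[of u "[]"]
  have "\<exists>N. is_conj_prod R N u" if "word_equiv R u []"
    using that by (auto simp: is_conj_prod_def word_class_eq_iff)
  moreover have "word_equiv R u []" if "is_conj_prod R N u" for N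
  proof -
    obtain cs where cs: "snd ` set cs \<subseteq> R \<union> winv ` R" "word_equiv {} u (conj_prod cs)"
      using \<open>is_conj_prod R N u\<close> by (auto simp: is_conj_prod_def word_class_eq_iff)
    have mono: "word_equiv R x y" if "word_equiv {} x y" for x y
      using that
    proof (induction rule: word_equiv.induct)
      case (trans u v w)
      show ?case by (rule word_equiv.trans[OF trans.IH])
    next
      case (cancel u x v)
      show ?case by (rule word_equiv.cancel)
    qed (simp_all add: word_equiv.refl word_equiv.sym)
    have rel: "word_equiv R r []" if "r \<in> R" for r
      using word_equiv.relator[OF that, of "[]" "[]"] by simp
    have rel_inv: "word_equiv R (winv r) []" if "r \<in> R" for r
    proof (rule word_equiv.trans[OF word_equiv.sym word_equiv_left_inverse[of R r]])
      show "word_equiv R (winv r @ r) (winv r)"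
        using word_equiv_append[OF word_equiv.refl rel[OF that], of "winv r"] by simp
    qed
    have "word_equiv R (conj_prod cs) []"
      using cs(1)
    proof (induction cs)
      case Nil
      show ?case by (simp add: conj_prod_def word_equiv.refl)
    next
      case (Cons c cs)
      obtain w r where c: "c = (w, r)" by force
      have "word_equiv R r []" using Cons.prems c rel rel_inv by auto
      then have "word_equiv R (winv w @ r @ w) []"
        using word_equiv_context[of R r "[]" "winv w" w] word_equiv_left_inverse[of R w]
        by (simp add: word_equiv.trans[where v = "winv w @ w"])
      with Cons show ?case
        using word_equiv_append[of R "winv w @ r @ w" "[]" "conj_prod cs" "[]"]
        by (simp add: conj_prod_def c)
    qed
    then show ?thesis using mono[OF cs(2)] word_equiv.trans by blast
  qed
  ultimately show ?thesis by (auto simp: one_presented_group word_class_eq_iff)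
qed

lemma conjugate_in_iff:
  "conjugate_in R u v \<longleftrightarrow> (\<exists>w. word_class R (u @ w) = word_class R (w @ v))"
proof -
  interpret group "presented_group R" by (rule group_presented_group)
  have "inv\<^bsub>presented_group R\<^esub> g \<otimes>\<^bsub>presented_group R\<^esub> x \<otimes>\<^bsub>presented_group R\<^esub> g = y
      \<longleftrightarrow> x \<otimes>\<^bsub>presented_group R\<^esub> g = g \<otimes>\<^bsub>presented_group R\<^esub> y"
    if "g \<in> carrier (presented_group R)" "x \<in> carrier (presented_group R)"
      "y \<in> carrier (presented_group R)" for g x y
    using that by (metis inv_closed inv_solve_left m_assoc m_closed)
  then show ?thesis
    by (simp add: conjugate_in_def carrier_presented_group mult_word_class)
qed

lemma annular_dehn_set:
  fixes R :: "('a::finite) wrd set"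
  shows "finite {ann R u v | u v. length u + length v \<le> n \<and> conjugate_in R u v}"
    and "{ann R u v | u v. length u + length v \<le> n \<and> conjugate_in R u v} \<noteq> {}"
proof -
  let ?W = "{u :: 'a wrd. set u \<subseteq> UNIV \<and> length u \<le> n}"
  have "finite ?W" by (rule finite_lists_length_le) simp
  then have "finite ((\<lambda>(u, v). ann R u v) ` (?W \<times> ?W))" by blast
  then show "finite {ann R u v | u v. length u + length v \<le> n \<and> conjugate_in R u v}"
    by (rule rev_finite_subset) auto
  have "conjugate_in R [] []" by (auto simp: conjugate_in_iff)
  then show "{ann R u v | u v. length u + length v \<le> n \<and> conjugate_in R u v} \<noteq> {}"
    by (metis (mono_tags, lifting) add_0 empty_iff le0 list.size(3) mem_Collect_eq)
qed

definition growth_le :: "(nat \<Rightarrow> real) \<Rightarrow> (nat \<Rightarrow> real) \<Rightarrow> bool"  (infix "\<lesssim>" 50)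
  where "f \<lesssim> g \<longleftrightarrow>
    (\<exists>C::nat. C > 0 \<and> (\<forall>n. f n \<le> real C * g (C * n + n) + real C * real n + real C))"

definition growth_equiv :: "(nat \<Rightarrow> real) \<Rightarrow> (nat \<Rightarrow> real) \<Rightarrow> bool"  (infix "\<simeq>" 50)
  where "f \<simeq> g \<longleftrightarrow> f \<lesssim> g \<and> g \<lesssim> f"

datatype gen = Gen_a | Gen_b | Gen_s | Gen_t

instance gen :: finite
proof
  have "(UNIV :: gen set) = {Gen_a, Gen_b, Gen_s, Gen_t}"
    using gen.exhaust by blast
  then show "finite (UNIV :: gen set)" by (metis finite.emptyI finite.insertI)
qed

definition gpow :: "gen \<Rightarrow> nat \<Rightarrow> gen wrd"
  where "gpow x k = replicate k (x, True)"

definition commutator :: "'a wrd \<Rightarrow> 'a wrd \<Rightarrow> 'a wrd"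
  where "commutator x y = winv x @ winv y @ x @ y"

text \<open>A relation \<open>u = v\<close> is turned into the relator \<open>u v\<^sup>-\<^sup>1\<close>.\<close>

definition B_relators :: "nat \<Rightarrow> nat \<Rightarrow> gen wrd set"
  where "B_relators p q =
   (let a = gpow Gen_a; b = gpow Gen_b 1; s = gpow Gen_s 1; t = gpow Gen_t 1 in
    {commutator (a 1) b,
     winv s @ a q @ s @ winv (a p @ b),
     winv t @ a q @ t @ winv (a p @ winv b)})"

end

theory Submission
  imports Defs "HOL-Library.Product_Plus"
begin

text \<open>The group is a double HNN extension of the plane \<open>\<int>\<^sup>2 = \<langle>a, b\<rangle>\<close>. Since
\<open>s\<inverse> a^(qm) s\<close> and \<open>t\<inverse> a^(qm) t\<close> are \<open>(a^p b)^m\<close> and \<open>(a^p b\<inverse>)^m\<close>, their product is \<open>a^(2pm)\<close>: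
doubling the length of a word multiplies the exponent of \<open>a\<close> by \<open>2p/q = 2^\<alpha>\<close>, so words of length
\<open>n\<close> reach distance about \<open>n^\<alpha>\<close> in the plane, and loops of length \<open>n\<close> can enclose area \<open>n^(2\<alpha>)\<close>.

\<^emph>\<open>Lower bound.\<close> A pair \<open>(u, 1)\<close> with \<open>u = 1\<close> in the group has annular area equal to the area of
\<open>u\<close>. Take for \<open>u\<close> the commutator of short words representing \<open>a^(qm)\<close> and \<open>(a^p b)^m\<close>. The group has a central
extension in which \<open>[a, b]\<close> becomes a central element of infinite order and the other two relations
persist; it is realized by permutations of \<open>\<int>\<^sup>3\<close>. There \<open>u\<close> acts as the \<open>q m\<^sup>2\<close>-th power of the central
element, while each relator contributes at most one such factor, so the area of \<open>u\<close> is at least \<open>q m\<^sup>2\<close>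
(\<open>snowflake_commutator_area\<close>).

\<^emph>\<open>Distortion and area.\<close> Call a word visibly planar if it is built from \<open>a\<close>, \<open>b\<close> by concatenation and by
passing elements of an edge group through a stable letter. There is a norm on the plane that is subadditive and
exactly invariant under the edge isomorphisms; it is at most twice the length of such a word, and it
is comparable to the \<open>1/\<alpha>\<close>-th power of the usual norm (\<open>plane_val_bounds\<close>). Writing points of the
plane in coordinates adapted to two edge directions at a time, a visibly planar word of length \<open>n\<close> is reduced to
\<open>a^i b^j\<close> with \<open>O(n^(2\<alpha>))\<close> relators by a plain induction (\<open>cost_plane_val\<close>): joining pieces of
lengths \<open>x\<close>, \<open>y\<close> costs \<open>O(x^\<alpha> y^\<alpha>)\<close>, which the square of \<open>(x + y)^\<alpha> \<ge> x^\<alpha> + y^\<alpha>\<close> absorbs.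

\<^emph>\<open>Upper bound.\<close> After a cyclic rotation, each word is either visibly planar or a cyclic
sequence of stable letters, without pinches, separated by visibly planar words (\<open>word_cyc_reduce\<close>). Normal
forms for HNN extensions show that conjugate words are of the same kind. Two conjugate elements of the plane are
equal or correspond under edge isomorphisms (\<open>plane_conjugate\<close>), and
the annulus between them has area quadratic in their size. Two conjugate cyclic sequences can be rotated so that they are joined by a ladder of
edge group elements (\<open>hyperbolic_conjugate\<close>). Consecutive rungs in parallel
edge directions differ by at most the size of the planar syllables in between, and transverse ones are bounded by
it. So one transverse pair bounds every rung of the ladder, and if there is none,
all rungs can be shifted together until one of them is trivial. In both cases a ladder with rungs of size
\<open>O(n^\<alpha>)\<close> exists, and it fills the annulus with \<open>O(n^(2\<alpha>))\<close> relators (\<open>cost_ladder\<close>).\<close>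

declare word_equiv.trans [trans]

section \<open>Equality of words\<close>

lemma word_equiv_commute: "word_equiv R u v \<longleftrightarrow> word_equiv R v u"
  using word_equiv.sym by blast

lemma word_equiv_winv:
  assumes "word_equiv R u v"
  shows "word_equiv R (winv u) (winv v)"
proof -
  have "word_equiv R (winv u @ v @ winv v) (winv u)"
    using word_equiv_append[OF word_equiv.refl word_equiv_right_inverse, of R "winv u" v] by simp
  moreover have "word_equiv R (winv u @ u @ winv v) (winv u @ v @ winv v)"
    using word_equiv_context[OF assms] .
  moreover have "word_equiv R (winv u @ u @ winv v) (winv v)"
    using word_equiv_append[OF word_equiv_left_inverse word_equiv.refl, of R u "winv v"] by simp
  ultimately show ?thesis by (meson word_equiv.sym word_equiv.trans)
qed

lemma word_equiv_cancels:
  "word_equiv R (x @ winv x @ y) y" "word_equiv R (winv x @ x @ y) y"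
  "word_equiv R (y @ x @ winv x) y" "word_equiv R (y @ winv x @ x) y"
  using word_equiv_context[OF word_equiv_right_inverse[of R x], of "[]" y]
    word_equiv_context[OF word_equiv_left_inverse[of R x], of "[]" y]
    word_equiv_context[OF word_equiv_right_inverse[of R x], of y "[]"]
    word_equiv_context[OF word_equiv_left_inverse[of R x], of y "[]"]
  by simp_all

lemma word_equiv_move_left:
  "word_equiv R (x @ u) v \<longleftrightarrow> word_equiv R u (winv x @ v)"
proof
  assume "word_equiv R (x @ u) v"
  then have "word_equiv R (winv x @ x @ u) (winv x @ v)"
    by (rule word_equiv_append[OF word_equiv.refl])
  then show "word_equiv R u (winv x @ v)"
    by (meson word_equiv_cancels(2) word_equiv.sym word_equiv.trans)
next
  assume "word_equiv R u (winv x @ v)"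
  then have "word_equiv R (x @ u) (x @ winv x @ v)"
    by (rule word_equiv_append[OF word_equiv.refl])
  then show "word_equiv R (x @ u) v"
    by (meson word_equiv_cancels(1) word_equiv.sym word_equiv.trans)
qed

section \<open>Counting relators\<close>

lemma conj_prod_simps [simp]:
  "conj_prod [] = []" "conj_prod ((w, r) # cs) = winv w @ r @ w @ conj_prod cs"
  "conj_prod (cs @ ds) = conj_prod cs @ conj_prod ds"
  by (simp_all add: conj_prod_def)

lemma is_conj_prodI:
  "length cs = N \<Longrightarrow> snd ` set cs \<subseteq> R \<union> winv ` R \<Longrightarrow> word_equiv {} u (conj_prod cs) \<Longrightarrow>
     is_conj_prod R N u"
  by (auto simp: is_conj_prod_def word_class_eq_iff)

lemma is_conj_prodE:
  assumes "is_conj_prod R N u"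
  obtains cs where "length cs = N" "snd ` set cs \<subseteq> R \<union> winv ` R" "word_equiv {} u (conj_prod cs)"
  using assms by (auto simp: is_conj_prod_def word_class_eq_iff)

lemma is_conj_prod_free:
  assumes "is_conj_prod R N u" "word_equiv {} u v"
  shows "is_conj_prod R N v"
  using assms(1) by (rule is_conj_prodE)
    (rule is_conj_prodI, assumption+, rule word_equiv.trans[OF word_equiv.sym[OF assms(2)]])

lemma is_conj_prod_append:
  assumes "is_conj_prod R N u" "is_conj_prod R M v"
  shows "is_conj_prod R (N + M) (u @ v)"
proof -
  obtain cs ds where "length cs = N" "snd ` set cs \<subseteq> R \<union> winv ` R" "word_equiv {} u (conj_prod cs)"
    "length ds = M" "snd ` set ds \<subseteq> R \<union> winv ` R" "word_equiv {} v (conj_prod ds)"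
    using assms by (meson is_conj_prodE)
  then show ?thesis
    by (intro is_conj_prodI[of "cs @ ds"]) (auto intro: word_equiv_append)
qed

lemma is_conj_prod_conj:
  assumes "is_conj_prod R N u"
  shows "is_conj_prod R N (winv x @ u @ x)"
proof -
  obtain cs where cs: "length cs = N" "snd ` set cs \<subseteq> R \<union> winv ` R" "word_equiv {} u (conj_prod cs)"
    using assms by (meson is_conj_prodE)
  have "word_equiv {} (winv x @ conj_prod cs @ x) (conj_prod (map (\<lambda>(w, r). (w @ x, r)) cs))"
  proof (induction cs)
    case Nil
    then show ?case using word_equiv_left_inverse by simp
  next
    case (Cons c cs)
    obtain w r where c: "c = (w, r)" by force
    have "word_equiv {} (winv x @ winv w @ r @ w @ conj_prod cs @ x)
      (winv x @ winv w @ r @ w @ x @ winv x @ conj_prod cs @ x)"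
      using word_equiv_context[OF word_equiv_right_inverse, of "{}" "winv x @ winv w @ r @ w" x
          "conj_prod cs @ x"] by (subst word_equiv_commute) simp
    also have "word_equiv {} \<dots>
       (winv x @ winv w @ r @ w @ x @ conj_prod (map (\<lambda>(w, r). (w @ x, r)) cs))"
      using word_equiv_append[OF word_equiv.refl Cons.IH, of "winv x @ winv w @ r @ w @ x"] by simp
    finally show ?case by (simp add: c)
  qed
  with cs(3) have "word_equiv {} (winv x @ u @ x) (conj_prod (map (\<lambda>(w, r). (w @ x, r)) cs))"
    by (meson word_equiv_context word_equiv.trans)
  then show ?thesis using cs(1,2) by (intro is_conj_prodI) (auto simp: image_image split_beta)
qed

lemma is_conj_prod_winv:
  assumes "is_conj_prod R N u"
  shows "is_conj_prod R N (winv u)"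
proof -
  obtain cs where cs: "length cs = N" "snd ` set cs \<subseteq> R \<union> winv ` R" "word_equiv {} u (conj_prod cs)"
    using assms by (meson is_conj_prodE)
  have "winv (conj_prod cs) = conj_prod (rev (map (\<lambda>(w, r). (w, winv r)) cs))"
    by (induction cs) (auto)
  then have "word_equiv {} (winv u) (conj_prod (rev (map (\<lambda>(w, r). (w, winv r)) cs)))"
    using word_equiv_winv[OF cs(3)] by simp
  then show ?thesis using cs(1,2)
    by (intro is_conj_prodI) (auto simp: image_image split_beta image_subset_iff)
qed

text \<open>The area of a diagram between two words, as a relation. The bound is real-valued because all
estimates below are multiples of powers \<open>n^(2\<alpha>)\<close>; as a three-place relation it composes along chains of
equalities and is monotone under context.\<close>

definition rel_cost :: "'a wrd set \<Rightarrow> real \<Rightarrow> 'a wrd \<Rightarrow> 'a wrd \<Rightarrow> bool"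
  where "rel_cost R c u v \<longleftrightarrow> (\<exists>N. real N \<le> c \<and> is_conj_prod R N (u @ winv v))"

lemma rel_cost_mono: "rel_cost R c u v \<Longrightarrow> c \<le> d \<Longrightarrow> rel_cost R d u v"
  unfolding rel_cost_def by (meson order_trans)

lemma rel_cost_free:
  assumes "word_equiv {} u v"
  shows "rel_cost R 0 u v"
proof -
  have "word_equiv {} (u @ winv v) (v @ winv v)"
    using word_equiv_append[OF assms word_equiv.refl] .
  then have "is_conj_prod R 0 (u @ winv v)"
    by (intro is_conj_prodI[of "[]"]) (auto intro: word_equiv.trans word_equiv_right_inverse)
  then show ?thesis unfolding rel_cost_def by (metis of_nat_0 order_refl)
qed

lemma rel_cost_refl: "rel_cost R 0 u u"
  by (simp add: rel_cost_free word_equiv.refl)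

lemma rel_cost_relator:
  assumes "u @ winv v \<in> R"
  shows "rel_cost R 1 u v"
proof -
  have "is_conj_prod R 1 (u @ winv v)"
    using assms by (intro is_conj_prodI[of "[([], u @ winv v)]"]) (auto simp: word_equiv.refl)
  then show ?thesis unfolding rel_cost_def by (metis of_nat_1 order_refl)
qed

lemma rel_cost_sym:
  assumes "rel_cost R c u v"
  shows "rel_cost R c v u"
  using assms is_conj_prod_winv unfolding rel_cost_def by fastforce

lemma rel_cost_trans [trans]:
  assumes "rel_cost R c u v" "rel_cost R d v w"
  shows "rel_cost R (c + d) u w"
proof -
  obtain N M where *: "real N \<le> c" "is_conj_prod R N (u @ winv v)"
    "real M \<le> d" "is_conj_prod R M (v @ winv w)"
    using assms unfolding rel_cost_def by blast
  have "is_conj_prod R (N + M) (u @ winv w)"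
    by (rule is_conj_prod_free[OF is_conj_prod_append[OF *(2,4)]])
       (use word_equiv_context[OF word_equiv_left_inverse, of "{}" u v "winv w"] in simp)
  then show ?thesis unfolding rel_cost_def using *(1,3) by (intro exI[of _ "N + M"]) simp
qed

text \<open>The relators are conjugated by the left context, so surrounding words are free of charge.\<close>

lemma rel_cost_context:
  assumes "rel_cost R c u v"
  shows "rel_cost R c (x @ u @ y) (x @ v @ y)"
proof -
  obtain N where *: "real N \<le> c" "is_conj_prod R N (u @ winv v)"
    using assms unfolding rel_cost_def by blast
  have "is_conj_prod R N (x @ (u @ winv v) @ winv x)"
    using is_conj_prod_conj[OF *(2), of "winv x"] by simp
  moreover have "word_equiv {} (x @ (u @ winv v) @ winv x) ((x @ u @ y) @ winv (x @ v @ y))"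
    using word_equiv_context[OF word_equiv_right_inverse, of "{}" "x @ u" y "winv v @ winv x"]
    by (subst word_equiv_commute) simp
  ultimately have "is_conj_prod R N ((x @ u @ y) @ winv (x @ v @ y))"
    by (rule is_conj_prod_free)
  then show ?thesis unfolding rel_cost_def using *(1) by blast
qed

lemma rel_cost_append:
  assumes "rel_cost R c u u'" "rel_cost R d v v'"
  shows "rel_cost R (c + d) (u @ v) (u' @ v')"
proof -
  have "rel_cost R c (u @ v) (u' @ v)" using rel_cost_context[OF assms(1), of "[]" v] by simp
  also have "rel_cost R d \<dots> (u' @ v')" using rel_cost_context[OF assms(2), of u' "[]"] by simp
  finally show ?thesis .
qed

lemma rel_cost_imp_word_equiv:
  assumes "rel_cost R c u v"
  shows "word_equiv R u v"
proof -
  have "word_equiv R (u @ winv v) []"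
    using assms word_class_one_iff[of R "u @ winv v"]
    by (auto simp: rel_cost_def one_presented_group word_class_eq_iff)
  then have "word_equiv R (u @ winv v @ v) v"
    using word_equiv_append[OF _ word_equiv.refl, of R "u @ winv v" "[]" v] by simp
  then show ?thesis by (meson word_equiv_cancels(4) word_equiv.sym word_equiv.trans)
qed

lemma area_le_iff_rel_cost:
  assumes "word_equiv R u v"
  shows "real (area R (u @ winv v)) \<le> c \<longleftrightarrow> rel_cost R c u v"
proof
  have "word_equiv R (u @ winv v) (v @ winv v)"
    by (rule word_equiv_append[OF assms word_equiv.refl])
  then have "word_class R (u @ winv v) = \<one>\<^bsub>presented_group R\<^esub>"
    by (simp add: one_presented_group word_class_eq_iff)
       (meson word_equiv.trans word_equiv_right_inverse)
  then have "is_conj_prod R (area R (u @ winv v)) (u @ winv v)"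
    unfolding area_def using word_class_one_iff LeastI_ex by metis
  then show "real (area R (u @ winv v)) \<le> c \<Longrightarrow> rel_cost R c u v"
    unfolding rel_cost_def by blast
next
  assume "rel_cost R c u v"
  then obtain N where "real N \<le> c" "is_conj_prod R N (u @ winv v)"
    by (auto simp: rel_cost_def)
  then show "real (area R (u @ winv v)) \<le> c"
    unfolding area_def by (meson Least_le of_nat_le_iff order_trans)
qed

text \<open>The same for annular diagrams: the costs of successive conjugations add up, and rotating a word
is free.\<close>

definition conj_cost :: "'a wrd set \<Rightarrow> real \<Rightarrow> 'a wrd \<Rightarrow> 'a wrd \<Rightarrow> bool"
  where "conj_cost R c u v \<longleftrightarrow> (\<exists>w. rel_cost R c (u @ w) (w @ v))"

lemma conj_cost_mono: "conj_cost R c u v \<Longrightarrow> c \<le> d \<Longrightarrow> conj_cost R d u v"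
  unfolding conj_cost_def using rel_cost_mono by blast

lemma conj_cost_rel_cost: "rel_cost R c u v \<Longrightarrow> conj_cost R c u v"
  unfolding conj_cost_def by (intro exI[of _ "[]"]) simp

lemma conj_cost_sym:
  assumes "conj_cost R c u v"
  shows "conj_cost R c v u"
proof -
  obtain w where w: "rel_cost R c (u @ w) (w @ v)" using assms unfolding conj_cost_def by blast
  have "rel_cost R 0 (v @ winv w) (winv w @ (w @ v) @ winv w)"
    by (rule rel_cost_free, rule word_equiv.sym) (simp add: word_equiv_cancels)
  also have "rel_cost R c \<dots> (winv w @ (u @ w) @ winv w)"
    by (rule rel_cost_context[OF rel_cost_sym[OF w]])
  also have "rel_cost R 0 \<dots> (winv w @ u)"
    using word_equiv_cancels(3)[of _ "winv w @ u" w] by (simp add: rel_cost_free)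
  finally show ?thesis unfolding conj_cost_def by auto
qed

lemma conj_cost_trans [trans]:
  assumes "conj_cost R c u v" "conj_cost R d v w"
  shows "conj_cost R (c + d) u w"
proof -
  obtain x y where xy: "rel_cost R c (u @ x) (x @ v)" "rel_cost R d (v @ y) (y @ w)"
    using assms unfolding conj_cost_def by blast
  have "rel_cost R c (u @ x @ y) (x @ v @ y)"
    using rel_cost_context[OF xy(1), of "[]" y] by simp
  also have "rel_cost R d \<dots> (x @ y @ w)"
    using rel_cost_context[OF xy(2), of x "[]"] by simp
  finally show ?thesis unfolding conj_cost_def by (intro exI[of _ "x @ y"]) simp
qed

lemma conj_cost_rotate: "conj_cost R 0 (x @ y) (y @ x)"
  unfolding conj_cost_def by (intro exI[of _ x]) (simp add: rel_cost_refl)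

lemma ann_le_of_conj_cost:
  assumes "conj_cost R c u v"
  shows "real (ann R u v) \<le> c"
proof -
  obtain w where w: "rel_cost R c (u @ w) (w @ v)" using assms unfolding conj_cost_def by blast
  have 1: "word_equiv R (u @ w) (w @ v)" by (rule rel_cost_imp_word_equiv[OF w])
  have "rel_cost R 0 (winv w @ u @ w) (winv w @ (u @ w))" by (simp add: rel_cost_refl)
  also have "rel_cost R c \<dots> (winv w @ (w @ v))" using rel_cost_context[OF w, of "winv w" "[]"] by simp
  also have "rel_cost R 0 \<dots> v"
    by (simp add: rel_cost_free word_equiv_cancels(2))
  finally have 2: "rel_cost R c (winv w @ u @ w) v" by simp
  have "real (area R (winv w @ u @ w @ winv v)) \<le> c"
    using area_le_iff_rel_cost[OF rel_cost_imp_word_equiv[OF 2]] 2 by simp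
  moreover have "ann R u v \<le> area R (winv w @ u @ w @ winv v)"
    unfolding ann_def using 1 by (intro Least_le) (auto simp: word_class_eq_iff)
  ultimately show ?thesis by linarith
qed

text \<open>If \<open>u = 1\<close> then every \<open>w\<close> conjugates \<open>u\<close> to the empty word, and \<open>w\<inverse> u w\<close> has the same area as \<open>u\<close>:
an annulus with one trivial boundary is a disc. Lower bounds on areas of discs are therefore lower
bounds on areas of annuli.\<close>

lemma area_le_ann_Nil:
  assumes "word_equiv R u []"
  shows "area R u \<le> ann R u []"
proof -
  let ?P = "\<lambda>N. \<exists>w. word_class R (u @ w) = word_class R (w @ []) \<and>
       area R (winv w @ u @ w @ winv []) = N"
  have "?P (area R u)"
    using assms by (intro exI[of _ "[]"]) (simp add: word_class_eq_iff)
  then have "?P (ann R u [])" unfolding ann_def by (rule LeastI)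
  then obtain w where w: "word_equiv R (u @ w) w" "area R (winv w @ u @ w) = ann R u []"
    by (auto simp: word_class_eq_iff)
  have "word_equiv R (winv w @ u @ w) []"
    using w(1) word_equiv_move_left[of R "winv w"] by simp
  then have "rel_cost R (ann R u []) (winv w @ u @ w) []"
    using area_le_iff_rel_cost[of R "winv w @ u @ w" "[]" "ann R u []"] w(2) by simp
  then have "is_conj_prod R (ann R u []) (winv w @ u @ w) \<or> (\<exists>N\<le>ann R u []. is_conj_prod R N (winv w @ u @ w))"
    by (auto simp: rel_cost_def)
  then obtain N where N: "N \<le> ann R u []" "is_conj_prod R N (winv w @ u @ w)" by blast
  have "is_conj_prod R N (w @ (winv w @ u @ w) @ winv w)"
    using is_conj_prod_conj[OF N(2), of "winv w"] by simp
  moreover have "word_equiv {} (w @ (winv w @ u @ w) @ winv w) u"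
    using word_equiv_cancels(1)[of "{}" w "u @ w @ winv w"] word_equiv_cancels(3)[of "{}" u w]
    by (auto intro: word_equiv.trans)
  ultimately have "is_conj_prod R N u" by (rule is_conj_prod_free)
  then have "area R u \<le> N" unfolding area_def by (rule Least_le)
  with N(1) show ?thesis by simp
qed


section \<open>Powers of words\<close>

definition wpow :: "'a wrd \<Rightarrow> int \<Rightarrow> 'a wrd"
  where "wpow w m = (if 0 \<le> m then concat (replicate (nat m) w)
    else concat (replicate (nat (- m)) (winv w)))"

lemma wpow_0 [simp]: "wpow w 0 = []"
  and wpow_1 [simp]: "wpow w 1 = w"
  and wpow_minus_1 [simp]: "wpow w (- 1) = winv w"
  by (simp_all add: wpow_def)

lemma concat_replicate_snoc: "concat (replicate k w) @ w = concat (replicate (Suc k) w)"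
  by (induction k) auto

lemma length_wpow: "length (wpow w m) = nat \<bar>m\<bar> * length w"
  by (auto simp: wpow_def length_concat sum_list_replicate winv_def)

lemma wpow_step:
  "word_equiv R (wpow w m @ w) (wpow w (m + 1))" "word_equiv R (wpow w m @ winv w) (wpow w (m - 1))"
proof -
  have neg: "word_equiv R (wpow x m @ y) (wpow x (m + d))"
    if "m = 0 \<or> sgn m = - d" "\<bar>d\<bar> = 1" "y = wpow x d" for m d :: int and x y :: "'a wrd"
  proof (cases "m = 0")
    case True
    then show ?thesis using that by (simp add: word_equiv.refl)
  next
    case False
    then have s: "sgn m = - d" using that by simp
    define k where "k = nat (\<bar>m\<bar> - 1)"
    define z where "z = wpow x (- d)"
    have z: "d = 1 \<and> z = winv x \<and> y = x \<or> d = - 1 \<and> z = x \<and> y = winv x"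
      using that by (auto simp: z_def abs_if split: if_splits)
    then have zy: "y = winv z" by auto
    have "wpow x m = concat (replicate k z) @ z" "wpow x (m + d) = concat (replicate k z)"
      using s that(1) z False unfolding concat_replicate_snoc
      by (auto simp: wpow_def k_def sgn_if abs_if nat_diff_distrib Suc_nat_eq_nat_zadd1
            split: if_splits simp del: replicate_Suc)
    then show ?thesis by (simp add: zy word_equiv_cancels)
  qed
  have pos: "wpow x m @ wpow x d = wpow x (m + d)" if "sgn m = d" "\<bar>d\<bar> = 1" for m d :: int and x :: "'a wrd"
  proof -
    have "nat \<bar>m + d\<bar> = Suc (nat \<bar>m\<bar>)" using that by (auto simp: abs_if sgn_if split: if_splits)
    moreover have "concat (replicate (Suc 0) y) = y" for y :: "'a wrd" by simp
    ultimately show ?thesis using that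
      by (auto simp: wpow_def concat_replicate_snoc abs_if sgn_if split: if_splits simp del: replicate_Suc)
  qed
  show "word_equiv R (wpow w m @ w) (wpow w (m + 1))"
    using neg[of m 1 w w] pos[of m 1 w] by (cases "0 < m") (auto simp: word_equiv.refl sgn_if)
  show "word_equiv R (wpow w m @ winv w) (wpow w (m - 1))"
    using neg[of m "-1" "winv w" w] neg[of m "-1" w "winv w"] pos[of m "-1" w]
    by (cases "m < 0") (auto simp: word_equiv.refl sgn_if)
qed

lemma wpow_add: "word_equiv R (wpow w m @ wpow w n) (wpow w (m + n))"
proof (induction n rule: int_induct[of _ 0])
  case base
  show ?case by (simp add: word_equiv.refl)
next
  case (step1 n)
  have "word_equiv R (wpow w m @ wpow w (n + 1)) ((wpow w m @ wpow w n) @ w)"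
    using word_equiv_append[OF word_equiv.refl word_equiv.sym[OF wpow_step(1)]] by simp
  also have "word_equiv R \<dots> (wpow w (m + n) @ w)"
    by (rule word_equiv_append[OF step1.IH word_equiv.refl])
  also have "word_equiv R \<dots> (wpow w (m + n + 1))" by (rule wpow_step)
  finally show ?case by (simp add: algebra_simps)
next
  case (step2 n)
  have "word_equiv R (wpow w m @ wpow w (n - 1)) ((wpow w m @ wpow w n) @ winv w)"
    using word_equiv_append[OF word_equiv.refl word_equiv.sym[OF wpow_step(2)]] by simp
  also have "word_equiv R \<dots> (wpow w (m + n) @ winv w)"
    by (rule word_equiv_append[OF step2.IH word_equiv.refl])
  also have "word_equiv R \<dots> (wpow w (m + n - 1))" by (rule wpow_step)
  finally show ?case by (simp add: algebra_simps)
qed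

text \<open>A corridor: the word \<open>s\<close> passes the factors of the power one at a time.\<close>

lemma rel_cost_wpow_slide:
  assumes "rel_cost R c (x @ s) (s @ y)"
  shows "rel_cost R (c * \<bar>real_of_int m\<bar>) (wpow x m @ s) (s @ wpow y m)"
proof -
  have nat: "rel_cost R (c * real k) (concat (replicate k x) @ s) (s @ concat (replicate k y))"
    if "rel_cost R c (x @ s) (s @ y)" for k and x y :: "'a wrd"
  proof (induction k)
    case 0
    show ?case by (simp add: rel_cost_refl)
  next
    case (Suc k)
    have "rel_cost R (c * real k) (concat (replicate (Suc k) x) @ s) (x @ s @ concat (replicate k y))"
      using rel_cost_context[OF Suc.IH, of x "[]"] by simp
    also have "rel_cost R c \<dots> (s @ y @ concat (replicate k y))"
      using rel_cost_context[OF that, of "[]"] by simp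
    finally show ?case by (simp add: algebra_simps)
  qed
  have "rel_cost R 0 (winv x @ s) (winv x @ (s @ y) @ winv y)"
    by (rule rel_cost_free, rule word_equiv.sym)
       (use word_equiv_cancels(3)[of "{}" "winv x @ s" y] in simp)
  also have "rel_cost R c \<dots> (winv x @ (x @ s) @ winv y)"
    by (rule rel_cost_context[OF rel_cost_sym[OF assms]])
  also have "rel_cost R 0 \<dots> (s @ winv y)"
    by (rule rel_cost_free) (simp add: word_equiv_cancels)
  finally have inv: "rel_cost R c (winv x @ s) (s @ winv y)" by simp
  show ?thesis using nat[OF assms, of "nat m"] nat[OF inv, of "nat (- m)"]
    by (cases "0 \<le> m") (auto simp: wpow_def)
qed

text \<open>An \<open>m \<times> n\<close> rectangle of commutation cells.\<close>

lemma rel_cost_wpow_commute: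
  assumes "rel_cost R c (x @ y) (y @ x)"
  shows "rel_cost R (c * \<bar>real_of_int m\<bar> * \<bar>real_of_int n\<bar>)
    (wpow x m @ wpow y n) (wpow y n @ wpow x m)"
  by (rule rel_cost_sym[OF rel_cost_wpow_slide[OF rel_cost_sym[OF rel_cost_wpow_slide[OF assms]]]])

section \<open>The plane\<close>

type_synonym vec = "int \<times> int"

definition scl :: "int \<Rightarrow> vec \<Rightarrow> vec"
  where "scl m z = (m * fst z, m * snd z)"

lemma fst_scl [simp]: "fst (scl m z) = m * fst z"
  and snd_scl [simp]: "snd (scl m z) = m * snd z"
  by (simp_all add: scl_def)

lemma scl_simps [simp]: "scl 0 z = 0" "scl m 0 = 0" "scl 1 z = z" "scl (- m) z = - scl m z"
  "scl m (- z) = - scl m z"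
  by (simp_all add: prod_eq_iff)

lemma scl_distribs:
  "scl (m + n) z = scl m z + scl n z" "scl (m - n) z = scl m z - scl n z"
  "scl m (z + w) = scl m z + scl m w" "scl m (z - w) = scl m z - scl m w"
  by (simp_all add: prod_eq_iff algebra_simps)

text \<open>Stable letters have value zero so that \<open>bval\<close> is a homomorphism on all words; the value is meaningful for words in
\<open>a\<close> and \<open>b\<close>.\<close>

primrec letter_vec :: "gen \<Rightarrow> vec" where
  "letter_vec Gen_a = (1, 0)" | "letter_vec Gen_b = (0, 1)"
| "letter_vec Gen_s = 0" | "letter_vec Gen_t = 0"

fun bval :: "gen wrd \<Rightarrow> vec" where
  "bval [] = 0"
| "bval ((x, e) # w) = (if e then letter_vec x else - letter_vec x) + bval w"

lemma bval_append [simp]: "bval (u @ v) = bval u + bval v"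
  by (induction u rule: bval.induct) (auto simp: algebra_simps)

lemma bval_winv [simp]: "bval (winv u) = - bval u"
  by (induction u rule: bval.induct) (auto simp: algebra_simps flip_def)

lemma bval_concat_replicate [simp]: "bval (concat (replicate k w)) = scl (int k) (bval w)"
  by (induction k) (auto simp: scl_distribs)

lemma bval_wpow [simp]: "bval (wpow w m) = scl m (bval w)"
  by (auto simp: wpow_def)

definition base_word :: "gen wrd \<Rightarrow> bool"
  where "base_word w \<longleftrightarrow> fst ` set w \<subseteq> {Gen_a, Gen_b}"

lemma base_word_simps [simp]:
  "base_word []" "base_word (x # u) \<longleftrightarrow> fst x \<in> {Gen_a, Gen_b} \<and> base_word u"
  "base_word (u @ v) \<longleftrightarrow> base_word u \<and> base_word v"
  "base_word (winv u) \<longleftrightarrow> base_word u"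
  by (auto simp: base_word_def winv_def flip_def image_image)

lemma base_word_concat_replicate: "base_word w \<Longrightarrow> base_word (concat (replicate k w))"
  by (induction k) auto

lemma base_word_wpow: "base_word w \<Longrightarrow> base_word (wpow w m)"
  by (auto simp: wpow_def intro!: base_word_concat_replicate)

lemma gpow_simps [simp]: "base_word (gpow Gen_a k)" "base_word (gpow Gen_b k)"
  "bval (gpow x k) = scl (int k) (letter_vec x)" "length (gpow x k) = k"
  by (auto simp: gpow_def base_word_def, induction k, auto simp: scl_distribs)

abbreviation "wa \<equiv> [(Gen_a, True)]"
abbreviation "wb \<equiv> [(Gen_b, True)]"

definition plane_word :: "vec \<Rightarrow> gen wrd"
  where "plane_word z = wpow wa (fst z) @ wpow wb (snd z)"

lemma base_word_plane_word [simp]: "base_word (plane_word z)"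
  by (simp add: plane_word_def base_word_wpow)

lemma bval_plane_word [simp]: "bval (plane_word z) = z"
  by (simp add: plane_word_def prod_eq_iff)

definition vsize :: "vec \<Rightarrow> real"
  where "vsize z = \<bar>real_of_int (fst z)\<bar> + \<bar>real_of_int (snd z)\<bar>"

lemma vsize_nonneg [simp]: "0 \<le> vsize z"
  and vsize_0 [simp]: "vsize 0 = 0"
  and vsize_minus [simp]: "vsize (- z) = vsize z"
  and vsize_triangle: "vsize (z + w) \<le> vsize z + vsize w"
  and vsize_diff_triangle: "vsize (z - w) \<le> vsize z + vsize w"
  by (auto simp: vsize_def)

lemma length_plane_word: "real (length (plane_word z)) = vsize z"
  by (simp add: plane_word_def length_wpow vsize_def)

lemma vsize_bval_le: "vsize (bval w) \<le> real (length w)"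
proof (induction w rule: bval.induct)
  case (2 x e w)
  have "vsize (letter_vec x) \<le> 1" by (cases x) (auto simp: vsize_def)
  then show ?case using 2 vsize_triangle[of "letter_vec x" "bval w"]
      vsize_triangle[of "- letter_vec x" "bval w"] by auto
qed (auto simp: vsize_def)

locale snowflake =
  fixes p q :: nat
  assumes q_pos: "0 < q" and q_less_p: "q < p"
begin

abbreviation rels :: "gen wrd set" where "rels \<equiv> B_relators p q"
abbreviation cost :: "real \<Rightarrow> gen wrd \<Rightarrow> gen wrd \<Rightarrow> bool" where "cost \<equiv> rel_cost rels"

lemma cost_ab: "cost 1 (wa @ wb) (wb @ wa)"
proof -
  have "cost 0 (wa @ wb) ((wb @ wa) @ commutator wa wb)"
    unfolding commutator_def
    by (rule rel_cost_free, rule word_equiv.sym)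
       (use word_equiv.cancel[of "{}" "[(Gen_b, True)]" "(Gen_a, True)" "[(Gen_b, False), (Gen_a, True), (Gen_b, True)]"]
          word_equiv.cancel[of "{}" "[]" "(Gen_b, True)" "[(Gen_a, True), (Gen_b, True)]"]
        in \<open>auto simp: flip_def winv_def intro: word_equiv.trans\<close>)
  also have "cost 1 \<dots> ((wb @ wa) @ [])"
  proof -
    have "cost 1 (commutator wa wb) []"
      by (rule rel_cost_relator) (simp add: B_relators_def gpow_def Let_def)
    then show ?thesis using rel_cost_context[of rels 1 _ _ "wb @ wa" "[]"] by simp
  qed
  finally show ?thesis by simp
qed

text \<open>Sorting a word in \<open>a\<close> and \<open>b\<close> needs at most one commutation for each pair of letters.\<close>

lemma cost_sort_base_word:
  "base_word w \<Longrightarrow> cost ((real (length w))\<^sup>2) w (plane_word (bval w))"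
proof (induction w)
  case Nil
  then show ?case by (simp add: plane_word_def rel_cost_refl)
next
  case (Cons c w)
  obtain x e where c: "c = (x, e)" by force
  let ?z = "bval w"
  define d :: int where "d = (if e then 1 else -1)"
  have "cost ((real (length w))\<^sup>2) (c # w) ([c] @ plane_word ?z)"
    using rel_cost_context[of rels _ w _ "[c]" "[]"] Cons by simp
  also have "cost (real (length w)) \<dots> (plane_word (bval (c # w)))"
  proof (cases "x = Gen_a")
    case True
    have "[c] = wpow wa d" by (auto simp: d_def c True winv_def flip_def)
    moreover have "cost 0 (wpow wa d @ wpow wa (fst ?z)) (wpow wa (d + fst ?z))"
      by (rule rel_cost_free, rule wpow_add)
    ultimately have "cost 0 ([c] @ plane_word ?z) (plane_word (bval (c # w)))"
      using rel_cost_context[of rels 0 "wpow wa d @ wpow wa (fst ?z)" _ "[]" "wpow wb (snd ?z)"]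
      by (auto simp: c True plane_word_def d_def)
    then show ?thesis by (rule rel_cost_mono) simp
  next
    case False
    then have x: "x = Gen_b" using Cons.prems c by simp
    have cw: "[c] = wpow wb d" by (auto simp: d_def c x winv_def flip_def)
    have "cost \<bar>real_of_int (fst ?z)\<bar> ([c] @ wpow wa (fst ?z)) (wpow wa (fst ?z) @ [c])"
      using rel_cost_sym[OF rel_cost_wpow_commute[OF cost_ab, of "fst ?z" d]]
      by (simp add: cw) (simp add: d_def split: if_splits)
    from rel_cost_context[OF this, of "[]" "wpow wb (snd ?z)"]
    have "cost \<bar>real_of_int (fst ?z)\<bar> ([c] @ plane_word ?z)
        (wpow wa (fst ?z) @ wpow wb d @ wpow wb (snd ?z))"
      by (simp add: plane_word_def cw)
    also have "cost 0 \<dots> (wpow wa (fst ?z) @ wpow wb (d + snd ?z))"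
      by (rule rel_cost_free, rule word_equiv_append[OF word_equiv.refl wpow_add])
    also have "wpow wa (fst ?z) @ wpow wb (d + snd ?z) = plane_word (bval (c # w))"
      by (auto simp: c x plane_word_def d_def)
    finally show ?thesis
      using vsize_bval_le[of w] by (elim rel_cost_mono) (simp add: vsize_def)
  qed
  finally show ?case by (rule rel_cost_mono) (simp add: power2_eq_square algebra_simps)
qed

lemma cost_base_words:
  assumes "base_word u" "base_word v" "bval u = bval v" "real (length u) \<le> l" "real (length v) \<le> l"
  shows "cost (2 * l\<^sup>2) u v"
proof -
  have "cost ((real (length u))\<^sup>2 + (real (length v))\<^sup>2) u v"
    using rel_cost_trans[OF cost_sort_base_word[OF assms(1), unfolded assms(3)]
        rel_cost_sym[OF cost_sort_base_word[OF assms(2)]]] .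
  moreover have "(real (length u))\<^sup>2 \<le> l\<^sup>2" "(real (length v))\<^sup>2 \<le> l\<^sup>2"
    using assms by (simp_all add: power_mono)
  ultimately show ?thesis by (elim rel_cost_mono) linarith
qed

lemma word_equiv_base_words:
  "base_word u \<Longrightarrow> base_word v \<Longrightarrow> bval u = bval v \<Longrightarrow> word_equiv rels u v"
  by (rule rel_cost_imp_word_equiv[OF cost_base_words[of u v "max (real (length u)) (real (length v))"]]) auto

definition stable_letter :: "gen letter \<Rightarrow> bool"
  where "stable_letter e \<longleftrightarrow> fst e = Gen_s \<or> fst e = Gen_t"

lemma stable_letter_cases:
  assumes "stable_letter e"
  obtains "e = (Gen_s, True)" | "e = (Gen_t, True)" | "e = (Gen_s, False)" | "e = (Gen_t, False)"
  using assms by (cases e; cases "snd e") (auto simp: stable_letter_def)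

lemma stable_letter_flip [simp]: "stable_letter (flip e) = stable_letter e"
  by (simp add: stable_letter_def flip_def)

text \<open>The generator of the edge group on the left of the stable letter \<open>e\<close>; the one on the right belongs
to \<open>flip e\<close>. So \<open>a^q\<close> is on the left of \<open>s\<close> and \<open>t\<close>, and \<open>a^p b\<close> and \<open>a^p b\<inverse>\<close> are on the left of
\<open>s\<inverse>\<close> and \<open>t\<inverse>\<close>. With this convention all four letters obey the single relation of \<open>cost_edge\<close>.\<close>

definition edge_word :: "gen letter \<Rightarrow> gen wrd"
  where "edge_word e = (if snd e then gpow Gen_a q
    else gpow Gen_a p @ (if fst e = Gen_s then gpow Gen_b 1 else winv (gpow Gen_b 1)))"

definition edge_vec :: "gen letter \<Rightarrow> vec"
  where "edge_vec e = (if snd e then (int q, 0) else (int p, if fst e = Gen_s then 1 else - 1))"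

lemma edge_vec_simps [simp]:
  "edge_vec (x, True) = (int q, 0)" "edge_vec (Gen_s, False) = (int p, 1)"
  "edge_vec (Gen_t, False) = (int p, - 1)"
  by (simp_all add: edge_vec_def)

lemma bval_edge_word [simp]: "bval (edge_word e) = edge_vec e"
  by (auto simp: edge_word_def edge_vec_def prod_eq_iff)

lemma base_word_edge_word [simp]: "base_word (edge_word e)"
  by (auto simp: edge_word_def)

lemma length_edge_word_le: "length (edge_word e) \<le> p + 1"
  using q_less_p by (auto simp: edge_word_def winv_def)

lemma cost_edge:
  assumes "stable_letter e"
  shows "cost 1 (edge_word e @ [e]) ([e] @ edge_word (flip e))"
proof -
  have pos: "cost 1 (edge_word (x, True) @ [(x, True)]) ([(x, True)] @ edge_word (x, False)) \<and>
       cost 1 (edge_word (x, False) @ [(x, False)]) ([(x, False)] @ edge_word (x, True))"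
    if "stable_letter (x, True)" for x
  proof -
    let ?A = "edge_word (x, True)" and ?B = "edge_word (x, False)"
    have rel: "cost 1 ([(x, False)] @ ?A @ [(x, True)]) ?B"
      by (rule rel_cost_relator)
        (use that in \<open>auto simp: stable_letter_def B_relators_def Let_def edge_word_def gpow_def winv_def flip_def\<close>)
    have "cost 0 (?A @ [(x, True)]) ([(x, True)] @ [(x, False)] @ ?A @ [(x, True)])"
      by (rule rel_cost_free, rule word_equiv.sym)
         (use word_equiv.cancel[of "{}" "[]" "(x, True)" "?A @ [(x, True)]"] in \<open>simp add: flip_def\<close>)
    also have "cost 1 \<dots> ([(x, True)] @ ?B)"
      using rel_cost_context[OF rel, of "[(x, True)]" "[]"] by simp
    finally have 1: "cost 1 (?A @ [(x, True)]) ([(x, True)] @ ?B)" by simp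
    have "cost 1 (?B @ [(x, False)]) (([(x, False)] @ ?A) @ [(x, True), (x, False)])"
      using rel_cost_context[OF rel_cost_sym[OF rel], of "[]" "[(x, False)]"] by simp
    also have "cost 0 \<dots> ([(x, False)] @ ?A)"
      by (rule rel_cost_free)
         (use word_equiv.cancel[of "{}" "[(x, False)] @ ?A" "(x, True)" "[]"] in \<open>simp add: flip_def\<close>)
    finally show ?thesis using 1 by simp
  qed
  obtain x b where "e = (x, b)" by force
  then show ?thesis using pos[of x] assms by (cases b) (auto simp: stable_letter_def flip_def)
qed

definition edge_pow :: "gen letter \<Rightarrow> int \<Rightarrow> gen wrd"
  where "edge_pow e m = wpow (edge_word e) m"

lemma edge_pow_simps [simp]: "bval (edge_pow e m) = scl m (edge_vec e)" "base_word (edge_pow e m)"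
  by (simp_all add: edge_pow_def base_word_wpow)

lemma length_edge_pow_le: "real (length (edge_pow e m)) \<le> (real p + 1) * \<bar>real_of_int m\<bar>"
proof -
  have "length (edge_pow e m) \<le> nat \<bar>m\<bar> * (p + 1)"
    unfolding edge_pow_def length_wpow by (rule mult_le_mono2[OF length_edge_word_le])
  then have "real (length (edge_pow e m)) \<le> real (nat \<bar>m\<bar> * (p + 1))" by (rule of_nat_mono)
  then show ?thesis by (simp add: algebra_simps)
qed

lemma cost_edge_pow:
  assumes "stable_letter e"
  shows "cost \<bar>real_of_int m\<bar> (edge_pow e m @ [e]) ([e] @ edge_pow (flip e) m)"
  using rel_cost_wpow_slide[OF cost_edge[OF assms], of m] by (simp add: edge_pow_def)

end


section \<open>The lower bound: a central extension\<close>

type_synonym pt = "int \<times> int \<times> int"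

definition shift :: "int \<Rightarrow> pt \<Rightarrow> pt"
  where "shift n = (\<lambda>(i, j, k). (i, j, k + n))"

definition mirror :: "pt \<Rightarrow> pt"
  where "mirror = (\<lambda>(i, j, k). (i, - j, - k))"

lemma shift_simps [simp]:
  "shift 0 P = P" "shift m (shift n P) = shift (m + n) P"
  "shift m P = shift n P \<longleftrightarrow> m = n"
  "mirror (mirror P) = P" "mirror (shift n P) = shift (- n) (mirror P)"
  by (auto simp: shift_def mirror_def split: prod.split)

context snowflake
begin

text \<open>The Heisenberg group acts on \<open>\<int>\<^sup>3\<close> by \<open>a (i, j, k) = (i + 1, j, k)\<close> and
\<open>b (i, j, k) = (i, j + 1, k + 2 i)\<close>; the factor 2 avoids halves in the closed formula for the
powers of \<open>a^p b\<close>, and makes \<open>[a, b]\<close> the translation of \<open>k\<close> by \<open>- 2\<close>. The letter \<open>s\<close> has to carry the orbits of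
\<open>a^p b\<close> to those of \<open>a^q\<close> equivariantly and commute with translations of \<open>k\<close>. A point is
\<open>(a^p b)^j (i', 0, k')\<close> with \<open>i' = i - p j\<close>; it is sent to
\<open>a^(q j) (i' mod q, i' div q, k')\<close>, where quotient and remainder match the orbits of \<open>a^p b\<close>, indexed by
\<open>i'\<close>, with those of \<open>a^q\<close>, indexed by a residue and \<open>j\<close>.
The reflection \<open>mirror\<close> commutes with \<open>a\<close> and inverts \<open>b\<close>, so conjugating by it yields the
action of \<open>t\<close>.\<close>

definition heis_s :: "pt \<Rightarrow> pt"
  where "heis_s = (\<lambda>(i, j, k). let i' = i - int p * j in
    (int q * j + i' mod int q, i' div int q, k - 2 * j * i' - int p * (j * (j - 1))))"

definition heis_s_inv :: "pt \<Rightarrow> pt"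
  where "heis_s_inv = (\<lambda>(i, j, k). let m = i div int q; i' = int q * j + i mod int q in
    (i' + int p * m, m, k + 2 * m * i' + int p * (m * (m - 1))))"

fun letter_act :: "gen letter \<Rightarrow> pt \<Rightarrow> pt" where
  "letter_act (Gen_a, e) (i, j, k) = (if e then i + 1 else i - 1, j, k)"
| "letter_act (Gen_b, e) (i, j, k) =
     (i, if e then j + 1 else j - 1, if e then k + 2 * i else k - 2 * i)"
| "letter_act (Gen_s, e) P = (if e then heis_s P else heis_s_inv P)"
| "letter_act (Gen_t, e) P = mirror (if e then heis_s (mirror P) else heis_s_inv (mirror P))"

abbreviation word_act :: "gen wrd \<Rightarrow> pt \<Rightarrow> pt"
  where "word_act \<equiv> foldr letter_act"

lemma heis_s_inverse [simp]: "heis_s (heis_s_inv P) = P" "heis_s_inv (heis_s P) = P"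
  using q_pos by (auto simp: heis_s_def heis_s_inv_def Let_def split: prod.split)

lemma heis_s_shift: "heis_s (shift n P) = shift n (heis_s P)"
  "heis_s_inv (shift n P) = shift n (heis_s_inv P)"
  by (auto simp: heis_s_def heis_s_inv_def shift_def Let_def split: prod.split)

lemma letter_act_flip [simp]: "letter_act (flip x) (letter_act x P) = P"
  by (cases "(x, P)" rule: letter_act.cases) (auto simp: flip_def)

lemma letter_act_flip' [simp]: "letter_act x (letter_act (flip x) P) = P"
  using letter_act_flip[of "flip x" P] by simp

lemma letter_act_shift: "letter_act x (shift n P) = shift n (letter_act x P)"
  by (cases "(x, P)" rule: letter_act.cases) (auto simp: heis_s_shift, auto simp: shift_def)

lemma word_act_shift: "word_act u (shift n P) = shift n (word_act u P)"
  by (induction u) (auto simp: letter_act_shift)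

lemma word_act_winv [simp]: "word_act (winv u) (word_act u P) = P"
  by (induction u arbitrary: P) auto

lemma word_act_winv' [simp]: "word_act u (word_act (winv u) P) = P"
  using word_act_winv[of "winv u" P] by simp

lemma word_act_free: "word_equiv {} u v \<Longrightarrow> word_act u P = word_act v P"
  by (induction arbitrary: P rule: word_equiv.induct) auto

lemma word_act_gpow_a: "word_act (gpow Gen_a n) (i, j, k) = (i + int n, j, k)"
  unfolding gpow_def by (induction n) auto

text \<open>Only the commutator acts nontrivially; the relations for \<open>s\<close> and \<open>t\<close> hold exactly in the
central extension.\<close>

lemma word_act_relator:
  assumes "r \<in> rels"
  shows "\<exists>c. \<bar>c\<bar> \<le> 2 \<and> (\<forall>P. word_act r P = shift c P)"
proof -
  have s: "letter_act (Gen_s, False) (word_act (gpow Gen_a q) (letter_act (Gen_s, True) P)) =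
     word_act (gpow Gen_a p) (letter_act (Gen_b, True) P)" for P
  proof -
    obtain i j k where P: "P = (i, j, k)" by (metis prod.exhaust)
    have "heis_s (word_act (gpow Gen_a p) (letter_act (Gen_b, True) P))
       = word_act (gpow Gen_a q) (heis_s P)"
      unfolding P by (auto simp: word_act_gpow_a heis_s_def Let_def algebra_simps)
    then show ?thesis by (metis heis_s_inverse(2) letter_act.simps(3))
  qed
  have mir: "mirror (word_act (gpow Gen_a n) (mirror P)) = word_act (gpow Gen_a n) P" for n P
    by (cases P) (auto simp: mirror_def word_act_gpow_a)
  have mb: "mirror (letter_act (Gen_b, True) (mirror P)) = letter_act (Gen_b, False) P" for P
    by (cases P) (auto simp: mirror_def)
  have t: "letter_act (Gen_t, False) (word_act (gpow Gen_a q) (letter_act (Gen_t, True) P)) =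
     word_act (gpow Gen_a p) (letter_act (Gen_b, False) P)" for P
    using s[of "mirror P"] mir[of q "mirror (heis_s (mirror P))"] mir[of p "letter_act (Gen_b, False) P"]
      mb[of P] by simp (metis shift_simps(4))
  have shift0: "\<exists>c. \<bar>c\<bar> \<le> 2 \<and> (\<forall>P. word_act (x @ winv y) P = shift c P)"
    if "\<And>P. word_act x P = word_act y P" for x y
    by (intro exI[of _ 0]) (simp add: that)
  consider "r = commutator (gpow Gen_a 1) (gpow Gen_b 1)"
    | "r = (winv (gpow Gen_s 1) @ gpow Gen_a q @ gpow Gen_s 1) @ winv (gpow Gen_a p @ gpow Gen_b 1)"
    | "r = (winv (gpow Gen_t 1) @ gpow Gen_a q @ gpow Gen_t 1) @ winv (gpow Gen_a p @ winv (gpow Gen_b 1))"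
    using assms by (auto simp: B_relators_def Let_def)
  then show ?thesis
  proof cases
    case 1
    then show ?thesis
      by (intro exI[of _ "-2"]) (auto simp: commutator_def gpow_def winv_def flip_def shift_def)
  next
    case 2
    show ?thesis unfolding 2
      by (rule shift0) (use s in \<open>simp add: gpow_def[of Gen_s] gpow_def[of Gen_b] winv_def flip_def
           del: letter_act.simps\<close>)
  next
    case 3
    show ?thesis unfolding 3
      by (rule shift0) (use t in \<open>simp add: gpow_def[of Gen_t] gpow_def[of Gen_b] winv_def flip_def
           del: letter_act.simps\<close>)
  qed
qed

text \<open>Translations of \<open>k\<close> are central, so conjugation does not change them and the contributions of the
relators add up. This is what makes the extension count area.\<close>

lemma word_act_is_conj_prod:
  assumes "is_conj_prod rels N u" "word_act u P = shift c P"
  shows "\<bar>c\<bar> \<le> 2 * int N"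
proof -
  obtain cs where cs: "length cs = N" "snd ` set cs \<subseteq> rels \<union> winv ` rels"
    "word_equiv {} u (conj_prod cs)"
    using assms by (meson is_conj_prodE)
  have rel: "\<exists>c. \<bar>c\<bar> \<le> 2 \<and> (\<forall>P. word_act r P = shift c P)" if mem: "r \<in> rels \<union> winv ` rels" for r
  proof (cases "r \<in> rels")
    case False
    then obtain r' where r: "r' \<in> rels" "r = winv r'" using mem by blast
    obtain d where d: "\<bar>d\<bar> \<le> 2" "\<And>P. word_act r' P = shift d P" using word_act_relator[OF r(1)] by auto
    have "word_act r P = shift (- d) P" for P
      using word_act_winv[of r' "shift (- d) P"] by (simp add: r(2) d(2))
    then show ?thesis using d(1) by (intro exI[of _ "- d"]) auto
  qed (rule word_act_relator)
  have "\<exists>c. \<bar>c\<bar> \<le> 2 * int (length cs) \<and> (\<forall>P. word_act (conj_prod cs) P = shift c P)"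
    using cs(2)
  proof (induction cs)
    case Nil
    show ?case by (intro exI[of _ 0]) simp
  next
    case (Cons d cs)
    obtain w r where d: "d = (w, r)" by force
    obtain c where c: "\<bar>c\<bar> \<le> 2 * int (length cs)" "\<And>P. word_act (conj_prod cs) P = shift c P"
      using Cons by auto
    obtain c' where c': "\<bar>c'\<bar> \<le> 2" "\<And>P. word_act r P = shift c' P"
      using rel[of r] Cons.prems d by auto
    show ?case using c c'
      by (intro exI[of _ "c' + c"]) (auto simp: d word_act_shift)
  qed
  then obtain d where d: "\<bar>d\<bar> \<le> 2 * int N" "word_act (conj_prod cs) P = shift d P"
    using cs(1) by blast
  with assms(2) word_act_free[OF cs(3), of P] have "shift c P = shift d P" by simp
  with d(1) show ?thesis by simp
qed

lemma word_act_word_equiv: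
  assumes "word_equiv rels u v"
  shows "\<exists>c. \<forall>P. word_act u P = shift c (word_act v P)"
  using assms
proof (induction rule: word_equiv.induct)
  case (sym u v)
  then obtain c where "\<And>P. word_act u P = shift c (word_act v P)" by auto
  then show ?case by (intro exI[of _ "- c"]) auto
next
  case (trans u v w)
  then obtain c d where "\<And>P. word_act u P = shift c (word_act v P)"
    "\<And>P. word_act v P = shift d (word_act w P)" by auto
  then show ?case by (intro exI[of _ "c + d"]) auto
next
  case (relator r u v)
  obtain c where "\<And>P. word_act r P = shift c P" using word_act_relator[OF relator] by auto
  then show ?case by (intro exI[of _ c]) (auto simp: word_act_shift)
qed (auto intro: exI[of _ 0])

lemma word_act_edge_pow:
  "word_act (edge_pow (Gen_s, True) (int m)) (i, j, k) = (i + int q * int m, j, k)"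
  "word_act (edge_pow (Gen_s, False) (int m)) (i, j, k) =
     (i + int p * int m, j + int m, k + 2 * int m * i + int p * (int m * (int m - 1)))"
  by (induction m arbitrary: i j k)
     (auto simp: edge_pow_def wpow_def edge_word_def word_act_gpow_a gpow_def[of Gen_b]
        nat_add_distrib algebra_simps)

text \<open>The boundary of a parallelogram in the plane with sides \<open>a^(qm)\<close> and \<open>(a^p b)^m\<close>, with the sides replaced by arbitrary words. Central
ambiguities in the sides cancel in the commutator, which therefore still acts as translation by twice the
enclosed area \<open>q m\<^sup>2\<close>.\<close>

lemma snowflake_commutator_area:
  assumes "word_equiv rels u (edge_pow (Gen_s, True) (int m))"
    and "word_equiv rels v (edge_pow (Gen_s, False) (int m))"
  shows "word_equiv rels (commutator u v) []" "q * m\<^sup>2 \<le> area rels (commutator u v)"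
proof -
  let ?A = "edge_pow (Gen_s, True) (int m)" and ?B = "edge_pow (Gen_s, False) (int m)"
  have "word_equiv rels (u @ v) (?A @ ?B)" by (rule word_equiv_append[OF assms])
  also have "word_equiv rels \<dots> (?B @ ?A)"
    by (rule word_equiv_base_words) auto
  also have "word_equiv rels \<dots> (v @ u)"
    by (rule word_equiv.sym[OF word_equiv_append[OF assms(2,1)]])
  finally have "word_equiv rels (u @ v) (v @ u)" .
  then show 1: "word_equiv rels (commutator u v) []"
    unfolding commutator_def word_equiv_move_left by simp
  have "is_conj_prod rels (area rels (commutator u v)) (commutator u v)"
    using area_le_iff_rel_cost[OF 1, of "area rels (commutator u v)"] LeastI_ex
     word_class_one_iff[of rels "commutator u v"] 1
    unfolding area_def one_presented_group word_class_eq_iff by metis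
  moreover have "word_act (commutator u v) P = shift (- 2 * int (q * m\<^sup>2)) P" for P
  proof -
    obtain c d where c: "\<And>P. word_act u P = shift c (word_act ?A P)"
      and d: "\<And>P. word_act v P = shift d (word_act ?B P)"
      using assms word_act_word_equiv by metis
    obtain i j k where P: "P = (i, j, k)" by (metis prod.exhaust)
    have "word_act (u @ v) P = word_act (v @ u) (shift (- 2 * int (q * m\<^sup>2)) P)"
      by (simp add: c d P shift_def word_act_edge_pow power2_eq_square algebra_simps)
    then show ?thesis by (simp add: commutator_def)
  qed
  ultimately have "\<bar>- 2 * int (q * m\<^sup>2)\<bar> \<le> 2 * int (area rels (commutator u v))"
    using word_act_is_conj_prod by blast
  then show "q * m\<^sup>2 \<le> area rels (commutator u v)" by linarith
qed

text \<open>The exponent of \<open>a^q\<close> after \<open>k\<close> doublings, namely \<open>2 p m / q\<close> rounded up. The word \<open>flake\<close> below makes up for the rounding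
by a short power of \<open>a\<close>.\<close>

fun flake_exp :: "nat \<Rightarrow> nat" where
  "flake_exp 0 = 1"
| "flake_exp (Suc k) = (2 * p * flake_exp k + q - 1) div q"

definition conj_by :: "gen \<Rightarrow> gen wrd \<Rightarrow> gen wrd"
  where "conj_by x w = (x, False) # w @ [(x, True)]"

fun flake :: "nat \<Rightarrow> gen wrd" where
  "flake 0 = gpow Gen_a q"
| "flake (Suc k) = conj_by Gen_s (flake k) @ conj_by Gen_t (flake k) @
     gpow Gen_a (q * flake_exp (Suc k) - 2 * p * flake_exp k)"

lemma flake_exp_Suc_bounds:
  "2 * p * flake_exp k \<le> q * flake_exp (Suc k)"
  "q * flake_exp (Suc k) - 2 * p * flake_exp k \<le> q"
proof -
  have *: "2 * p * flake_exp k + q - 1 = q * flake_exp (Suc k) + (2 * p * flake_exp k + q - 1) mod q"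
    by simp
  have "(2 * p * flake_exp k + q - 1) mod q \<le> q - 1"
    using q_pos mod_less_divisor[OF q_pos, of "2 * p * flake_exp k + q - 1"] by linarith
  then show "2 * p * flake_exp k \<le> q * flake_exp (Suc k)"
    "q * flake_exp (Suc k) - 2 * p * flake_exp k \<le> q" using * q_pos by linarith+
qed

lemma flake_exp_ge: "(2 * real p / real q) ^ k \<le> real (flake_exp k)"
proof (induction k)
  case (Suc k)
  have "real q * (2 * real p / real q) ^ Suc k = 2 * real p * (2 * real p / real q) ^ k"
    using q_pos by simp
  also have "\<dots> \<le> real (2 * p * flake_exp k)" using Suc by (simp add: mult_left_mono)
  also have "\<dots> \<le> real (q * flake_exp (Suc k))"
    using flake_exp_Suc_bounds(1) by (simp only: of_nat_le_iff)
  finally have "real q * (2 * real p / real q) ^ Suc k \<le> real q * real (flake_exp (Suc k))"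
    by (simp only: of_nat_mult)
  then show ?case using q_pos by (simp only: mult_le_cancel_left_pos of_nat_0_less_iff)
qed simp

lemma length_flake: "length (flake k) + (q + 4) \<le> (2 * q + 4) * 2 ^ k"
proof (induction k)
  case (Suc k)
  then show ?case using flake_exp_Suc_bounds(2)[of k] by (simp add: conj_by_def del: flake_exp.simps)
qed simp

lemma conj_by_edge_pow:
  assumes "word_equiv rels w (edge_pow (x, True) m)" "stable_letter (x, True)"
  shows "word_equiv rels (conj_by x w) (edge_pow (x, False) m)"
proof -
  have "word_equiv rels (w @ [(x, True)]) (edge_pow (x, True) m @ [(x, True)])"
    by (rule word_equiv_append[OF assms(1) word_equiv.refl])
  also have "word_equiv rels \<dots> ([(x, True)] @ edge_pow (x, False) m)"
    using rel_cost_imp_word_equiv[OF cost_edge_pow[OF assms(2)]] by (simp add: flip_def)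
  finally show ?thesis unfolding conj_by_def
    using word_equiv_move_left[of rels "[(x, False)]" "w @ [(x, True)]"] by (simp add: flip_def)
qed

lemma flake_equiv: "word_equiv rels (flake k) (edge_pow (Gen_s, True) (int (flake_exp k)))"
proof (induction k)
  case 0
  show ?case by (simp add: edge_pow_def edge_word_def word_equiv.refl)
next
  case (Suc k)
  let ?m = "int (flake_exp k)" and ?r = "gpow Gen_a (q * flake_exp (Suc k) - 2 * p * flake_exp k)"
  have st: "edge_pow (Gen_t, True) ?m = edge_pow (Gen_s, True) ?m"
    by (simp add: edge_pow_def edge_word_def)
  have "word_equiv rels (flake (Suc k)) (edge_pow (Gen_s, False) ?m @ edge_pow (Gen_t, False) ?m @ ?r)"
    unfolding flake.simps
    by (intro word_equiv_append conj_by_edge_pow word_equiv.refl)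
       (use Suc in \<open>simp_all add: stable_letter_def st\<close>)
  also have "word_equiv rels \<dots> (edge_pow (Gen_s, True) (int (flake_exp (Suc k))))"
    by (rule word_equiv_base_words)
       (use flake_exp_Suc_bounds(1)[of k] in
         \<open>auto simp: prod_eq_iff of_nat_diff algebra_simps simp del: flake_exp.simps\<close>)
  finally show ?case .
qed

lemma ann_le_annular_dehn:
  assumes "conjugate_in R u v" "length u + length v \<le> n"
  shows "ann R u v \<le> annular_dehn (R :: gen wrd set) n"
  unfolding annular_dehn_def using assms annular_dehn_set(1)[of R n] by (intro Max_ge) auto

lemma annular_dehn_lower:
  "(2 * real p / real q) ^ (2 * k) \<le> real (annular_dehn rels ((8 * q + 20) * 2 ^ k))"
proof -
  let ?u = "flake k" and ?v = "conj_by Gen_s (flake k)"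
  let ?c = "commutator ?u ?v"
  have uv: "word_equiv rels ?u (edge_pow (Gen_s, True) (int (flake_exp k)))"
    "word_equiv rels ?v (edge_pow (Gen_s, False) (int (flake_exp k)))"
    by (rule flake_equiv, rule conj_by_edge_pow[OF flake_equiv]) (simp add: stable_letter_def)
  have 1: "word_equiv rels ?c []" by (rule snowflake_commutator_area(1)[OF uv])
  have "conjugate_in rels ?c []"
    using 1 by (auto simp: conjugate_in_iff word_class_eq_iff intro: exI[of _ "[]"])
  moreover have "length ?c \<le> (8 * q + 20) * 2 ^ k"
  proof -
    have l: "length ?u \<le> (2 * q + 4) * 2 ^ k" using length_flake[of k] by simp
    \<comment> \<open>The two letters of conj_by occur twice.\<close>
    have "length ?c = 4 * length ?u + 4" by (simp add: commutator_def conj_by_def winv_def)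
    also have "\<dots> \<le> 4 * ((2 * q + 4) * 2 ^ k) + 4 * 2 ^ k"
      using l by (intro add_mono mult_left_mono) auto
    finally show ?thesis by (simp add: algebra_simps)
  qed
  ultimately have "ann rels ?c [] \<le> annular_dehn rels ((8 * q + 20) * 2 ^ k)"
    by (intro ann_le_annular_dehn) auto
  then have "area rels ?c \<le> annular_dehn rels ((8 * q + 20) * 2 ^ k)"
    using area_le_ann_Nil[OF 1] by linarith
  with snowflake_commutator_area(2)[OF uv]
  have "q * (flake_exp k)\<^sup>2 \<le> annular_dehn rels ((8 * q + 20) * 2 ^ k)" by linarith
  moreover have "(flake_exp k)\<^sup>2 \<le> q * (flake_exp k)\<^sup>2" using q_pos by simp
  ultimately have "(flake_exp k)\<^sup>2 \<le> annular_dehn rels ((8 * q + 20) * 2 ^ k)" by linarith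
  then have 2: "real ((flake_exp k)\<^sup>2) \<le> real (annular_dehn rels ((8 * q + 20) * 2 ^ k))"
    by (rule of_nat_mono)
  have "((2 * real p / real q) ^ k)\<^sup>2 \<le> (real (flake_exp k))\<^sup>2"
    by (rule power_mono[OF flake_exp_ge]) simp
  then have "(2 * real p / real q) ^ (k * 2) \<le> (real (flake_exp k))\<^sup>2"
    by (simp only: power_mult)
  also have "\<dots> = real ((flake_exp k)\<^sup>2)" by simp
  also note 2
  finally show ?thesis by (simp only: mult.commute)
qed

end


section \<open>Powers of lengths\<close>

lemma powr_superadditive:
  fixes x y a :: real
  assumes "0 \<le> x" "0 \<le> y" "1 \<le> a"
  shows "x powr a + y powr a \<le> (x + y) powr a"
proof -
  have *: "u powr a \<le> u * (x + y) powr (a - 1)" if "0 \<le> u" "u \<le> x + y" for u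
  proof (cases "u = 0")
    case False
    then have "u powr a = u * u powr (a - 1)" using that by (simp add: powr_mult_base)
    also have "\<dots> \<le> u * (x + y) powr (a - 1)"
      using that assms(3) by (intro mult_left_mono powr_mono2) auto
    finally show ?thesis .
  qed simp
  have "x powr a + y powr a \<le> (x + y) * (x + y) powr (a - 1)"
    using *[of x] *[of y] assms by (simp add: distrib_right)
  also have "\<dots> = (x + y) powr a"
    using assms by (cases "x + y = 0") (auto simp: powr_mult_base)
  finally show ?thesis .
qed

text \<open>The case of an exponent below 1 is the superadditivity of the inverse power.\<close>

lemma powr_subadditive:
  fixes x y a :: real
  assumes "0 \<le> x" "0 \<le> y" "0 < a" "a \<le> 1"
  shows "(x + y) powr a \<le> x powr a + y powr a"
proof (cases "x + y = 0")
  case False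
  then have "(x powr a + y powr a) powr (1 / a) \<ge> (x powr a) powr (1 / a) + (y powr a) powr (1 / a)"
    using assms by (intro powr_superadditive) auto
  then have "x + y \<le> (x powr a + y powr a) powr (1 / a)"
    using assms by (simp add: powr_powr)
  then have "(x + y) powr a \<le> ((x powr a + y powr a) powr (1 / a)) powr a"
    using assms by (intro powr_mono2) auto
  then show ?thesis using assms by (simp add: powr_powr)
qed (use assms in auto)

context snowflake
begin

definition alpha :: real
  where "alpha = log 2 (2 * real p / real q)"

lemma two_powr_alpha: "2 powr alpha = 2 * real p / real q"
  using q_pos q_less_p by (simp add: alpha_def)

lemma alpha_gt_1: "1 < alpha"
proof -
  have "2 powr 1 < 2 powr alpha" using q_pos q_less_p by (simp add: two_powr_alpha field_simps)
  then show ?thesis using powr_less_cancel_iff[of 2 1 alpha] by linarith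
qed

text \<open>The natural scale for distances in the plane. Superadditivity, which needs \<open>\<alpha> \<ge> 1\<close>, is what closes all
inductions over concatenation.\<close>

definition len_pow :: "'a list \<Rightarrow> real"
  where "len_pow w = real (length w) powr alpha"

lemma len_pow_nonneg [simp]: "0 \<le> len_pow w" and len_pow_Nil [simp]: "len_pow [] = 0"
  and len_pow_singleton [simp]: "len_pow [x] = 1"
  by (simp_all add: len_pow_def)

lemma len_pow_append: "len_pow u + len_pow v \<le> len_pow (u @ v)"
  using powr_superadditive[of "length u" "length v" alpha] alpha_gt_1 by (simp add: len_pow_def)

lemma len_pow_mono: "length u \<le> length v \<Longrightarrow> len_pow u \<le> len_pow v"
  using alpha_gt_1 by (simp add: len_pow_def powr_mono2)

lemma len_pow_eq: "length u = length v \<Longrightarrow> len_pow u = len_pow v"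
  by (simp add: len_pow_def)

section \<open>Distortion of the plane\<close>

text \<open>Words whose membership in the plane can be read off from matching pairs of stable letters, together with
their value. By Britton's lemma every word with value in the plane is of this kind; the
generation by binary concatenation, in place of a list of syllables, is what the inductions below use.\<close>

inductive plane_val :: "gen wrd \<Rightarrow> vec \<Rightarrow> bool" where
  nil: "plane_val [] 0"
| letter: "base_word [x] \<Longrightarrow> plane_val [x] (bval [x])"
| append: "plane_val u z \<Longrightarrow> plane_val v w \<Longrightarrow> plane_val (u @ v) (z + w)"
| wrap: "plane_val v (scl m (edge_vec e)) \<Longrightarrow> stable_letter e \<Longrightarrow>
    plane_val (flip e # v @ [e]) (scl m (edge_vec (flip e)))"

text \<open>In the coordinates \<open>i - p j\<close> and \<open>i + p j\<close> the edge group of \<open>a^q\<close> lies on the diagonal and those of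
\<open>a^p b^(+-1)\<close> on the axes. A vector \<open>(q m, q m)\<close> on the diagonal is carried to \<open>2 p m\<close> on an axis, and the
exponent \<open>1/\<alpha>\<close> is chosen such that the factor \<open>2 p / q\<close> counts exactly as the loss of one of the
two summands. So edge isomorphisms are isometries for this norm.\<close>

definition flake_norm :: "vec \<Rightarrow> real"
  where "flake_norm z =
    (\<bar>real_of_int (fst z - int p * snd z)\<bar> / real p) powr (1 / alpha) +
    (\<bar>real_of_int (fst z + int p * snd z)\<bar> / real p) powr (1 / alpha)"

lemma flake_norm_triangle: "flake_norm (z + w) \<le> flake_norm z + flake_norm w"
proof -
  have *: "(\<bar>real_of_int (s + t)\<bar> / real p) powr (1 / alpha) \<le>
     (\<bar>real_of_int s\<bar> / real p) powr (1 / alpha) + (\<bar>real_of_int t\<bar> / real p) powr (1 / alpha)" for s t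
  proof -
    have "(\<bar>real_of_int (s + t)\<bar> / real p) powr (1 / alpha) \<le>
       (\<bar>real_of_int s\<bar> / real p + \<bar>real_of_int t\<bar> / real p) powr (1 / alpha)"
      using alpha_gt_1 by (intro powr_mono2) (auto simp: add_divide_distrib[symmetric] intro!: divide_right_mono)
    also have "\<dots> \<le> (\<bar>real_of_int s\<bar> / real p) powr (1 / alpha) + (\<bar>real_of_int t\<bar> / real p) powr (1 / alpha)"
      using alpha_gt_1 by (intro powr_subadditive) auto
    finally show ?thesis .
  qed
  show ?thesis
    unfolding flake_norm_def
    using *[of "fst z - int p * snd z" "fst w - int p * snd w"]
      *[of "fst z + int p * snd z" "fst w + int p * snd w"]
    by (simp add: algebra_simps)
qed

lemma flake_norm_edge_vec:
  assumes "stable_letter e"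
  shows "flake_norm (scl m (edge_vec e)) = 2 * (real q * \<bar>real_of_int m\<bar> / real p) powr (1 / alpha)"
proof -
  have "(2 * \<bar>real_of_int m\<bar>) powr (1 / alpha) =
     ((2 * real p / real q) * (real q * \<bar>real_of_int m\<bar> / real p)) powr (1 / alpha)"
    using q_pos q_less_p by simp
  also have "\<dots> = (2 powr alpha) powr (1 / alpha) * (real q * \<bar>real_of_int m\<bar> / real p) powr (1 / alpha)"
    unfolding two_powr_alpha by (rule powr_mult; simp)
  also have "(2 powr alpha) powr (1 / alpha) = 2" using alpha_gt_1 by (simp add: powr_powr)
  finally have *: "(2 * \<bar>real_of_int m\<bar>) powr (1 / alpha) =
     2 * (real q * \<bar>real_of_int m\<bar> / real p) powr (1 / alpha)" .
  have **: "\<bar>real_of_int m * real p + real p * real_of_int m\<bar> / real p = 2 * \<bar>real_of_int m\<bar>"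
    using q_less_p by (simp add: abs_mult algebra_simps flip: mult_2)
  show ?thesis
    using assms * ** by (cases rule: stable_letter_cases) (auto simp: flake_norm_def abs_mult mult.commute)
qed

lemma flake_norm_le_length: "plane_val w z \<Longrightarrow> flake_norm z \<le> 2 * real (length w)"
proof (induction rule: plane_val.induct)
  case nil
  show ?case by (simp add: flake_norm_def)
next
  case (letter x)
  have "(1 / real p) powr (1 / alpha) \<le> 1 powr (1 / alpha)"
    using alpha_gt_1 q_less_p by (intro powr_mono2) auto
  then show ?case using letter q_less_p by (cases x) (auto simp: flake_norm_def)
next
  case (append u z v w)
  then show ?case using flake_norm_triangle[of z w] by simp
next
  case (wrap v m e)
  then show ?case by (simp add: flake_norm_edge_vec)
qed

definition dist_const :: real where "dist_const = 4 * (real p)\<^sup>2"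

lemma dist_const_ge_1: "1 \<le> dist_const"
proof -
  have "1 \<le> (real p)\<^sup>2" using q_less_p by (intro one_le_power) simp
  then show ?thesis by (simp add: dist_const_def)
qed

text \<open>Solving the norm bound for the coordinates. The constant absorbs \<open>2^\<alpha> = 2 p / q \<le> 2 p\<close>.\<close>

lemma plane_val_bounds:
  assumes "plane_val w z"
  shows "\<bar>real_of_int (fst z - int p * snd z)\<bar> \<le> dist_const * len_pow w"
    and "\<bar>real_of_int (fst z + int p * snd z)\<bar> \<le> dist_const * len_pow w"
    and "vsize z \<le> dist_const * len_pow w"
proof -
  have p1: "1 \<le> real p" "1 \<le> real q" using q_pos q_less_p by auto
  have *: "x \<le> 2 * (real p)\<^sup>2 * len_pow w"
    if "0 \<le> x" "(x / real p) powr (1 / alpha) \<le> 2 * real (length w)" for x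
  proof -
    have "((x / real p) powr (1 / alpha)) powr alpha \<le> (2 * real (length w)) powr alpha"
      using that alpha_gt_1 by (intro powr_mono2) auto
    then have "x / real p \<le> 2 * real p / real q * len_pow w"
      using that alpha_gt_1 p1 by (simp add: powr_powr powr_mult two_powr_alpha len_pow_def)
    also have "\<dots> \<le> 2 * real p * len_pow w"
    proof -
      have "2 * real p / real q \<le> 2 * real p" using p1 by (simp add: divide_le_eq mult_left_le)
      then show ?thesis by (intro mult_right_mono) auto
    qed
    finally show ?thesis using p1 by (simp add: field_simps power2_eq_square)
  qed
  let ?U = "\<bar>real_of_int (fst z - int p * snd z)\<bar>" and ?V = "\<bar>real_of_int (fst z + int p * snd z)\<bar>"
  have fn: "(?U / real p) powr (1 / alpha) + (?V / real p) powr (1 / alpha) \<le> 2 * real (length w)"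
    using flake_norm_le_length[OF assms] unfolding flake_norm_def .
  have "0 \<le> (?U / real p) powr (1 / alpha)" "0 \<le> (?V / real p) powr (1 / alpha)" by auto
  with fn have "(?U / real p) powr (1 / alpha) \<le> 2 * real (length w)"
    "(?V / real p) powr (1 / alpha) \<le> 2 * real (length w)" by linarith+
  then have U: "?U \<le> 2 * (real p)\<^sup>2 * len_pow w" and V: "?V \<le> 2 * (real p)\<^sup>2 * len_pow w"
    by (intro *; simp)+
  then show "?U \<le> dist_const * len_pow w" "?V \<le> dist_const * len_pow w"
    using mult_nonneg_nonneg[of "(real p)\<^sup>2" "len_pow w"] by (auto simp: dist_const_def)
  have "\<bar>real_of_int (fst z)\<bar> + real p * \<bar>real_of_int (snd z)\<bar> \<le> ?U + ?V"
  proof -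
    have "\<bar>real p * real_of_int (snd z)\<bar> = real p * \<bar>real_of_int (snd z)\<bar>" by (simp add: abs_mult)
    moreover have "\<bar>x\<bar> + \<bar>y\<bar> \<le> \<bar>x - y\<bar> + \<bar>x + y\<bar>" for x y :: real by linarith
    from this[of "real_of_int (fst z)" "real p * real_of_int (snd z)"]
    have "\<bar>real_of_int (fst z)\<bar> + \<bar>real p * real_of_int (snd z)\<bar> \<le> ?U + ?V" by simp
    ultimately show ?thesis by simp
  qed
  moreover have "\<bar>real_of_int (snd z)\<bar> \<le> real p * \<bar>real_of_int (snd z)\<bar>"
    using p1 mult_right_mono[of 1 "real p" "\<bar>real_of_int (snd z)\<bar>"] by simp
  ultimately show "vsize z \<le> dist_const * len_pow w" using U V by (simp add: vsize_def dist_const_def)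
qed

section \<open>Area of words with values in the plane\<close>

text \<open>Coordinates of \<open>z\<close> with respect to the basis \<open>edge_vec e\<close>, \<open>(1, 0)\<close>, where \<open>e\<close> is \<open>s\<inverse>\<close> or \<open>t\<inverse>\<close>
(the letters called \<open>slanted\<close> below), so that the first basis vector is \<open>(p, 1)\<close> or \<open>(p, - 1)\<close>.\<close>

definition level :: "gen letter \<Rightarrow> vec \<Rightarrow> int"
  where "level e z = snd (edge_vec e) * snd z"

definition offset :: "gen letter \<Rightarrow> vec \<Rightarrow> int"
  where "offset e z = fst z - int p * level e z"

text \<open>A path to \<open>z\<close> made of two straight segments, in the direction of \<open>edge_vec e\<close> and in that of \<open>a\<close>. An element of one of
these two edge groups is thus spelled as a power of its generator, ready to be passed through a
stable letter at linear cost, with no area for straightening it first.\<close>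

definition comb :: "gen letter \<Rightarrow> vec \<Rightarrow> gen wrd"
  where "comb e z = edge_pow e (level e z) @ wpow wa (offset e z)"

text \<open>The distance of \<open>z\<close>, in these coordinates, from the nearer of the two edge directions that are
straight for \<open>comb e\<close>. In the third edge direction the path \<open>comb e z\<close> has a corner, and the penalty grows linearly.\<close>

definition penalty :: "gen letter \<Rightarrow> vec \<Rightarrow> real"
  where "penalty e z = min \<bar>real_of_int (level e z)\<bar> \<bar>real_of_int (offset e z)\<bar>"

lemma level_add [simp]: "level e (z + w) = level e z + level e w"
  and offset_add [simp]: "offset e (z + w) = offset e z + offset e w"
  by (simp_all add: level_def offset_def algebra_simps)

definition slanted :: "gen letter \<Rightarrow> bool"
  where "slanted e \<longleftrightarrow> stable_letter e \<and> \<not> snd e"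

lemma slanted_cases:
  assumes "slanted e" obtains "e = (Gen_s, False)" | "e = (Gen_t, False)"
  using assms by (cases e) (auto simp: slanted_def stable_letter_def)

lemma base_word_comb [simp]: "base_word (comb e z)"
  by (simp add: comb_def base_word_wpow)

lemma bval_comb:
  assumes "slanted e" shows "bval (comb e z) = z"
  using assms by (cases rule: slanted_cases) (auto simp: comb_def level_def offset_def scl_def plus_prod_def)

lemma length_comb_le:
  "real (length (comb e z)) \<le> (real p + 1) * \<bar>real_of_int (level e z)\<bar> + \<bar>real_of_int (offset e z)\<bar>"
  using length_edge_pow_le[of e "level e z"] by (simp add: comb_def length_wpow)

lemma level_offset_bounds:
  assumes "plane_val w z" "slanted e"
  shows "\<bar>real_of_int (level e z)\<bar> \<le> dist_const * len_pow w" "\<bar>real_of_int (offset e z)\<bar> \<le> dist_const * len_pow w"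
proof -
  have "\<bar>real_of_int (snd z)\<bar> \<le> vsize z" by (simp add: vsize_def)
  with plane_val_bounds[OF assms(1)] assms(2)
  show "\<bar>real_of_int (level e z)\<bar> \<le> dist_const * len_pow w" "\<bar>real_of_int (offset e z)\<bar> \<le> dist_const * len_pow w"
    by (auto elim!: slanted_cases simp: level_def offset_def)
qed

lemma cost_comb_append:
  "cost (2 * (real p + 2)\<^sup>2 * \<bar>real_of_int (offset e z)\<bar> * \<bar>real_of_int (level e w)\<bar>)
     (comb e z @ comb e w) (comb e (z + w))"
proof -
  have "cost (2 * (real p + 2)\<^sup>2) (wa @ edge_word e) (edge_word e @ wa)"
    using length_edge_word_le[of e] by (intro cost_base_words) auto
  from rel_cost_wpow_commute[OF this]
  have "cost (2 * (real p + 2)\<^sup>2 * \<bar>real_of_int (offset e z)\<bar> * \<bar>real_of_int (level e w)\<bar>)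
    (wpow wa (offset e z) @ edge_pow e (level e w)) (edge_pow e (level e w) @ wpow wa (offset e z))"
    by (simp add: edge_pow_def)
  from rel_cost_context[OF this, of "edge_pow e (level e z)" "wpow wa (offset e w)"]
  have "cost (2 * (real p + 2)\<^sup>2 * \<bar>real_of_int (offset e z)\<bar> * \<bar>real_of_int (level e w)\<bar>)
    (comb e z @ comb e w)
    ((edge_pow e (level e z) @ edge_pow e (level e w)) @ wpow wa (offset e z) @ wpow wa (offset e w))"
    by (simp add: comb_def)
  also have "cost 0 \<dots> (comb e (z + w))"
    unfolding comb_def edge_pow_def level_add offset_add
    by (intro rel_cost_free word_equiv_append wpow_add)
  finally show ?thesis by simp
qed

lemma wpow_gpow: "wpow (gpow x k) m = wpow [(x, True)] (int k * m)"
proof -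
  have rep: "concat (replicate n (replicate k y)) = concat (replicate (k * n) [y])" for n and y :: "gen letter"
    by (induction n) (auto simp: replicate_add)
  have "winv (gpow x k) = replicate k (x, False)"
    by (simp add: gpow_def winv_def flip_def)
  then show ?thesis using rep[of _ "(x, True)"] rep[of _ "(x, False)"]
    by (cases "k = 0"; cases "m = 0") (auto simp: wpow_def gpow_def winv_def flip_def nat_mult_distrib zero_le_mult_iff simp flip: mult_minus_right)
qed

lemma cost_wrap:
  assumes "stable_letter e" "cost c v (edge_pow e m)"
  shows "cost (c + \<bar>real_of_int m\<bar>) (flip e # v @ [e]) (edge_pow (flip e) m)"
proof -
  have "cost c (flip e # v @ [e]) ([flip e] @ edge_pow e m @ [e])"
    using rel_cost_context[OF assms(2), of "[flip e]" "[e]"] by simp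
  also have "cost \<bar>real_of_int m\<bar> \<dots> ([flip e] @ [e] @ edge_pow (flip e) m)"
    using rel_cost_context[OF cost_edge_pow[OF assms(1), of m], of "[flip e]" "[]"] by simp
  also have "cost 0 \<dots> (edge_pow (flip e) m)"
    using word_equiv.cancel[of "{}" "[]" "flip e" "edge_pow (flip e) m"]
    by (intro rel_cost_free) simp
  finally show ?thesis by simp
qed

lemma comb_edge_vec:
  assumes "slanted e" 
  shows "comb e (scl m (edge_vec e)) = edge_pow e m" "penalty e (scl m (edge_vec e)) = 0"
  using assms by (auto elim!: slanted_cases simp: comb_def level_def offset_def penalty_def)

lemma comb_axis:
  "comb e (scl m (int q, 0)) = edge_pow (x, True) m" "penalty e (scl m (int q, 0)) = 0"
  by (auto simp: comb_def level_def offset_def edge_pow_def edge_word_def wpow_gpow mult.commute penalty_def)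

text \<open>Changing the family of paths costs the square of the distance, because the paths for \<open>(a^p b)^m\<close> and for
\<open>(a^p b\<inverse>)^m\<close> enclose a triangle. This is charged to the penalty, which has the size of \<open>m\<close> here.\<close>

lemma cost_comb_other:
  assumes "slanted e" "slanted f"
  shows "cost (2 * (3 * real p + 1)\<^sup>2 * penalty e (scl m (edge_vec f)) * \<bar>real_of_int m\<bar>)
     (edge_pow f m) (comb e (scl m (edge_vec f)))"
proof (cases "e = f")
  case True
  then show ?thesis using comb_edge_vec[OF assms(2), of m] by (simp add: rel_cost_refl)
next
  case False
  then have ef: "level e (scl m (edge_vec f)) = - m" "offset e (scl m (edge_vec f)) = 2 * int p * m"
    using assms by (auto elim!: slanted_cases simp: level_def offset_def)
  have p1: "1 \<le> real p" using q_less_p by simp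
  have "\<bar>real_of_int m\<bar> \<le> 2 * real p * \<bar>real_of_int m\<bar>"
    using p1 mult_right_mono[of 1 "2 * real p" "\<bar>real_of_int m\<bar>"] by simp
  then have pen: "penalty e (scl m (edge_vec f)) = \<bar>real_of_int m\<bar>"
    by (simp add: penalty_def ef abs_mult min_def)
  have "cost (2 * ((3 * real p + 1) * \<bar>real_of_int m\<bar>)\<^sup>2) (edge_pow f m) (comb e (scl m (edge_vec f)))"
  proof (rule cost_base_words)
    show "real (length (edge_pow f m)) \<le> (3 * real p + 1) * \<bar>real_of_int m\<bar>"
      using length_edge_pow_le[of f m] p1
      by (elim order_trans) (intro mult_right_mono, auto)
    show "real (length (comb e (scl m (edge_vec f)))) \<le> (3 * real p + 1) * \<bar>real_of_int m\<bar>"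
      using length_comb_le[of e "scl m (edge_vec f)"] by (simp add: ef abs_mult algebra_simps)
  qed (use assms bval_comb in auto)
  then show ?thesis by (elim rel_cost_mono) (simp add: pen power2_eq_square mult_ac)
qed

definition pen_const :: real where "pen_const = 2 * (3 * real p + 1)\<^sup>2 * dist_const"
definition area_const :: real
  where "area_const = 2 * (2 * real p + 2)\<^sup>2 + pen_const * dist_const + 2 * (real p + 2)\<^sup>2 * dist_const\<^sup>2 + dist_const"

lemma area_const_ge:
  "0 \<le> pen_const" "2 * (2 * real p + 2)\<^sup>2 \<le> area_const" "dist_const \<le> area_const"
  "2 * pen_const * dist_const + 2 * (real p + 2)\<^sup>2 * dist_const\<^sup>2 \<le> 2 * area_const" "0 \<le> area_const"
proof -
  have b: "0 \<le> dist_const" using dist_const_ge_1 by simp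
  then show L: "0 \<le> pen_const" by (simp add: pen_const_def)
  have "0 \<le> pen_const * dist_const" "0 \<le> 2 * (real p + 2)\<^sup>2 * dist_const\<^sup>2" "0 \<le> 2 * (2 * real p + 2)\<^sup>2"
    using L b by auto
  then show "2 * (2 * real p + 2)\<^sup>2 \<le> area_const" "dist_const \<le> area_const"
    "2 * pen_const * dist_const + 2 * (real p + 2)\<^sup>2 * dist_const\<^sup>2 \<le> 2 * area_const" "0 \<le> area_const"
    using b by (auto simp: area_const_def)
qed

text \<open>The inductive step for concatenation in numbers. The penalty term of the smaller one of \<open>x\<close> and \<open>y\<close> is at
most \<open>B\<close> times its square, hence at most \<open>B x y\<close>; the penalty of the larger one exceeds that
of the sum by at most \<open>B\<close> times the smaller one. All errors
are multiples of \<open>x y\<close>, which fits into \<open>K ((x + y)\<^sup>2 - x\<^sup>2 - y\<^sup>2)\<close>.\<close>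

lemma comb_append_arith:
  fixes x y H P P1 P2 K L B E :: real
  assumes nn: "0 \<le> x" "0 \<le> y" "0 \<le> P" "0 \<le> K" "0 \<le> L" "0 \<le> B"
    and "x + y \<le> H" "P1 \<le> P + B * y" "P2 \<le> P + B * x" "P1 \<le> B * x" "P2 \<le> B * y"
    and K: "2 * L * B + E \<le> 2 * K"
  shows "(K * x\<^sup>2 + L * P1 * x) + (K * y\<^sup>2 + L * P2 * y) + E * (x * y) \<le> K * H\<^sup>2 + L * P * H"
proof -
  have key: "P1 * x + P2 * y \<le> P * (x + y) + 2 * (B * (x * y))"
  proof (cases "y \<le> x")
    case True
    have "P1 * x \<le> (P + B * y) * x" "P2 * y \<le> (B * y) * y" "(B * y) * y \<le> (B * y) * x" "0 \<le> P * y"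
      using assms True by (auto intro!: mult_right_mono mult_left_mono)
    then show ?thesis by (simp add: algebra_simps)
  next
    case False
    have "P2 * y \<le> (P + B * x) * y" "P1 * x \<le> (B * x) * x" "(B * x) * x \<le> (B * x) * y" "0 \<le> P * x"
      using assms False by (auto intro!: mult_right_mono mult_left_mono)
    then show ?thesis by (simp add: algebra_simps)
  qed
  have "L * (P1 * x + P2 * y) \<le> L * (P * (x + y) + 2 * (B * (x * y)))"
    using key nn by (intro mult_left_mono) auto
  moreover have "(2 * L * B + E) * (x * y) \<le> 2 * K * (x * y)"
    using K nn by (intro mult_right_mono) auto
  moreover have "K * (x + y)\<^sup>2 \<le> K * H\<^sup>2" "L * P * (x + y) \<le> L * P * H"
    using assms by (auto intro!: mult_left_mono power_mono)
  ultimately show ?thesis by (simp add: algebra_simps power2_eq_square)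
qed

text \<open>Two more letters raise the power of the length by at least 1, so its square grows by more than twice
that power, which pays for a corridor of length \<open>m\<close>.\<close>

lemma cost_wrap_arith:
  assumes "\<bar>real_of_int m\<bar> \<le> dist_const * len_pow v"
  shows "area_const * (len_pow v)\<^sup>2 + \<bar>real_of_int m\<bar> \<le> area_const * (len_pow (f # v @ [e]))\<^sup>2"
proof -
  have "len_pow v + 1 \<le> len_pow (v @ [e])" using len_pow_append[of v "[e]"] by simp
  also have "\<dots> \<le> len_pow (f # v @ [e])" by (rule len_pow_mono) simp
  finally have "(len_pow v + 1)\<^sup>2 \<le> (len_pow (f # v @ [e]))\<^sup>2" by (intro power_mono) auto
  then have "area_const * (len_pow v + 1)\<^sup>2 \<le> area_const * (len_pow (f # v @ [e]))\<^sup>2"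
    using area_const_ge by (intro mult_left_mono) auto
  moreover have "dist_const * len_pow v \<le> area_const * len_pow v" "0 \<le> area_const * len_pow v"
    using area_const_ge by (auto intro!: mult_right_mono)
  ultimately show ?thesis using assms area_const_ge
    by (simp add: power2_eq_square algebra_simps)
qed

text \<open>Why the bound is not spoiled by nesting: a straightening step of quadratic cost at each of linearly many nested
stable letters would give a larger exponent. With the penalty term, the word inside a pair of stable letters has its value on an edge direction, where a suitable penalty is
zero and the path is already straight; passing through the stable letter costs only the length of
the corridor. A quadratic cost arises only when the result is wanted in the other family of paths, and then the penalty of the result pays for it.\<close>

lemma cost_plane_val_comb:
  assumes "plane_val w z" "slanted e"
  shows "cost (area_const * (len_pow w)\<^sup>2 + pen_const * penalty e z * len_pow w) w (comb e z)"
  using assms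
proof (induction arbitrary: e rule: plane_val.induct)
  case nil
  have "comb e 0 = []" by (simp add: comb_def level_def offset_def edge_pow_def)
  then show ?case by (simp add: rel_cost_refl)
next
  case (letter x)
  obtain y b where x: "x = (y, b)" by force
  have p1: "1 \<le> real p" using q_less_p by simp
  have "cost (2 * (2 * real p + 2)\<^sup>2) [x] (comb e (bval [x]))"
  proof (rule cost_base_words)
    have "\<bar>real_of_int (level e (bval [x]))\<bar> * (real p + 1) + \<bar>real_of_int (offset e (bval [x]))\<bar> \<le> 2 * real p + 2"
      using letter p1 by (auto elim!: slanted_cases simp: level_def offset_def x)
    then show "real (length (comb e (bval [x]))) \<le> 2 * real p + 2"
      using length_comb_le[of e "bval [x]"] by (simp add: mult.commute)
  qed (use letter bval_comb p1 in auto)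
  moreover have "0 \<le> pen_const * penalty e (bval [x])"
    using area_const_ge by (simp add: penalty_def)
  ultimately show ?case
    using area_const_ge(2) by (elim rel_cost_mono) simp
next
  case (append u z v w)
  let ?x = "len_pow u" and ?y = "len_pow v" and ?E = "2 * (real p + 2)\<^sup>2 * dist_const\<^sup>2"
  have b: "0 \<le> dist_const" using dist_const_ge_1 by simp
  note bu = level_offset_bounds[OF append.hyps(1) append.prems]
  note bv = level_offset_bounds[OF append.hyps(2) append.prems]
  have "cost (area_const * ?x\<^sup>2 + pen_const * penalty e z * ?x +
     (area_const * ?y\<^sup>2 + pen_const * penalty e w * ?y)) (u @ v) (comb e z @ comb e w)"
    by (rule rel_cost_append[OF append.IH[OF append.prems]])
  also note cost_comb_append
  finally have "cost (area_const * ?x\<^sup>2 + pen_const * penalty e z * ?x +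
     (area_const * ?y\<^sup>2 + pen_const * penalty e w * ?y) +
     2 * (real p + 2)\<^sup>2 * \<bar>real_of_int (offset e z)\<bar> * \<bar>real_of_int (level e w)\<bar>)
     (u @ v) (comb e (z + w))" .
  moreover have "2 * (real p + 2)\<^sup>2 * \<bar>real_of_int (offset e z)\<bar> * \<bar>real_of_int (level e w)\<bar> \<le> ?E * (?x * ?y)"
  proof -
    have "\<bar>real_of_int (offset e z)\<bar> * \<bar>real_of_int (level e w)\<bar> \<le> (dist_const * ?x) * (dist_const * ?y)"
      using bu bv b by (intro mult_mono) auto
    then have "2 * (real p + 2)\<^sup>2 * (\<bar>real_of_int (offset e z)\<bar> * \<bar>real_of_int (level e w)\<bar>)
       \<le> 2 * (real p + 2)\<^sup>2 * ((dist_const * ?x) * (dist_const * ?y))"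
      by (intro mult_left_mono) auto
    then show ?thesis by (simp add: power2_eq_square mult_ac)
  qed
  moreover have "(area_const * ?x\<^sup>2 + pen_const * penalty e z * ?x) +
     (area_const * ?y\<^sup>2 + pen_const * penalty e w * ?y) + ?E * (?x * ?y)
     \<le> area_const * (len_pow (u @ v))\<^sup>2 + pen_const * penalty e (z + w) * len_pow (u @ v)"
  proof (rule comb_append_arith)
    show "penalty e z \<le> penalty e (z + w) + dist_const * ?y" using bv by (auto simp: penalty_def min_def)
    show "penalty e w \<le> penalty e (z + w) + dist_const * ?x" using bu by (auto simp: penalty_def min_def)
    show "penalty e z \<le> dist_const * ?x" "penalty e w \<le> dist_const * ?y" using bu bv by (auto simp: penalty_def)
    show "0 \<le> penalty e (z + w)" by (simp add: penalty_def)
  qed (use b area_const_ge len_pow_append in auto)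
  ultimately show ?case by (elim rel_cost_mono) linarith
next
  case (wrap v m f)
  show ?case
  proof (cases "snd f")
    case True
    then have df: "slanted (flip f)" and vf: "edge_vec f = (int q, 0)"
      and ef: "edge_pow f = edge_pow (Gen_s, True)"
      using wrap.hyps by (auto simp: slanted_def stable_letter_def flip_def edge_vec_def edge_pow_def edge_word_def)
    have "cost (area_const * (len_pow v)\<^sup>2) v (edge_pow f m)"
      using wrap.IH[OF wrap.prems] comb_axis(1)[of e m Gen_s] comb_axis(2)[of e m] by (simp add: vf ef)
    note cost_wrap[OF wrap.hyps(2) this]
    also note cost_comb_other[OF wrap.prems df]
    finally have c: "cost (area_const * (len_pow v)\<^sup>2 + \<bar>real_of_int m\<bar> +
      2 * (3 * real p + 1)\<^sup>2 * penalty e (scl m (edge_vec (flip f))) * \<bar>real_of_int m\<bar>)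
      (flip f # v @ [f]) (comb e (scl m (edge_vec (flip f))))" .
    have "\<bar>real_of_int m\<bar> \<le> real q * \<bar>real_of_int m\<bar>"
      using q_pos mult_right_mono[of 1 "real q" "\<bar>real_of_int m\<bar>"] by simp
    also have "\<dots> \<le> vsize (scl m (edge_vec f))" by (simp add: vf vsize_def abs_mult)
    also have "\<dots> \<le> dist_const * len_pow v" by (rule plane_val_bounds(3)[OF wrap.hyps(1)])
    finally have m: "\<bar>real_of_int m\<bar> \<le> dist_const * len_pow v" .
    let ?P = "penalty e (scl m (edge_vec (flip f)))"
    have "2 * (3 * real p + 1)\<^sup>2 * ?P * \<bar>real_of_int m\<bar> \<le> 2 * (3 * real p + 1)\<^sup>2 * ?P * (dist_const * len_pow v)"
      using m by (intro mult_left_mono) (auto simp: penalty_def)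
    also have "\<dots> = pen_const * ?P * len_pow v" by (simp add: pen_const_def)
    also have "\<dots> \<le> pen_const * ?P * len_pow (flip f # v @ [f])"
      using area_const_ge(1) by (intro mult_left_mono len_pow_mono) (auto simp: penalty_def)
    finally show ?thesis using c cost_wrap_arith[OF m, of "flip f" f]
      by (elim rel_cost_mono) linarith
  next
    case False
    then have df: "slanted f" and ff: "edge_vec (flip f) = (int q, 0)"
      and ef: "flip f = (fst f, True)"
      using wrap.hyps by (auto simp: slanted_def flip_def edge_vec_def)
    have "cost (area_const * (len_pow v)\<^sup>2) v (edge_pow f m)"
      using wrap.IH[OF df] comb_edge_vec[OF df, of m] by simp
    note cost_wrap[OF wrap.hyps(2) this]
    also have "edge_pow (flip f) m = comb e (scl m (edge_vec (flip f)))"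
      using comb_axis(1)[of e m "fst f"] by (simp add: ff ef)
    finally have c: "cost (area_const * (len_pow v)\<^sup>2 + \<bar>real_of_int m\<bar>) (flip f # v @ [f])
      (comb e (scl m (edge_vec (flip f))))" .
    have "\<bar>real_of_int m\<bar> = \<bar>real_of_int (level f (scl m (edge_vec f)))\<bar>"
      using df by (auto elim!: slanted_cases simp: level_def)
    also have "\<dots> \<le> dist_const * len_pow v" by (rule level_offset_bounds(1)[OF wrap.hyps(1) df])
    finally have m: "\<bar>real_of_int m\<bar> \<le> dist_const * len_pow v" .
    show ?thesis using c cost_wrap_arith[OF m, of "flip f" f] comb_axis(2)[of e m]
      by (elim rel_cost_mono) (simp add: ff)
  qed
qed

definition plane_const :: real
  where "plane_const = area_const + pen_const * dist_const + 2 * ((real p + 2) * dist_const)\<^sup>2"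

lemma plane_const_nonneg: "0 \<le> plane_const"
  using area_const_ge dist_const_ge_1 by (simp add: plane_const_def)

lemma cost_plane_val:
  assumes "plane_val w z"
  shows "cost (plane_const * (len_pow w)\<^sup>2) w (plane_word z)"
proof -
  let ?e = "(Gen_s, False)"
  have d: "slanted ?e" by (simp add: slanted_def stable_letter_def)
  have b: "0 \<le> dist_const" using dist_const_ge_1 by simp
  note bo = level_offset_bounds[OF assms d]
  have 1: "cost (area_const * (len_pow w)\<^sup>2 + pen_const * penalty ?e z * len_pow w) w (comb ?e z)"
    by (rule cost_plane_val_comb[OF assms d])
  have 2: "cost (2 * ((real p + 2) * (dist_const * len_pow w))\<^sup>2) (comb ?e z) (plane_word z)"
  proof (rule cost_base_words)
    show "real (length (comb ?e z)) \<le> (real p + 2) * (dist_const * len_pow w)"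
    proof -
      have "(real p + 1) * \<bar>real_of_int (level ?e z)\<bar> \<le> (real p + 1) * (dist_const * len_pow w)"
        using bo by (intro mult_left_mono) auto
      then show ?thesis using length_comb_le[of ?e z] bo by (simp add: algebra_simps)
    qed
    have "1 * (dist_const * len_pow w) \<le> (real p + 2) * (dist_const * len_pow w)"
      using b by (intro mult_right_mono) auto
    then show "real (length (plane_word z)) \<le> (real p + 2) * (dist_const * len_pow w)"
      using plane_val_bounds(3)[OF assms] by (simp add: length_plane_word)
  qed (simp_all add: bval_comb[OF d])
  have "penalty ?e z \<le> dist_const * len_pow w" using bo by (simp add: penalty_def)
  then have "pen_const * penalty ?e z * len_pow w \<le> pen_const * (dist_const * len_pow w) * len_pow w"
    using area_const_ge(1) by (intro mult_right_mono mult_left_mono) auto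
  then show ?thesis using rel_cost_trans[OF 1 2]
    by (elim rel_cost_mono) (simp add: plane_const_def power2_eq_square algebra_simps)
qed

end


section \<open>Normal forms\<close>

text \<open>Normal forms \<open>c\<^sub>1 e\<^sub>1 c\<^sub>2 e\<^sub>2 \<dots> z\<close> of the HNN extension: each \<open>c\<^sub>i\<close> is a coset representative
modulo the edge group on the left of \<open>e\<^sub>i\<close>, and no pinch occurs.\<close>

datatype nf = Base vec | Syl vec "gen letter" nf

context snowflake
begin

text \<open>The multiple of \<open>edge_vec e\<close> that is removed from \<open>z\<close> to reach the representative of its coset. For
\<open>a^q\<close> the representatives have first coordinate in \<open>{0..<q}\<close>, for \<open>a^p b\<close> and \<open>a^p b\<inverse>\<close> they lie on the \<open>a\<close>-axis.\<close>

definition quo :: "gen letter \<Rightarrow> vec \<Rightarrow> int"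
  where "quo e z = (if snd e then fst z div int q else snd (edge_vec e) * snd z)"

lemma quo_add_edge [simp]:
  assumes "stable_letter e"
  shows "quo e (scl m (edge_vec e) + z) = m + quo e z" "quo e (z + scl m (edge_vec e)) = quo e z + m"
    "quo e (scl m (edge_vec e)) = m"
  using assms q_pos by (cases rule: stable_letter_cases; simp add: quo_def algebra_simps)+

lemma quo_0 [simp]: "quo e 0 = 0"
  by (simp add: quo_def)

lemma edge_vec_inj:
  assumes "scl m (edge_vec e) = scl n (edge_vec f)" "stable_letter e" "stable_letter f"
  shows "m = n"
  using assms(2)
  by (cases rule: stable_letter_cases; insert assms(1,3) q_pos q_less_p;
      auto elim!: stable_letter_cases simp: scl_def)

text \<open>Left multiplication by a plane element: the part in the edge group moves on through the stable letter.\<close>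

fun plane_act :: "vec \<Rightarrow> nf \<Rightarrow> nf" where
  "plane_act x (Base z) = Base (x + z)"
| "plane_act x (Syl c e n) = Syl (x + c - scl (quo e (x + c)) (edge_vec e)) e
     (plane_act (scl (quo e (x + c)) (edge_vec (flip e))) n)"

fun cancels :: "gen letter \<Rightarrow> nf \<Rightarrow> bool" where
  "cancels e (Base z) = False"
| "cancels e (Syl c f n) = (c = 0 \<and> f = flip e)"

fun nf_tail :: "nf \<Rightarrow> nf" where
  "nf_tail (Base z) = Base z"
| "nf_tail (Syl c e n) = n"

definition stable_act :: "gen letter \<Rightarrow> nf \<Rightarrow> nf"
  where "stable_act e n = (if cancels e n then nf_tail n else Syl 0 e n)"

fun valid :: "nf \<Rightarrow> bool" where
  "valid (Base z) = True"
| "valid (Syl c e n) = (stable_letter e \<and> quo e c = 0 \<and> \<not> cancels e n \<and> valid n)"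

lemma plane_act_0: "valid n \<Longrightarrow> plane_act 0 n = n"
  by (induction n) auto

lemma plane_act_add: "valid n \<Longrightarrow> plane_act x (plane_act y n) = plane_act (x + y) n"
proof (induction n arbitrary: x y)
  case (Base z)
  then show ?case by (simp add: add.assoc)
next
  case (Syl c e n)
  let ?m = "quo e (y + c)" and ?k = "quo e (x + y + c)"
  have e: "stable_letter e" using Syl.prems by simp
  have q: "quo e (x + (y + c - scl ?m (edge_vec e))) = ?k - ?m"
    using quo_add_edge(2)[OF e, of "x + y + c" "- ?m"] by (simp add: algebra_simps)
  have "scl (?k - ?m) (edge_vec (flip e)) + scl ?m (edge_vec (flip e)) = scl ?k (edge_vec (flip e))"
    by (simp add: scl_distribs)
  moreover have "x + (y + c - scl ?m (edge_vec e)) - scl (?k - ?m) (edge_vec e) =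
      x + y + c - scl ?k (edge_vec e)"
    by (simp add: scl_distribs algebra_simps)
  ultimately show ?case using Syl by (simp add: q)
qed

lemma cancels_plane_act:
  "valid n \<Longrightarrow> stable_letter e \<Longrightarrow> cancels e (plane_act (scl m (edge_vec (flip e))) n) = cancels e n"
  by (cases n) auto

lemma valid_plane_act: "valid n \<Longrightarrow> valid (plane_act x n)"
proof (induction n arbitrary: x)
  case (Syl c e n)
  have e: "stable_letter e" using Syl.prems by simp
  have "quo e (x + c - scl (quo e (x + c)) (edge_vec e)) = 0"
    using quo_add_edge(2)[OF e, of "x + c" "- quo e (x + c)"] by simp
  then show ?case using Syl cancels_plane_act[of n e] by simp
qed simp

lemma valid_stable_act: "valid n \<Longrightarrow> stable_letter e \<Longrightarrow> valid (stable_act e n)"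
  by (cases n) (auto simp: stable_act_def)

lemma stable_act_flip:
  "valid n \<Longrightarrow> stable_letter e \<Longrightarrow> stable_act (flip e) (stable_act e n) = n"
  by (cases n) (auto simp: stable_act_def)

lemma plane_act_stable_act:
  "valid n \<Longrightarrow> stable_letter e \<Longrightarrow>
    plane_act (scl m (edge_vec e)) (stable_act e n) = stable_act e (plane_act (scl m (edge_vec (flip e))) n)"
  using cancels_plane_act[of n e m] by (cases n) (auto simp: stable_act_def)

definition nf_act :: "gen letter \<Rightarrow> nf \<Rightarrow> nf"
  where "nf_act x = (if stable_letter x then stable_act x else plane_act (bval [x]))"

lemma stable_letter_iff_base: "base_word [x] \<longleftrightarrow> \<not> stable_letter x"
  by (cases "fst x") (auto simp: stable_letter_def)

lemma nf_act_flip: "valid n \<Longrightarrow> nf_act (flip x) (nf_act x n) = n"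
proof (cases "stable_letter x")
  case False
  assume "valid n"
  moreover have "bval [flip x] + bval [x] = 0" by (cases x) (simp add: flip_def)
  ultimately show ?thesis using False by (simp add: nf_act_def plane_act_add plane_act_0 del: bval.simps)
qed (simp add: nf_act_def stable_act_flip)

lemma valid_nf_act: "valid n \<Longrightarrow> valid (nf_act x n)"
  by (simp add: nf_act_def valid_plane_act valid_stable_act)

lemma valid_word_nf_act: "valid n \<Longrightarrow> valid (foldr nf_act u n)"
  by (induction u) (simp_all add: valid_nf_act)

lemma nf_act_base_word: "base_word w \<Longrightarrow> valid n \<Longrightarrow> foldr nf_act w n = plane_act (bval w) n"
proof (induction w)
  case (Cons x w)
  then have "nf_act x = plane_act (bval [x])" using stable_letter_iff_base[of x] by (simp add: nf_act_def)
  then show ?case using Cons bval_append[of "[x]" w]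
    by (simp add: plane_act_add del: bval.simps bval_append)
qed (simp add: plane_act_0)

lemma nf_act_relator:
  assumes "r \<in> rels" "valid n"
  shows "foldr nf_act r n = n"
proof -
  have *: "foldr nf_act ([flip e] @ edge_word e @ [e] @ winv (edge_word (flip e))) n = n"
    if e: "stable_letter e" for e
  proof -
    let ?n = "plane_act (- edge_vec (flip e)) n"
    have v: "valid ?n" by (rule valid_plane_act[OF assms(2)])
    have "foldr nf_act ([flip e] @ edge_word e @ [e] @ winv (edge_word (flip e))) n =
      stable_act (flip e) (plane_act (scl 1 (edge_vec e)) (stable_act e ?n))"
      using e v assms(2) by (simp add: nf_act_base_word nf_act_def valid_stable_act)
    also have "\<dots> = stable_act (flip e) (stable_act e (plane_act (scl 1 (edge_vec (flip e))) ?n))"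
      by (simp only: plane_act_stable_act[OF v e])
    also have "\<dots> = plane_act (scl 1 (edge_vec (flip e))) ?n"
      by (rule stable_act_flip[OF valid_plane_act[OF v] e])
    also have "\<dots> = n" using assms(2) by (simp add: plane_act_add plane_act_0)
    finally show ?thesis .
  qed
  consider "r = commutator (gpow Gen_a 1) (gpow Gen_b 1)"
    | "r = [flip (Gen_s, True)] @ edge_word (Gen_s, True) @ [(Gen_s, True)] @
         winv (edge_word (flip (Gen_s, True)))"
    | "r = [flip (Gen_t, True)] @ edge_word (Gen_t, True) @ [(Gen_t, True)] @
         winv (edge_word (flip (Gen_t, True)))"
    using assms(1) by (auto simp: B_relators_def Let_def edge_word_def gpow_def[of Gen_s]
        gpow_def[of Gen_t] winv_def flip_def)
  then show ?thesis
  proof cases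
    case 1
    then have "base_word r" "bval r = 0" by (simp_all add: commutator_def zero_prod_def)
    then show ?thesis using assms(2) by (simp add: nf_act_base_word plane_act_0)
  next
    case 2
    show ?thesis unfolding 2 by (rule *) (simp add: stable_letter_def)
  next
    case 3
    show ?thesis unfolding 3 by (rule *) (simp add: stable_letter_def)
  qed
qed

text \<open>The group acts on normal forms. So words that are equal in the group have the same normal form, which will separate reduced forms.\<close>

lemma nf_act_word_equiv:
  "word_equiv rels u v \<Longrightarrow> valid n \<Longrightarrow> foldr nf_act u n = foldr nf_act v n"
proof (induction arbitrary: n rule: word_equiv.induct)
  case (cancel u x v)
  then show ?case using nf_act_flip[of "foldr nf_act v n" "flip x"] by (simp add: valid_word_nf_act)
next
  case (relator r u v)
  then show ?case by (simp add: nf_act_relator valid_word_nf_act)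
qed simp_all

section \<open>Reduced forms\<close>

text \<open>The list \<open>(e\<^sub>1, g\<^sub>1), (e\<^sub>2, g\<^sub>2), \<dots>\<close> stands for \<open>e\<^sub>1 g\<^sub>1 e\<^sub>2 g\<^sub>2 \<dots>\<close>; a leading plane element is kept separately, so that
forms can be rotated.\<close>

type_synonym form = "(gen letter \<times> vec) list"

definition form_word :: "form \<Rightarrow> gen wrd"
  where "form_word L = concat (map (\<lambda>(e, g). e # plane_word g) L)"

lemma form_word_simps [simp]:
  "form_word [] = []" "form_word ((e, g) # L) = e # plane_word g @ form_word L"
  "form_word (L @ M) = form_word L @ form_word M"
  by (simp_all add: form_word_def)

fun no_pinch :: "gen letter \<times> vec \<Rightarrow> gen letter \<times> vec \<Rightarrow> bool" where
  "no_pinch (e, g) (f, h) \<longleftrightarrow> \<not> (f = flip e \<and> (\<exists>m. g = scl m (edge_vec f)))"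

definition reduced :: "form \<Rightarrow> bool"
  where "reduced L \<longleftrightarrow> (\<forall>x\<in>set L. stable_letter (fst x)) \<and> successively no_pinch L"

lemma reduced_simps [simp]:
  "reduced []" "reduced (x # L) \<longleftrightarrow> stable_letter (fst x) \<and> reduced L \<and> (L \<noteq> [] \<longrightarrow> no_pinch x (hd L))"
  by (auto simp: reduced_def successively_Cons)

lemma reduced_append:
  "reduced (L @ M) \<longleftrightarrow> reduced L \<and> reduced M \<and> (L \<noteq> [] \<longrightarrow> M \<noteq> [] \<longrightarrow> no_pinch (last L) (hd M))"
  by (auto simp: reduced_def successively_append_iff)

text \<open>The normal form of \<open>x e\<^sub>1 g\<^sub>1 e\<^sub>2 g\<^sub>2 \<dots> z\<close>.\<close>

fun nform :: "vec \<Rightarrow> form \<Rightarrow> vec \<Rightarrow> nf" where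
  "nform x [] z = Base (x + z)"
| "nform x ((e, g) # L) z = plane_act x (stable_act e (nform g L z))"

lemma valid_nform: "reduced L \<Longrightarrow> valid (nform x L z)"
  by (induction x L z rule: nform.induct) (auto simp: valid_plane_act valid_stable_act)

lemma nf_act_form_word:
  "reduced L \<Longrightarrow> foldr nf_act (plane_word x @ form_word L @ plane_word z) (Base 0) = nform x L z"
proof (induction x L z rule: nform.induct)
  case (1 x z)
  then show ?case by (simp add: nf_act_base_word)
next
  case (2 x e g L z)
  have "nf_act e = stable_act e" using 2 by (simp add: nf_act_def)
  then show ?case
    using 2 valid_nform[of L g z]
    by (simp add: nf_act_base_word valid_stable_act)
qed

lemma plane_act_nform: "reduced L \<Longrightarrow> plane_act y (nform x L z) = nform (y + x) L z"
  by (cases L) (auto simp: plane_act_add valid_stable_act valid_nform add.assoc)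

text \<open>Britton's lemma: in a reduced form no stable letter ever cancels, so the letters of the form are
those of its normal form.\<close>

lemma stable_act_nform:
  assumes "reduced ((e, g) # L)"
  shows "stable_act e (nform g L z) = Syl 0 e (nform g L z)"
proof -
  have "\<not> cancels e (nform g L z)" using assms
  proof (induction L arbitrary: e g)
    case (Cons x L)
    obtain f h where x: "x = (f, h)" by (metis surj_pair)
    have "\<not> cancels f (nform h L z)" using Cons x by auto
    then have "nform g (x # L) z = plane_act g (Syl 0 f (nform h L z))" by (simp add: x stable_act_def)
    then show ?case using Cons.prems by (auto simp: x)
  qed simp
  then show ?thesis by (simp add: stable_act_def)
qed

text \<open>A ladder joins two forms with the same stable letters by edge group elements: for \<open>L = (e, g) # L'\<close> and \<open>M = (e, h) # M'\<close>, the
element \<open>d = m edge_vec e\<close> is moved across \<open>e\<close>, and what is left of it after comparing \<open>g\<close> with \<open>h\<close>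
enters the rest. So \<open>ladder d L M z\<close> says that \<open>L z = d M\<close>, syllable by syllable.\<close>

fun ladder :: "vec \<Rightarrow> form \<Rightarrow> form \<Rightarrow> vec \<Rightarrow> bool" where
  "ladder d [] [] z \<longleftrightarrow> d = z"
| "ladder d ((e, g) # L) ((f, h) # M) z \<longleftrightarrow> e = f \<and>
     (\<exists>m. d = scl m (edge_vec e) \<and> ladder (h + scl m (edge_vec (flip e)) - g) L M z)"
| "ladder d _ _ z \<longleftrightarrow> False"

lemma ladder_length: "ladder d L M z \<Longrightarrow> length L = length M"
  by (induction d L M z rule: ladder.induct) auto

text \<open>Comparing normal forms from the left. Equal representatives mean that the first plane elements
differ by an element of the edge group, and this element is the next rung.\<close>

lemma nform_eq_imp_ladder:
  assumes "reduced L" "reduced M" "nform x L z = nform y M w"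
  shows "ladder (y - x) L M (z - w)"
  using assms
proof (induction L arbitrary: M x y)
  case Nil
  then show ?case
  proof (cases M)
    case (Cons a M')
    then show ?thesis using Nil stable_act_nform[of "fst a" "snd a" M' w] by (cases a) auto
  qed (simp add: algebra_simps)
next
  case (Cons a L)
  obtain e g where a: "a = (e, g)" by (metis surj_pair)
  have l: "nform x (a # L) z = Syl (x - scl (quo e x) (edge_vec e)) e
      (nform (scl (quo e x) (edge_vec (flip e)) + g) L z)"
    using stable_act_nform[of e g L z] Cons.prems(1) by (simp add: a plane_act_nform)
  show ?case
  proof (cases M)
    case Nil
    then show ?thesis using l Cons.prems by simp
  next
    case (Cons b M')
    obtain f h where b: "b = (f, h)" by (metis surj_pair)
    have r: "nform y M w = Syl (y - scl (quo f y) (edge_vec f)) f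
      (nform (scl (quo f y) (edge_vec (flip f)) + h) M' w)"
      using stable_act_nform[of f h M' w] Cons.prems(2) Cons by (simp add: b plane_act_nform)
    have eq: "e = f" "x - scl (quo e x) (edge_vec e) = y - scl (quo e y) (edge_vec e)"
      "nform (scl (quo e x) (edge_vec (flip e)) + g) L z = nform (scl (quo e y) (edge_vec (flip e)) + h) M' w"
      using l r Cons.prems(3) by auto
    let ?m = "quo e y - quo e x"
    have "ladder (scl (quo e y) (edge_vec (flip e)) + h - (scl (quo e x) (edge_vec (flip e)) + g)) L M' (z - w)"
      using Cons.IH[OF _ _ eq(3)] Cons.prems Cons by simp
    also have "scl (quo e y) (edge_vec (flip e)) + h - (scl (quo e x) (edge_vec (flip e)) + g) =
       h + scl ?m (edge_vec (flip e)) - g"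
      by (simp add: scl_distribs algebra_simps)
    finally have "ladder (h + scl ?m (edge_vec (flip e)) - g) L M' (z - w)" .
    moreover have "y - x = scl ?m (edge_vec e)"
      using eq(2) by (simp add: scl_distribs algebra_simps)
    ultimately show ?thesis using Cons eq(1) by (auto simp: a b)
  qed
qed

lemma word_equiv_imp_ladder:
  assumes "word_equiv rels (plane_word x @ form_word L @ plane_word z)
    (plane_word y @ form_word M @ plane_word w)" "reduced L" "reduced M"
  shows "ladder (y - x) L M (z - w)"
  using nf_act_word_equiv[OF assms(1), of "Base 0"] assms(2,3)
  by (intro nform_eq_imp_ladder) (simp_all only: nf_act_form_word valid.simps)

section \<open>Conjugacy\<close>

lemma plane_word_add: "word_equiv rels (plane_word x @ plane_word y) (plane_word (x + y))"
  by (rule word_equiv_base_words) auto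

lemma plane_word_0 [simp]: "plane_word 0 = []"
  by (simp add: plane_word_def)

lemma pinch_word:
  assumes "stable_letter e"
  shows "word_equiv rels (flip e # plane_word (scl m (edge_vec e)) @ [e])
     (plane_word (scl m (edge_vec (flip e))))"
proof -
  have pw: "word_equiv rels (plane_word (scl m (edge_vec e))) (edge_pow e m)" for e
    by (rule word_equiv_base_words) auto
  have "word_equiv rels (plane_word (scl m (edge_vec e)) @ [e]) (edge_pow e m @ [e])"
    by (rule word_equiv_append[OF pw word_equiv.refl])
  also have "word_equiv rels \<dots> ([e] @ edge_pow (flip e) m)"
    by (rule rel_cost_imp_word_equiv[OF cost_edge_pow[OF assms]])
  also have "word_equiv rels \<dots> ([e] @ plane_word (scl m (edge_vec (flip e))))"
    by (rule word_equiv_append[OF word_equiv.refl word_equiv.sym[OF pw]])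
  finally show ?thesis
    using word_equiv_move_left[of rels "[flip e]" "plane_word (scl m (edge_vec e)) @ [e]"] by simp
qed

lemma reduced_form_exists:
  "\<exists>x K. reduced K \<and> word_equiv rels w (plane_word x @ form_word K)"
proof (induction w)
  case Nil
  show ?case by (intro exI[of _ 0] exI[of _ "[]"]) (simp add: word_equiv.refl)
next
  case (Cons l w)
  then obtain x K where K: "reduced K" "word_equiv rels w (plane_word x @ form_word K)" by blast
  have lw: "word_equiv rels (l # w) (l # plane_word x @ form_word K)"
    using word_equiv_append[OF word_equiv.refl K(2), of "[l]"] by simp
  show ?case
  proof (cases "stable_letter l")
    case False
    then have "base_word [l]" using stable_letter_iff_base by blast
    then have "word_equiv rels [l] (plane_word (bval [l]))"
      by (intro rel_cost_imp_word_equiv[OF cost_sort_base_word])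
    from word_equiv_append[OF this word_equiv.refl, of "plane_word x @ form_word K"]
    have "word_equiv rels (l # plane_word x @ form_word K)
       ((plane_word (bval [l]) @ plane_word x) @ form_word K)" by simp
    also have "word_equiv rels \<dots> (plane_word (bval [l] + x) @ form_word K)"
      by (rule word_equiv_append[OF plane_word_add word_equiv.refl])
    finally show ?thesis using lw K(1) word_equiv.trans by blast
  next
    case l: True
    show ?thesis
    proof (cases "reduced ((l, x) # K)")
      case True
      then show ?thesis using lw by (intro exI[of _ 0] exI[of _ "(l, x) # K"]) simp
    next
      case False
      with l K(1) have ne: "K \<noteq> []" "\<not> no_pinch (l, x) (hd K)" by auto
      obtain f h K' where Kf: "K = (f, h) # K'" using ne(1) by (metis list.exhaust surj_pair)
      with ne(2) obtain m where "f = flip l" "x = scl m (edge_vec f)" by auto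
      with Kf have K': "K = (flip l, h) # K'" "x = scl m (edge_vec (flip l))" by simp_all
      from word_equiv_append[OF pinch_word[of "flip l" m] word_equiv.refl, of "plane_word h @ form_word K'"]
      have "word_equiv rels (l # plane_word x @ form_word K)
        ((plane_word (scl m (edge_vec l)) @ plane_word h) @ form_word K')"
        using l by (simp add: K')
      also have "word_equiv rels \<dots> (plane_word (scl m (edge_vec l) + h) @ form_word K')"
        by (rule word_equiv_append[OF plane_word_add word_equiv.refl])
      finally show ?thesis using lw K(1) K' word_equiv.trans by (metis reduced_simps(2))
    qed
  qed
qed

definition cyc_reduced :: "form \<Rightarrow> bool"
  where "cyc_reduced L \<longleftrightarrow> reduced L \<and> L \<noteq> [] \<and> no_pinch (last L) (hd L)"

lemma cyc_reduced_rotate1: "cyc_reduced L \<Longrightarrow> cyc_reduced (rotate1 L)"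
  by (cases L) (auto simp: cyc_reduced_def reduced_append hd_append split: if_splits)

lemma cyc_reduced_rotate: "cyc_reduced L \<Longrightarrow> cyc_reduced (rotate k L)"
  by (induction k) (simp_all add: cyc_reduced_rotate1)

lemma form_absorb:
  assumes "reduced K"
  shows "\<exists>x' K'. reduced K' \<and> length K' = length K \<and>
    word_equiv rels (plane_word x @ form_word K @ plane_word y) (plane_word x' @ form_word K')"
proof (cases K rule: rev_cases)
  case Nil
  then show ?thesis using plane_word_add[of x y] by (intro exI[of _ "x + y"] exI[of _ "[]"]) simp
next
  case (snoc K1 a)
  obtain e g where a: "a = (e, g)" by (metis surj_pair)
  have "word_equiv rels (plane_word x @ form_word K @ plane_word y)
     (plane_word x @ form_word (K1 @ [(e, g + y)]))"
    using word_equiv_append[OF word_equiv.refl plane_word_add, of "plane_word x @ form_word K1 @ [e]" g y]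
    by (simp add: snoc a)
  moreover have "reduced (K1 @ [(e, g + y)])"
    using assms by (cases "last K1") (auto simp: snoc a reduced_append)
  ultimately show ?thesis using snoc by (intro exI[of _ x] exI[of _ "K1 @ [(e, g + y)]"]) simp
qed

text \<open>If the last stable letter of the conjugator cancels against the first letter \<open>f\<close> of the conjugated
form, then appending that first syllable, that is, rotating the form, shortens the conjugator.\<close>

lemma conjugator_shorten_right:
  assumes "reduced K" "K \<noteq> []" "\<not> no_pinch (last K) (f, h)"
    "word_equiv rels w (plane_word x @ form_word K)"
  shows "\<exists>x' K'. reduced K' \<and> length K' < length K \<and>
    word_equiv rels (w @ f # plane_word h) (plane_word x' @ form_word K')"
proof -
  obtain K1 d k where K: "K = K1 @ [(d, k)]" using assms(2) by (metis rev_exhaust surj_pair)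
  then obtain m where m: "f = flip d" "k = scl m (edge_vec f)" using assms(3) by auto
  have st: "stable_letter f" using assms(1) m by (simp add: K reduced_append)
  have "word_equiv rels (w @ f # plane_word h) ((plane_word x @ form_word K) @ f # plane_word h)"
    by (rule word_equiv_append[OF assms(4) word_equiv.refl])
  also have "(plane_word x @ form_word K) @ f # plane_word h =
     (plane_word x @ form_word K1) @ (flip f # plane_word (scl m (edge_vec f)) @ [f]) @ plane_word h"
    by (simp add: K m)
  also have "word_equiv rels \<dots>
      ((plane_word x @ form_word K1) @ plane_word (scl m (edge_vec (flip f))) @ plane_word h)"
    by (rule word_equiv_context[OF pinch_word[OF st]])
  also have "word_equiv rels \<dots> ((plane_word x @ form_word K1) @ plane_word (scl m (edge_vec (flip f)) + h))"
    by (rule word_equiv_append[OF word_equiv.refl plane_word_add])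
  finally have 1: "word_equiv rels (w @ f # plane_word h)
     (plane_word x @ form_word K1 @ plane_word (scl m (edge_vec (flip f)) + h))" by simp
  have "reduced K1" using assms(1) by (simp add: K reduced_append)
  from form_absorb[OF this] obtain x' K' where K': "reduced K'" "length K' = length K1"
    "word_equiv rels (plane_word x @ form_word K1 @ plane_word (scl m (edge_vec (flip f)) + h))
       (plane_word x' @ form_word K')" by blast
  show ?thesis using word_equiv.trans[OF 1 K'(3)] K'(1,2) K
    by (intro exI[of _ x'] exI[of _ K']) simp
qed

text \<open>Shorten the conjugator until nothing cancels. Then both sides of \<open>y w = w M\<close> are reduced, but
the right one has more stable letters.\<close>

lemma plane_hyperbolic_not_conjugate:
  assumes "cyc_reduced M" "word_equiv rels (plane_word y @ w) (w @ form_word M)"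
  shows False
proof -
  obtain x K where K: "reduced K" "word_equiv rels w (plane_word x @ form_word K)"
    using reduced_form_exists by blast
  show False using assms K
  proof (induction "length K" arbitrary: M w x K rule: less_induct)
    case less
    obtain f h M' where M: "M = (f, h) # M'" using less.prems(1)
      unfolding cyc_reduced_def by (metis list.exhaust surj_pair)
    show False
    proof (cases "K = [] \<or> no_pinch (last K) (f, h)")
      case True
      have "word_equiv rels (plane_word (y + x) @ form_word K) ((plane_word y @ plane_word x) @ form_word K)"
        by (rule word_equiv_append[OF word_equiv.sym[OF plane_word_add] word_equiv.refl])
      also have "word_equiv rels \<dots> (plane_word y @ w)"
        using word_equiv_append[OF word_equiv.refl word_equiv.sym[OF less.prems(4)]] by simp
      also have "word_equiv rels \<dots> (w @ form_word M)" by fact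
      also have "word_equiv rels \<dots> ((plane_word x @ form_word K) @ form_word M)"
        by (rule word_equiv_append[OF less.prems(4) word_equiv.refl])
      finally have "word_equiv rels (plane_word (y + x) @ form_word K @ plane_word 0)
          (plane_word x @ form_word (K @ M) @ plane_word 0)" by simp
      note eq = this
      have "reduced (K @ M)"
        using less.prems(1,3) True by (auto simp: reduced_append cyc_reduced_def M)
      from ladder_length[OF word_equiv_imp_ladder[OF eq less.prems(3) this]]
      show False using M by simp
    next
      case False
      then obtain x' K' where K': "reduced K'" "length K' < length K"
        "word_equiv rels (w @ f # plane_word h) (plane_word x' @ form_word K')"
        using conjugator_shorten_right less.prems(3,4) by blast
      have "word_equiv rels (plane_word y @ w @ f # plane_word h)
         ((w @ f # plane_word h) @ form_word (rotate1 M))"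
        using word_equiv_append[OF less.prems(2) word_equiv.refl, of "f # plane_word h"] by (simp add: M)
      then show False
        using less.hyps[OF K'(2) cyc_reduced_rotate1[OF less.prems(1)] _ K'(1,3)] by blast
    qed
  qed
qed

text \<open>A ladder from a form to itself: its rungs all have the same coefficient, since an element of the
plane determines its coefficient in any edge group containing it.\<close>

lemma ladder_self:
  assumes "ladder z K K z'" "\<forall>x\<in>set K. stable_letter (fst x)"
  shows "z = z' \<or> (\<exists>m e f. stable_letter e \<and> stable_letter f \<and> z = scl m (edge_vec e) \<and> z' = scl m (edge_vec f))"
  using assms
proof (induction K arbitrary: z)
  case (Cons a K)
  obtain e g where a: "a = (e, g)" by (metis surj_pair)
  obtain m where m: "z = scl m (edge_vec e)" "ladder (scl m (edge_vec (flip e))) K K z'"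
    using Cons.prems by (auto simp: a)
  have e: "stable_letter e" using Cons.prems(2) by (simp add: a)
  from Cons.IH[OF m(2)] Cons.prems(2) consider "scl m (edge_vec (flip e)) = z'" |
    n e' f where "stable_letter e'" "stable_letter f" "scl m (edge_vec (flip e)) = scl n (edge_vec e')"
      "z' = scl n (edge_vec f)" by auto
  then show ?case
  proof cases
    case 1
    then show ?thesis using m(1) e by (metis stable_letter_flip)
  next
    case 2
    have "m = n" by (rule edge_vec_inj[OF 2(3)]) (use e 2 in simp_all)
    then show ?thesis using m(1) e 2 by blast
  qed
qed simp

lemma plane_conjugate:
  assumes "word_equiv rels (plane_word y @ w) (w @ plane_word y')"
  shows "y = y' \<or> (\<exists>m e f. stable_letter e \<and> stable_letter f \<and> y = scl m (edge_vec e) \<and> y' = scl m (edge_vec f))"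
proof -
  obtain x K where K: "reduced K" "word_equiv rels w (plane_word x @ form_word K)"
    using reduced_form_exists by blast
  have "word_equiv rels (plane_word (y + x) @ form_word K) ((plane_word y @ plane_word x) @ form_word K)"
    by (rule word_equiv_append[OF word_equiv.sym[OF plane_word_add] word_equiv.refl])
  also have "word_equiv rels \<dots> (plane_word y @ w)"
    using word_equiv_append[OF word_equiv.refl word_equiv.sym[OF K(2)]] by simp
  also have "word_equiv rels \<dots> (w @ plane_word y')" by fact
  also have "word_equiv rels \<dots> ((plane_word x @ form_word K) @ plane_word y')"
    by (rule word_equiv_append[OF K(2) word_equiv.refl])
  finally have "word_equiv rels (plane_word (y + x) @ form_word K @ plane_word 0)
      (plane_word x @ form_word K @ plane_word y')" by simp
  from word_equiv_imp_ladder[OF this K(1) K(1)] have "ladder (- y) K K (- y')" by simp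
  from ladder_self[OF this] K(1)
  consider "y = y'" | m e f where "stable_letter e" "stable_letter f" "- y = scl m (edge_vec e)"
    "- y' = scl m (edge_vec f)" by (auto simp: reduced_def)
  then show ?thesis
  proof cases
    case 2
    then have "y = scl (- m) (edge_vec e)" "y' = scl (- m) (edge_vec f)"
      by (metis minus_minus scl_simps(4))+
    then show ?thesis using 2 by blast
  qed simp
qed

text \<open>Collins' lemma. By induction on the number of stable letters in the conjugator \<open>w\<close>. If a pinch occurs where \<open>w\<close> meets \<open>L\<close>
or \<open>M\<close>, rotating that form makes \<open>w\<close> shorter. If there is none, both sides of
\<open>L w = w M\<close> are reduced, so \<open>w\<close> begins with the first letter of \<open>L\<close>, and again rotating \<open>L\<close>
makes \<open>w\<close> shorter. In the end \<open>w\<close> is in the plane and the two reduced forms are joined by a ladder.\<close>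

lemma hyperbolic_conjugate:
  assumes "cyc_reduced L" "cyc_reduced M" "word_equiv rels (form_word L @ w) (w @ form_word M)"
  shows "\<exists>i j z. ladder z (rotate i L) (rotate j M) z"
proof -
  obtain x K where K: "reduced K" "word_equiv rels w (plane_word x @ form_word K)"
    using reduced_form_exists by blast
  show ?thesis using assms K
  proof (induction "length K" arbitrary: L M w x K rule: less_induct)
    case less
    obtain L0 e g where L: "L = L0 @ [(e, g)]"
      using less.prems(1) unfolding cyc_reduced_def by (metis rev_exhaust surj_pair)
    obtain f h M' where M: "M = (f, h) # M'" using less.prems(2)
      unfolding cyc_reduced_def by (metis list.exhaust surj_pair)
    have st: "stable_letter e" using less.prems(1) by (simp add: L cyc_reduced_def reduced_append)
    have lhs: "word_equiv rels (form_word L @ w) (form_word L0 @ (e # plane_word (g + x)) @ form_word K)"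
    proof -
      have "word_equiv rels (form_word L @ w) (form_word L @ plane_word x @ form_word K)"
        by (rule word_equiv_append[OF word_equiv.refl less.prems(5)])
      also have "\<dots> = (form_word L0 @ [e]) @ (plane_word g @ plane_word x) @ form_word K"
        by (simp add: L)
      also have "word_equiv rels \<dots> ((form_word L0 @ [e]) @ plane_word (g + x) @ form_word K)"
        by (rule word_equiv_context[OF plane_word_add])
      finally show ?thesis by simp
    qed
    have rhs: "word_equiv rels (w @ form_word M) (plane_word x @ form_word (K @ M))"
      using word_equiv_append[OF less.prems(5) word_equiv.refl, of "form_word M"] by simp
    consider (base) "K = []" | (right) "K \<noteq> []" "\<not> no_pinch (last K) (f, h)"
      | (left) "K \<noteq> []" "\<not> no_pinch (e, g + x) (hd K)"
      | (none) "K \<noteq> []" "no_pinch (last K) (f, h)" "no_pinch (e, g + x) (hd K)" by blast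
    then show ?case
    proof cases
      case base
      have "word_equiv rels (form_word L @ plane_word x) (form_word L @ w)"
        using word_equiv_append[OF word_equiv.refl word_equiv.sym[OF less.prems(5)], of "form_word L"] base by simp
      also note less.prems(3)
      also note rhs
      finally have "word_equiv rels (plane_word 0 @ form_word L @ plane_word x)
        (plane_word x @ form_word M @ plane_word 0)" using base by simp
      from word_equiv_imp_ladder[OF this] less.prems(1,2) have "ladder x L M x"
        by (simp add: cyc_reduced_def)
      then show ?thesis by (intro exI[of _ 0] exI[of _ x]) simp
    next
      case right
      then obtain x' K' where K': "reduced K'" "length K' < length K"
        "word_equiv rels (w @ f # plane_word h) (plane_word x' @ form_word K')"
        using conjugator_shorten_right less.prems(4,5) by blast
      have "word_equiv rels (form_word L @ w @ f # plane_word h)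
         ((w @ f # plane_word h) @ form_word (rotate1 M))"
        using word_equiv_append[OF less.prems(3) word_equiv.refl, of "f # plane_word h"] by (simp add: M)
      then obtain i j z where "ladder z (rotate i L) (rotate j (rotate1 M)) z"
        using less.hyps[OF K'(2) less.prems(1) cyc_reduced_rotate1[OF less.prems(2)] _ K'(1,3)] by blast
      then have "ladder z (rotate i L) (rotate (Suc j) M) z" by (simp add: rotate1_rotate_swap)
      then show ?thesis by blast
    next
      case left
      obtain f' k K' where Kf: "K = (f', k) # K'" using left(1) by (metis list.exhaust surj_pair)
      with left(2) obtain m where "f' = flip e" "g + x = scl m (edge_vec f')" by auto
      with Kf have K': "K = (flip e, k) # K'" "g + x = scl m (edge_vec (flip e))" by simp_all
      let ?w = "e # plane_word g @ w" and ?L = "(e, g) # L0"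
      have L': "L = rotate1 ?L" by (simp add: L)
      then have L'': "?L = rotate (length L - 1) L"
        by (simp add: L rotate_append)
      have "word_equiv rels (e # plane_word g @ w) (e # plane_word g @ plane_word x @ form_word K)"
        using word_equiv_append[OF word_equiv.refl less.prems(5), of "e # plane_word g"] by simp
      also have "word_equiv rels (e # plane_word g @ plane_word x @ form_word K)
          ([e] @ plane_word (g + x) @ form_word K)"
        using word_equiv_context[OF plane_word_add, of "[e]" g x "form_word K"] by simp
      also have "word_equiv rels \<dots> (plane_word (scl m (edge_vec e)) @ plane_word k @ form_word K')"
        using word_equiv_append[OF pinch_word[of "flip e" m] word_equiv.refl, of "plane_word k @ form_word K'"] st
        by (simp add: K')
      also have "word_equiv rels \<dots> (plane_word (scl m (edge_vec e) + k) @ form_word K')"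
        using word_equiv_append[OF plane_word_add word_equiv.refl] by simp
      finally have w: "word_equiv rels ?w (plane_word (scl m (edge_vec e) + k) @ form_word K')" .
      have c: "word_equiv rels (form_word ?L @ ?w) (?w @ form_word M)"
        using word_equiv_append[OF word_equiv.refl less.prems(3), of "e # plane_word g"] by (simp add: L)
      have cL: "cyc_reduced ?L" unfolding L'' by (rule cyc_reduced_rotate[OF less.prems(1)])
      have rK: "reduced K'" using less.prems(4) by (simp add: K')
      have "length K' < length K" by (simp add: K')
      from less.hyps[OF this cL less.prems(2) c rK w]
      obtain i j z where "ladder z (rotate i ?L) (rotate j M) z" by blast
      then show ?thesis unfolding L'' rotate_rotate by blast
    next
      case none
      obtain c k K' where K: "K = (c, k) # K'" using none(1) by (metis list.exhaust surj_pair)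
      have red1: "reduced (L0 @ (e, g + x) # K)"
        using less.prems(1,4) none by (cases "last L0") (auto simp: L cyc_reduced_def reduced_append)
      have red2: "reduced (K @ M)"
        using less.prems(2,4) none by (auto simp: M cyc_reduced_def reduced_append)
      have "word_equiv rels (form_word L0 @ (e # plane_word (g + x)) @ form_word K)
          (plane_word x @ form_word (K @ M))"
        using lhs less.prems(3) rhs by (meson word_equiv.sym word_equiv.trans)
      then have lad: "ladder x (L0 @ (e, g + x) # K) (K @ M) 0"
        using word_equiv_imp_ladder[of 0 "L0 @ (e, g + x) # K" 0 x "K @ M" 0] red1 red2 by simp
      have "L \<noteq> []" by (simp add: L)
      then obtain c' g1 Lr where L1: "L = (c', g1) # Lr" by (metis list.exhaust surj_pair)
      have "\<exists>g2 R. L0 @ (e, g + x) # K = (c', g2) # R" using L1 L by (cases L0) auto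
      then obtain g2 R where "L0 @ (e, g + x) # K = (c', g2) # R" by blast
      with lad obtain m where c: "c' = c" "x = scl m (edge_vec c)" by (auto simp: K)
      have L2: "L = (c, g1) # Lr" using L1 c by simp
      have stc: "stable_letter c" using less.prems(4) by (simp add: K)
      let ?w = "winv (plane_word g1) @ flip c # w" and ?L = "rotate1 L"
      have "word_equiv rels (flip c # w) (flip c # plane_word x @ form_word K)"
        using word_equiv_append[OF word_equiv.refl less.prems(5), of "[flip c]"] by simp
      also have "word_equiv rels \<dots> (plane_word (scl m (edge_vec (flip c))) @ plane_word k @ form_word K')"
        using word_equiv_append[OF pinch_word[OF stc, of m] word_equiv.refl, of "plane_word k @ form_word K'"]
        by (simp add: K c)
      finally have "word_equiv rels (winv (plane_word g1) @ flip c # w)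
          (plane_word (- g1) @ plane_word (scl m (edge_vec (flip c))) @ plane_word k @ form_word K')"
        using rel_cost_imp_word_equiv[OF cost_sort_base_word[of "winv (plane_word g1)"]]
        by (intro word_equiv_append) auto
      also have "\<dots> = plane_word (- g1) @ (plane_word (scl m (edge_vec (flip c))) @ plane_word k) @ form_word K'"
        by simp
      also have "word_equiv rels \<dots> (plane_word (- g1) @ plane_word (scl m (edge_vec (flip c)) + k) @ form_word K')"
        by (rule word_equiv_context[OF plane_word_add])
      also have "word_equiv rels \<dots> (plane_word (- g1 + (scl m (edge_vec (flip c)) + k)) @ form_word K')"
        using word_equiv_append[OF plane_word_add word_equiv.refl, of "- g1"
            "scl m (edge_vec (flip c)) + k" "form_word K'"]
        by (simp only: append_assoc)
      finally have w: "word_equiv rels ?w (plane_word (- g1 + (scl m (edge_vec (flip c)) + k)) @ form_word K')" .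
      have "word_equiv rels ((c # plane_word g1) @ form_word Lr @ w) (w @ form_word M)"
        using less.prems(3) by (simp add: L2)
      then have 1: "word_equiv rels (form_word Lr @ w) (?w @ form_word M)"
        unfolding word_equiv_move_left by simp
      have "word_equiv rels (form_word ?L @ ?w) (form_word Lr @ w)"
        using word_equiv_context[OF word_equiv_right_inverse[of rels "c # plane_word g1"], of "form_word Lr" w]
        by (simp add: L2)
      note c = word_equiv.trans[OF this 1]
      have rK: "reduced K'" using less.prems(4) by (simp add: K)
      have "length K' < length K" by (simp add: K)
      from less.hyps[OF this cyc_reduced_rotate1[OF less.prems(1)] less.prems(2) c rK w]
      obtain i j z where "ladder z (rotate i ?L) (rotate j M) z" by blast
      then have "ladder z (rotate (Suc i) L) (rotate j M) z" by (simp add: rotate1_rotate_swap)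
      then show ?thesis by blast
    qed
  qed
qed

end


section \<open>Cyclically reduced factorizations\<close>

lemma not_successively_split:
  "\<not> successively R ys \<Longrightarrow> \<exists>as x y bs. ys = as @ x # y # bs \<and> \<not> R x y"
proof (induction R ys rule: successively.induct)
  case (3 R x y xs)
  show ?case
  proof (cases "R x y")
    case True
    then obtain as u v bs where "y # xs = as @ u # v # bs" "\<not> R u v" using 3 by auto
    then show ?thesis by (metis append_Cons)
  next
    case False
    then show ?thesis by (metis append_Nil)
  qed
qed auto

lemma cyclic_failure_rotate:
  assumes "xs \<noteq> []" "\<not> (successively R xs \<and> R (last xs) (hd xs))"
  shows "(\<exists>x. xs = [x] \<and> \<not> R x x) \<or> (\<exists>j x y zs. rotate j xs = x # y # zs \<and> \<not> R x y)"
proof -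
  have "\<not> successively R (xs @ [hd xs])" using assms by (simp add: successively_append_iff)
  then obtain as x y bs where s: "xs @ [hd xs] = as @ x # y # bs" "\<not> R x y"
    using not_successively_split by blast
  show ?thesis
  proof (cases bs rule: rev_cases)
    case Nil
    then have xs: "xs = as @ [x]" "hd xs = y" using s(1) by auto
    show ?thesis
    proof (cases as)
      case Nil
      then show ?thesis using xs s(2) by simp
    next
      case (Cons y' as')
      then have "rotate (length as) xs = x # y # as'" using xs by (simp only: rotate_append) simp
      then show ?thesis using s(2) by blast
    qed
  next
    case (snoc bs' b)
    then have "xs = as @ x # y # bs'" using s(1) by simp
    then have "rotate (length as) xs = x # y # bs' @ as" by (simp only: rotate_append) simp
    then show ?thesis using s(2) by blast
  qed
qed

lemma conj_cost_rotate_list: "conj_cost R 0 u (rotate k u)"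
  using conj_cost_rotate[of R "take (k mod length u) u" "drop (k mod length u) u"]
  by (simp add: rotate_drop_take)

context snowflake
begin

text \<open>A stable letter, the subword up to the next stable letter of the factorization, and the value of that subword.
Recording the subwords keeps factorizations literal: reducing them does not change the word but for a rotation, and
hence costs no relators.\<close>

type_synonym piece = "gen letter \<times> gen wrd \<times> vec"

definition flat :: "piece list \<Rightarrow> gen wrd"
  where "flat P = concat (map (\<lambda>(e, w, g). e # w) P)"

definition form_of :: "piece list \<Rightarrow> form"
  where "form_of P = map (\<lambda>(e, w, g). (e, g)) P"

definition pieces :: "piece list \<Rightarrow> bool"
  where "pieces P \<longleftrightarrow> (\<forall>(e, w, g)\<in>set P. stable_letter e \<and> plane_val w g)"

lemma flat_simps [simp]:
  "flat [] = []" "flat ((e, w, g) # P) = e # w @ flat P" "flat (P @ Q) = flat P @ flat Q"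
  by (simp_all add: flat_def)

lemma form_of_simps [simp]:
  "form_of [] = []" "form_of ((e, w, g) # P) = (e, g) # form_of P" "form_of (P @ Q) = form_of P @ form_of Q"
  "form_of P = [] \<longleftrightarrow> P = []" "length (form_of P) = length P"
  by (simp_all add: form_of_def)

lemma pieces_simps [simp]:
  "pieces []" "pieces ((e, w, g) # P) \<longleftrightarrow> stable_letter e \<and> plane_val w g \<and> pieces P"
  "pieces (P @ Q) \<longleftrightarrow> pieces P \<and> pieces Q"
  unfolding pieces_def by (simp_all add: ball_Un)

lemma pieces_rotate [simp]: "pieces (rotate j P) = pieces P"
  by (simp add: pieces_def)

lemma form_of_rotate: "form_of (rotate j P) = rotate j (form_of P)"
  by (simp add: form_of_def rotate_map)

lemma flat_rotate: "\<exists>k. flat (rotate j P) = rotate k (flat P)"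
proof -
  let ?j = "j mod length P"
  have "flat (rotate j P) = flat (drop ?j P) @ flat (take ?j P)" by (simp add: rotate_drop_take)
  also have "\<dots> = rotate (length (flat (take ?j P))) (flat (take ?j P) @ flat (drop ?j P))"
    by (rule rotate_append[symmetric])
  also have "flat (take ?j P) @ flat (drop ?j P) = flat P"
    by (simp flip: flat_simps(3))
  finally show ?thesis by blast
qed

text \<open>A pinch is itself a visibly planar word and can be merged with the planar words next to it, which
removes two stable letters from the factorization. A pinch across the end of the word is first rotated into the
interior.\<close>

lemma pieces_cyc_reduce:
  assumes "pieces P"
  shows "(\<exists>k g. plane_val (rotate k (flat P)) g) \<or>
    (\<exists>k Q. pieces Q \<and> cyc_reduced (form_of Q) \<and> flat Q = rotate k (flat P))"
  using assms
proof (induction "length P" arbitrary: P rule: less_induct)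
  case less
  show ?case
  proof (cases "P = [] \<or> cyc_reduced (form_of P)")
    case True
    then show ?thesis using less.prems plane_val.nil by (metis flat_simps(1) rotate0 id_apply)
  next
    case False
    let ?R = "\<lambda>a b. no_pinch (fst a, snd (snd a)) (fst b, snd (snd b))"
    have fm: "form_of P = map (\<lambda>a. (fst a, snd (snd a))) P"
      by (simp add: form_of_def split_beta)
    have "\<forall>x\<in>set (form_of P). stable_letter (fst x)"
      using less.prems by (auto simp: pieces_def fm)
    with False have "\<not> (successively ?R P \<and> ?R (last P) (hd P))"
      by (auto simp: cyc_reduced_def reduced_def fm successively_map last_map hd_map)
    from cyclic_failure_rotate[OF _ this] False
    consider x where "P = [x]" "\<not> ?R x x" | j x y zs where "rotate j P = x # y # zs" "\<not> ?R x y"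
      by blast
    then show ?thesis
    proof cases
      case 1
      then show ?thesis by (auto simp: flip_def prod_eq_iff)
    next
      case (2 j x y zs)
      obtain e w g where x: "x = (e, w, g)" by (metis surj_pair)
      obtain f v h where y: "y = (f, v, h)" by (metis surj_pair)
      obtain m where m: "f = flip e" "g = scl m (edge_vec f)" using 2(2) by (auto simp: x y)
      have pcs: "pieces (x # y # zs)" using less.prems 2(1) by (metis pieces_rotate)
      obtain k where k: "flat (x # y # zs) = rotate k (flat P)"
        using flat_rotate[of j P] 2(1) by auto
      let ?s = "(flip f # w @ [f]) @ v"
      have s: "plane_val ?s (scl m (edge_vec (flip f)) + h)"
        using pcs m by (intro plane_val.append plane_val.wrap) (auto simp: x y)
      have flat: "flat (x # y # zs) = ?s @ flat zs" by (simp add: x y m)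
      show ?thesis
      proof (cases zs rule: rev_cases)
        case Nil
        then have "plane_val (rotate k (flat P)) (scl m (edge_vec (flip f)) + h)"
          using s k flat by simp
        then show ?thesis by blast
      next
        case (snoc zs' c)
        obtain e' w' g' where c: "c = (e', w', g')" by (metis surj_pair)
        let ?Q = "zs' @ [(e', w' @ ?s, g' + (scl m (edge_vec (flip f)) + h))]"
        have Q: "pieces ?Q"
          using pcs s by (auto simp: x y snoc c intro: plane_val.append)
        have "length ?Q < length (rotate j P)" unfolding 2(1) snoc by simp
        then have len: "length ?Q < length P" by simp
        have "flat ?Q = flat zs @ ?s" by (simp add: snoc c)
        also have "\<dots> = rotate (length ?s) (flat (x # y # zs))" unfolding flat by (rule rotate_append[symmetric])
        finally have fQ: "flat ?Q = rotate (length ?s + k) (flat P)" unfolding k rotate_rotate .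
        from less.hyps[OF len Q] show ?thesis unfolding fQ rotate_rotate by blast
      qed
    qed
  qed
qed

lemma word_factorization:
  "\<exists>w0 g0 P. plane_val w0 g0 \<and> pieces P \<and> u = w0 @ flat P"
proof (induction u)
  case Nil
  show ?case using plane_val.nil pieces_simps(1) by (metis append_Nil flat_simps(1))
next
  case (Cons l u)
  then obtain w0 g0 P where *: "plane_val w0 g0" "pieces P" "u = w0 @ flat P" by blast
  show ?case
  proof (cases "stable_letter l")
    case True
    then have "pieces ((l, w0, g0) # P)" "l # u = [] @ flat ((l, w0, g0) # P)" using * by simp_all
    then show ?thesis using plane_val.nil by blast
  next
    case False
    then have "plane_val ([l] @ w0) (bval [l] + g0)"
      using * stable_letter_iff_base by (intro plane_val.append plane_val.letter) auto
    then show ?thesis using * by (metis append_Cons append_Nil)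
  qed
qed

lemma word_cyc_reduce:
  "(\<exists>k g. plane_val (rotate k u) g) \<or>
   (\<exists>k Q. pieces Q \<and> cyc_reduced (form_of Q) \<and> flat Q = rotate k u)"
proof -
  obtain w0 g0 P where *: "plane_val w0 g0" "pieces P" "u = w0 @ flat P"
    using word_factorization by blast
  show ?thesis
  proof (cases P rule: rev_cases)
    case Nil
    then have "plane_val (rotate 0 u) g0" using * by simp
    then show ?thesis by blast
  next
    case (snoc P' c)
    obtain e w g where c: "c = (e, w, g)" by (metis surj_pair)
    let ?P = "P' @ [(e, w @ w0, g + g0)]"
    have "pieces ?P" using * by (auto simp: snoc c intro: plane_val.append)
    moreover have "flat ?P = rotate (length w0) u"
      unfolding *(3) rotate_append by (simp add: snoc c)
    ultimately show ?thesis using pieces_cyc_reduce[of ?P] rotate_rotate by metis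
  qed
qed

definition form_size :: "form \<Rightarrow> real"
  where "form_size L = (\<Sum>x\<leftarrow>L. vsize (snd x))"

lemma form_size_simps [simp]: "form_size [] = 0" "form_size (x # L) = vsize (snd x) + form_size L"
  by (simp_all add: form_size_def)

lemma form_size_nonneg [simp]: "0 \<le> form_size L"
  by (induction L) auto

lemma form_size_le: "pieces P \<Longrightarrow> form_size (form_of P) \<le> dist_const * len_pow (flat P)"
proof (induction P)
  case (Cons c P)
  obtain e w g where c: "c = (e, w, g)" by (metis surj_pair)
  have b: "0 \<le> dist_const" using dist_const_ge_1 by simp
  have "vsize g \<le> dist_const * len_pow w" using Cons.prems by (intro plane_val_bounds(3)) (simp add: c)
  moreover have "len_pow w + len_pow (flat P) \<le> len_pow (e # w @ flat P)"
    by (rule order_trans[OF len_pow_append len_pow_mono]) simp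
  then have "dist_const * (len_pow w + len_pow (flat P)) \<le> dist_const * len_pow (e # w @ flat P)"
    using b by (intro mult_left_mono)
  ultimately show ?case using Cons by (simp add: c distrib_left)
qed simp

lemma length_le_flat: "length P \<le> length (flat P)"
  by (induction P) (auto simp: flat_def)

lemma cost_flat: "pieces P \<Longrightarrow> cost (plane_const * (len_pow (flat P))\<^sup>2) (flat P) (form_word (form_of P))"
proof (induction P)
  case Nil
  show ?case by (simp add: rel_cost_refl)
next
  case (Cons c P)
  obtain e w g where c: "c = (e, w, g)" by (metis surj_pair)
  have "cost (plane_const * (len_pow w)\<^sup>2 + plane_const * (len_pow (flat P))\<^sup>2) (w @ flat P)
      (plane_word g @ form_word (form_of P))"
    using Cons by (intro rel_cost_append cost_plane_val) (auto simp: c)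
  from rel_cost_context[OF this, of "[e]" "[]"]
  have 1: "cost (plane_const * (len_pow w)\<^sup>2 + plane_const * (len_pow (flat P))\<^sup>2) (flat (c # P))
     (form_word (form_of (c # P)))" by (simp add: c)
  have "len_pow w + len_pow (flat P) \<le> len_pow (flat (c # P))"
    unfolding c flat_simps by (rule order_trans[OF len_pow_append len_pow_mono]) simp
  then have "(len_pow w + len_pow (flat P))\<^sup>2 \<le> (len_pow (flat (c # P)))\<^sup>2" by (intro power_mono) auto
  moreover have "(len_pow w)\<^sup>2 + (len_pow (flat P))\<^sup>2 \<le> (len_pow w + len_pow (flat P))\<^sup>2"
    by (simp add: power2_eq_square algebra_simps)
  ultimately have "(len_pow w)\<^sup>2 + (len_pow (flat P))\<^sup>2 \<le> (len_pow (flat (c # P)))\<^sup>2" by linarith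
  then have "plane_const * ((len_pow w)\<^sup>2 + (len_pow (flat P))\<^sup>2) \<le> plane_const * (len_pow (flat (c # P)))\<^sup>2"
    using plane_const_nonneg by (intro mult_left_mono)
  with 1 show ?case by (elim rel_cost_mono) (simp add: distrib_left)
qed

section \<open>Area of ladders\<close>

text \<open>Two edge directions are equal or transverse. In the first case a difference \<open>x\<close> of two rungs bounds the difference of
their coefficients, in the second it bounds each of the coefficients.\<close>

lemma edge_vec_compare:
  assumes "scl m (edge_vec e) + x = scl n (edge_vec f)"
  shows "edge_vec e \<noteq> edge_vec f \<Longrightarrow>
      \<bar>real_of_int m\<bar> \<le> (real p + 1) * vsize x \<and> \<bar>real_of_int n\<bar> \<le> (real p + 1) * vsize x"
    and "edge_vec e = edge_vec f \<Longrightarrow> \<bar>real_of_int (n - m)\<bar> \<le> vsize x"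
proof -
  obtain i j where x: "x = (i, j)" by force
  let ?V = "\<bar>i\<bar> + \<bar>j\<bar>"
  have V: "vsize x = real_of_int ?V" by (simp add: vsize_def x)
  have eq: "m * fst (edge_vec e) + i = n * fst (edge_vec f)"
    "m * snd (edge_vec e) + j = n * snd (edge_vec f)"
    using arg_cong[OF assms, of fst] arg_cong[OF assms, of snd] by (simp_all add: x)
  have abs_le: "\<bar>k\<bar> \<le> \<bar>k * int c\<bar>" if "0 < c" for k and c :: nat
    using that mult_left_mono[of 1 "int c" "\<bar>k\<bar>"] by (simp add: abs_mult)
  have qa: "\<bar>k\<bar> \<le> \<bar>k * int q\<bar>" and pa: "\<bar>k\<bar> \<le> \<bar>k * int p\<bar>" for k
    using abs_le[of q k] abs_le[of p k] q_pos q_less_p by simp_all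
  have pj: "\<bar>k * int p\<bar> = int p * \<bar>k\<bar>" for k by (simp add: abs_mult)
  have "0 \<le> int p * \<bar>i\<bar>" by simp
  then have VV: "int p * \<bar>j\<bar> + ?V \<le> (int p + 1) * ?V" "?V \<le> (int p + 1) * ?V"
    by (simp_all add: algebra_simps)
  have form: "edge_vec e = (int q, 0) \<or> (\<exists>c. \<bar>c\<bar> = 1 \<and> edge_vec e = (int p, c))" for e
    by (simp add: edge_vec_def)
  have goal: "\<bar>m\<bar> \<le> (int p + 1) * ?V \<and> \<bar>n\<bar> \<le> (int p + 1) * ?V" if ne: "edge_vec e \<noteq> edge_vec f"
  proof -
    consider (up) c where "\<bar>c\<bar> = 1" "edge_vec e = (int q, 0)" "edge_vec f = (int p, c)"
      | (down) c where "\<bar>c\<bar> = 1" "edge_vec e = (int p, c)" "edge_vec f = (int q, 0)"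
      | (opposite) c where "\<bar>c\<bar> = 1" "edge_vec e = (int p, c)" "edge_vec f = (int p, - c)"
      using form[of e] form[of f] ne by (auto simp: abs_if split: if_splits)
    then show ?thesis
    proof cases
      case up
      then have "\<bar>n\<bar> = \<bar>j\<bar>" using eq(2) by (simp add: abs_mult)
      moreover have "\<bar>m * int q\<bar> \<le> \<bar>n * int p\<bar> + \<bar>i\<bar>" using eq(1) up by simp
      ultimately have "\<bar>m\<bar> \<le> int p * \<bar>j\<bar> + \<bar>i\<bar>" using qa[of m] pj[of n] by simp
      with \<open>\<bar>n\<bar> = \<bar>j\<bar>\<close> show ?thesis using VV by linarith
    next
      case down
      then have "\<bar>m\<bar> = \<bar>j\<bar>" using eq(2) arg_cong[of "m * c" "- j" abs] by (simp add: abs_mult)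
      moreover have "\<bar>n * int q\<bar> \<le> \<bar>m * int p\<bar> + \<bar>i\<bar>" using eq(1) down by simp
      ultimately have "\<bar>n\<bar> \<le> int p * \<bar>j\<bar> + \<bar>i\<bar>" using qa[of n] pj[of m] by simp
      with \<open>\<bar>m\<bar> = \<bar>j\<bar>\<close> show ?thesis using VV by linarith
    next
      case opposite
      then have "(n - m) * int p = i" "(m + n) * c = - j" using eq by (simp_all add: algebra_simps)
      moreover have "c = 1 \<or> c = - 1" using opposite(1) by linarith
      ultimately have "\<bar>n - m\<bar> \<le> \<bar>i\<bar>" "\<bar>m + n\<bar> = \<bar>j\<bar>"
        using pa[of "n - m"] by auto
      then show ?thesis using VV(2) by linarith
    qed
  qed
  show "edge_vec e \<noteq> edge_vec f \<Longrightarrow>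
      \<bar>real_of_int m\<bar> \<le> (real p + 1) * vsize x \<and> \<bar>real_of_int n\<bar> \<le> (real p + 1) * vsize x"
  proof -
    assume "edge_vec e \<noteq> edge_vec f"
    note goal[OF this]
    then have "real_of_int \<bar>m\<bar> \<le> real_of_int ((int p + 1) * ?V)" "real_of_int \<bar>n\<bar> \<le> real_of_int ((int p + 1) * ?V)"
      by (simp_all only: of_int_le_iff)
    then show ?thesis by (simp add: V)
  qed
  assume "edge_vec e = edge_vec f"
  then have "(n - m) * fst (edge_vec f) = i" using eq(1) by (simp add: algebra_simps)
  then have "\<bar>n - m\<bar> \<le> \<bar>i\<bar>"
    using form[of f] qa[of "n - m"] pa[of "n - m"] by auto
  then have "real_of_int \<bar>n - m\<bar> \<le> real_of_int ?V" by simp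
  then show "\<bar>real_of_int (n - m)\<bar> \<le> vsize x" by (simp add: V)
qed

lemma edge_vec_step:
  assumes "scl m (edge_vec e) + x = scl n (edge_vec f)"
  shows "\<bar>real_of_int n\<bar> \<le> \<bar>real_of_int m\<bar> + (real p + 1) * vsize x"
proof -
  have "1 * vsize x \<le> (real p + 1) * vsize x" by (intro mult_right_mono) auto
  then show ?thesis using edge_vec_compare[OF assms] by (cases "edge_vec e = edge_vec f") auto
qed

text \<open>The first letter of the form followed by \<open>f\<close>: the rung entering a form lies in the edge group of this letter.\<close>

fun next_letter :: "form \<Rightarrow> gen letter \<Rightarrow> gen letter" where
  "next_letter [] f = f"
| "next_letter ((e, g) # L) f = e"

lemma ladder_start:
  "ladder d L M (scl n (edge_vec f)) \<Longrightarrow> \<exists>m. d = scl m (edge_vec (next_letter L f))"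
  by (cases "(d, L, M, scl n (edge_vec f))" rule: ladder.cases) auto

lemma next_letter_stable: "reduced L \<Longrightarrow> stable_letter f \<Longrightarrow> stable_letter (next_letter L f)"
  by (cases L) auto

lemma ladder_end_le:
  assumes "ladder (scl m (edge_vec (next_letter L f))) L M (scl n (edge_vec f))"
    "reduced L" "stable_letter f"
  shows "\<bar>real_of_int n\<bar> \<le> \<bar>real_of_int m\<bar> + (real p + 1) * (form_size L + form_size M)"
  using assms
proof (induction L arbitrary: m M)
  case Nil
  then have "m = n" by (cases M) (auto dest: edge_vec_inj)
  then show ?case by simp
next
  case (Cons a L)
  obtain e g where a: "a = (e, g)" by (metis surj_pair)
  obtain h M' where M: "M = (e, h) # M'" using Cons.prems(1) by (cases M) (auto simp: a)
  have e: "stable_letter e" "reduced L" using Cons.prems(2) by (auto simp: a)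
  obtain m1 where "scl m (edge_vec e) = scl m1 (edge_vec e)"
    and l1: "ladder (h + scl m1 (edge_vec (flip e)) - g) L M' (scl n (edge_vec f))"
    using Cons.prems(1) by (auto simp: a M)
  then have m1: "m1 = m" using edge_vec_inj e(1) by metis
  obtain m' where m': "h + scl m (edge_vec (flip e)) - g = scl m' (edge_vec (next_letter L f))"
    using ladder_start[OF l1] m1 by auto
  have st: "stable_letter (next_letter L f)" by (rule next_letter_stable[OF e(2) Cons.prems(3)])
  have "\<bar>real_of_int m'\<bar> \<le> \<bar>real_of_int m\<bar> + (real p + 1) * vsize (h - g)"
    by (rule edge_vec_step) (use m' in \<open>simp add: algebra_simps\<close>)
  moreover have "(real p + 1) * vsize (h - g) \<le> (real p + 1) * (vsize h + vsize g)"
    by (intro mult_left_mono vsize_diff_triangle) auto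
  moreover have "\<bar>real_of_int n\<bar> \<le> \<bar>real_of_int m'\<bar> + (real p + 1) * (form_size L + form_size M')"
    by (rule Cons.IH[OF _ e(2) Cons.prems(3)]) (use l1 m1 m' in simp)
  ultimately show ?case by (simp add: a M algebra_simps)
qed

text \<open>The dichotomy for ladders. If all consecutive edge directions agree, the whole ladder can be
shifted by any \<open>t\<close>. If some pair is transverse, the rung behind it is bounded, and the following rungs grow at most by the sizes
of the syllables that they pass.\<close>

lemma ladder_shift_or_bounded:
  assumes "ladder (scl m (edge_vec (next_letter L f))) L M (scl n (edge_vec f))"
    "reduced L" "stable_letter f"
  shows "\<bar>real_of_int n\<bar> \<le> (real p + 1) * (form_size L + form_size M) \<or>
    (\<forall>t. ladder (scl (m + t) (edge_vec (next_letter L f))) L M (scl (n + t) (edge_vec f)))"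
  using assms
proof (induction L arbitrary: m M)
  case Nil
  then have "m = n" by (cases M) (auto dest: edge_vec_inj)
  then show ?case using Nil by (cases M) auto
next
  case (Cons a L)
  obtain e g where a: "a = (e, g)" by (metis surj_pair)
  obtain h M' where M: "M = (e, h) # M'" using Cons.prems(1) by (cases M) (auto simp: a)
  have e: "stable_letter e" "reduced L" using Cons.prems(2) by (auto simp: a)
  obtain m1 where "scl m (edge_vec e) = scl m1 (edge_vec e)"
    and l1: "ladder (h + scl m1 (edge_vec (flip e)) - g) L M' (scl n (edge_vec f))"
    using Cons.prems(1) by (auto simp: a M)
  then have m1: "m1 = m" using edge_vec_inj e(1) by metis
  let ?e' = "next_letter L f"
  obtain m' where m': "h + scl m (edge_vec (flip e)) - g = scl m' (edge_vec ?e')"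
    using ladder_start[OF l1] m1 by auto
  have l: "ladder (scl m' (edge_vec ?e')) L M' (scl n (edge_vec f))" using l1 m1 m' by simp
  have st: "stable_letter ?e'" by (rule next_letter_stable[OF e(2) Cons.prems(3)])
  have rel: "scl m (edge_vec (flip e)) + (h - g) = scl m' (edge_vec ?e')"
    using m' by (simp add: algebra_simps)
  have hg: "(real p + 1) * vsize (h - g) \<le> (real p + 1) * (vsize h + vsize g)"
    by (intro mult_left_mono vsize_diff_triangle) auto
  have nn: "0 \<le> (real p + 1) * (vsize h + vsize g)" by simp
  have sz: "(real p + 1) * (form_size (a # L) + form_size M) =
     (real p + 1) * (vsize h + vsize g) + (real p + 1) * (form_size L + form_size M')"
    by (simp add: a M algebra_simps)
  show ?case
  proof (cases "edge_vec (flip e) = edge_vec ?e'")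
    case False
    then have "\<bar>real_of_int m'\<bar> \<le> (real p + 1) * vsize (h - g)"
      using edge_vec_compare(1)[OF rel] by simp
    moreover have "\<bar>real_of_int n\<bar> \<le> \<bar>real_of_int m'\<bar> + (real p + 1) * (form_size L + form_size M')"
      by (rule ladder_end_le[OF l e(2) Cons.prems(3)])
    ultimately show ?thesis using hg sz by linarith
  next
    case True
    from Cons.IH[OF l e(2) Cons.prems(3)] show ?thesis
    proof
      assume "\<bar>real_of_int n\<bar> \<le> (real p + 1) * (form_size L + form_size M')"
      then show ?thesis using sz nn by linarith
    next
      assume *: "\<forall>t. ladder (scl (m' + t) (edge_vec ?e')) L M' (scl (n + t) (edge_vec f))"
      have "h + scl (m + t) (edge_vec (flip e)) - g = scl (m' + t) (edge_vec ?e')" for t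
        using rel True by (simp add: scl_distribs algebra_simps)
      with * have "ladder (scl (m + t) (edge_vec e)) (a # L) M (scl (n + t) (edge_vec f))" for t
        by (auto simp: a M)
      then show ?thesis by (simp add: a)
    qed
  qed
qed

text \<open>When the two ends of the ladder are identified, a bound on the last rung is a bound on the first one; and
if the ladder can be shifted, the shift can be chosen to make the first rung trivial.\<close>

lemma closed_ladder_bounded:
  assumes "ladder z L M z" "reduced L" "L \<noteq> []"
  shows "\<exists>e m. stable_letter e \<and> next_letter L e = e \<and>
    \<bar>real_of_int m\<bar> \<le> (real p + 1) * (form_size L + form_size M) \<and>
    ladder (scl m (edge_vec e)) L M (scl m (edge_vec e))"
proof -
  obtain e g L' where L: "L = (e, g) # L'" using assms(3) by (metis list.exhaust surj_pair)
  have e: "stable_letter e" "next_letter L e = e" using assms(2) by (auto simp: L)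
  obtain m where z: "z = scl m (edge_vec e)" using assms(1) by (cases M) (auto simp: L)
  have "ladder (scl m (edge_vec (next_letter L e))) L M (scl m (edge_vec e))"
    using assms(1) e by (simp add: z)
  from ladder_shift_or_bounded[OF this assms(2) e(1)] show ?thesis
  proof
    assume "\<bar>real_of_int m\<bar> \<le> (real p + 1) * (form_size L + form_size M)"
    then show ?thesis using e assms(1) z by blast
  next
    assume "\<forall>t. ladder (scl (m + t) (edge_vec (next_letter L e))) L M (scl (m + t) (edge_vec e))"
    from spec[OF this, of "- m"] e(2) have "ladder (scl 0 (edge_vec e)) L M (scl 0 (edge_vec e))" by simp
    then show ?thesis using e by (intro exI[of _ e] exI[of _ 0]) simp
  qed
qed

lemma edge_word_eq: "stable_letter e \<Longrightarrow> stable_letter f \<Longrightarrow> edge_vec e = edge_vec f \<Longrightarrow> edge_word e = edge_word f"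
  by (elim stable_letter_cases) (auto simp: edge_word_def)

definition rung_const :: real where "rung_const = 1 + (real p + 1)\<^sup>2"

lemma cost_edge_pow_plane:
  "cost (2 * (real p + 2)\<^sup>2 * \<bar>real_of_int m\<bar> * vsize h)
     (edge_pow e m @ plane_word h) (plane_word h @ edge_pow e m)"
proof -
  let ?c = "2 * (real p + 2)\<^sup>2"
  have "cost ?c (edge_word e @ [x]) ([x] @ edge_word e)" if "base_word [x]" for x
    using length_edge_word_le[of e] that bval_append[of "[x]" "edge_word e"]
    by (intro cost_base_words) (auto simp: add.commute)
  then have sl: "cost (?c * \<bar>real_of_int m\<bar> * \<bar>real_of_int k\<bar>)
     (edge_pow e m @ wpow [x] k) (wpow [x] k @ edge_pow e m)" if "base_word [x]" for x k
    unfolding edge_pow_def by (intro rel_cost_wpow_commute) (use that in auto)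
  have "cost (?c * \<bar>real_of_int m\<bar> * \<bar>real_of_int (fst h)\<bar>)
     (edge_pow e m @ plane_word h) (wpow wa (fst h) @ edge_pow e m @ wpow wb (snd h))"
    using rel_cost_context[OF sl[of "(Gen_a, True)" "fst h"], of "[]" "wpow wb (snd h)"]
    by (simp add: plane_word_def)
  also have "cost (?c * \<bar>real_of_int m\<bar> * \<bar>real_of_int (snd h)\<bar>) \<dots> (plane_word h @ edge_pow e m)"
    using rel_cost_context[OF sl[of "(Gen_b, True)" "snd h"], of "wpow wa (fst h)" "[]"]
    by (simp add: plane_word_def)
  finally show ?thesis by (simp add: vsize_def distrib_left)
qed

text \<open>In the case of transverse directions all words have length \<open>O(s)\<close>. In the parallel case the power
\<open>m\<close> can be much larger than \<open>s\<close>; the syllable \<open>h\<close> is moved past it at cost \<open>O(m s)\<close>, and only the bounded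
difference of the two powers has to be compared with \<open>g\<close> and \<open>h\<close>.\<close>

lemma cost_rung:
  assumes "stable_letter e" "stable_letter f"
    and "scl m (edge_vec e) + h = g + scl n (edge_vec f)"
  defines "s \<equiv> vsize g + vsize h"
  shows "cost (2 * (real p + 2)\<^sup>2 * \<bar>real_of_int m\<bar> * s + 2 * rung_const\<^sup>2 * s\<^sup>2)
     (edge_pow e m @ plane_word h) (plane_word g @ edge_pow f n)"
proof -
  have rel: "scl m (edge_vec e) + (h - g) = scl n (edge_vec f)"
    using assms(3) by (simp add: algebra_simps)
  have hg: "vsize (h - g) \<le> s" using vsize_diff_triangle[of h g] by (simp add: s_def)
  have s: "0 \<le> s" "vsize g \<le> s" "vsize h \<le> s" by (simp_all add: s_def)
  have pw: "real (length (edge_pow e' k)) + vsize x \<le> rung_const * s"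
    if "\<bar>real_of_int k\<bar> \<le> (real p + 1) * vsize (h - g)" "vsize x \<le> s" for e' k x
  proof -
    have "\<bar>real_of_int k\<bar> \<le> (real p + 1) * s"
      using that(1) mult_left_mono[OF hg, of "real p + 1"] by linarith
    then have "(real p + 1) * \<bar>real_of_int k\<bar> \<le> (real p + 1) * ((real p + 1) * s)"
      by (intro mult_left_mono) auto
    then show ?thesis using length_edge_pow_le[of e' k] that(2)
      by (simp add: rung_const_def power2_eq_square algebra_simps)
  qed
  have base: "cost (2 * rung_const\<^sup>2 * s\<^sup>2) u v"
    if "base_word u" "base_word v" "bval u = bval v" "real (length u) \<le> rung_const * s"
      "real (length v) \<le> rung_const * s" for u v
    using cost_base_words[OF that] by (simp add: power_mult_distrib mult.assoc)
  have nn: "0 \<le> 2 * (real p + 2)\<^sup>2 * \<bar>real_of_int m\<bar> * s" using s by simp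
  show ?thesis
  proof (cases "edge_vec e = edge_vec f")
    case False
    note mn = conjunct1[OF edge_vec_compare(1)[OF rel False]]
       conjunct2[OF edge_vec_compare(1)[OF rel False]]
    have "cost (2 * rung_const\<^sup>2 * s\<^sup>2) (edge_pow e m @ plane_word h) (plane_word g @ edge_pow f n)"
      using pw[OF mn(1) s(3), of e] pw[OF mn(2) s(2), of f] assms(3)
      by (intro base) (auto simp: length_plane_word)
    then show ?thesis using nn by (elim rel_cost_mono) simp
  next
    case True
    have ef: "edge_pow e = edge_pow f"
      using edge_word_eq[OF assms(1,2) True] by (simp add: edge_pow_def fun_eq_iff)
    have mn: "\<bar>real_of_int (m - n)\<bar> \<le> (real p + 1) * vsize (h - g)"
      using edge_vec_compare(2)[OF rel True] mult_right_mono[of 1 "real p + 1" "vsize (h - g)"]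
      by simp
    have "cost (2 * (real p + 2)\<^sup>2 * \<bar>real_of_int m\<bar> * vsize h)
        (edge_pow e m @ plane_word h) (plane_word h @ edge_pow f m)"
      using cost_edge_pow_plane[of m h e] by (simp add: ef)
    also have "cost 0 \<dots> (plane_word h @ edge_pow f (m - n) @ edge_pow f n)"
      using word_equiv_append[OF word_equiv.refl word_equiv.sym[OF wpow_add], of "{}" "plane_word h" "edge_word f" "m - n" n]
      by (intro rel_cost_free) (simp add: edge_pow_def)
    also have "cost (2 * rung_const\<^sup>2 * s\<^sup>2) \<dots> (plane_word g @ edge_pow f n)"
    proof -
      have "cost (2 * rung_const\<^sup>2 * s\<^sup>2) (plane_word h @ edge_pow f (m - n)) (plane_word g)"
        using pw[OF mn s(3), of f] pw[of 0 g f] s(2) rel True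
        by (intro base) (auto simp: length_plane_word scl_distribs algebra_simps)
      from rel_cost_context[OF this, of "[]" "edge_pow f n"] show ?thesis by simp
    qed
    finally have "cost (2 * (real p + 2)\<^sup>2 * \<bar>real_of_int m\<bar> * vsize h + 2 * rung_const\<^sup>2 * s\<^sup>2)
      (edge_pow e m @ plane_word h) (plane_word g @ edge_pow f n)" by simp
    moreover have "2 * (real p + 2)\<^sup>2 * \<bar>real_of_int m\<bar> * vsize h \<le> 2 * (real p + 2)\<^sup>2 * \<bar>real_of_int m\<bar> * s"
      using s by (intro mult_left_mono) auto
    ultimately show ?thesis by (elim rel_cost_mono) simp
  qed
qed

text \<open>The three summands are the corridors of the stable letters, the strips where long rungs pass the
syllables, and the corrections in the plane.\<close>

lemma cost_ladder:
  assumes "ladder (scl m (edge_vec (next_letter L f))) L M (scl n (edge_vec f))"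
    "reduced L" "stable_letter f"
    "\<bar>real_of_int m\<bar> + (real p + 1) * (form_size L + form_size M) \<le> B"
  shows "cost (real (length L) * B + 2 * (real p + 2)\<^sup>2 * B * (form_size L + form_size M) +
       2 * rung_const\<^sup>2 * (form_size L + form_size M)\<^sup>2)
     (edge_pow (next_letter L f) m @ form_word M) (form_word L @ edge_pow f n)"
  using assms
proof (induction L arbitrary: m M)
  case Nil
  then have "m = n" "M = []" by (cases M; auto dest: edge_vec_inj)+
  then show ?case by (simp add: rel_cost_refl)
next
  case (Cons a L)
  obtain e g where a: "a = (e, g)" by (metis surj_pair)
  obtain h M' where M: "M = (e, h) # M'" using Cons.prems(1) by (cases M) (auto simp: a)
  have e: "stable_letter e" "reduced L" using Cons.prems(2) by (auto simp: a)
  obtain m1 where "scl m (edge_vec e) = scl m1 (edge_vec e)"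
    and l1: "ladder (h + scl m1 (edge_vec (flip e)) - g) L M' (scl n (edge_vec f))"
    using Cons.prems(1) by (auto simp: a M)
  then have m1: "m1 = m" using edge_vec_inj e(1) by metis
  let ?e' = "next_letter L f"
  obtain m' where m': "h + scl m (edge_vec (flip e)) - g = scl m' (edge_vec ?e')"
    using ladder_start[OF l1] m1 by auto
  have l: "ladder (scl m' (edge_vec ?e')) L M' (scl n (edge_vec f))" using l1 m1 m' by simp
  have st: "stable_letter ?e'" by (rule next_letter_stable[OF e(2) Cons.prems(3)])
  have rel: "scl m (edge_vec (flip e)) + (h - g) = scl m' (edge_vec ?e')"
    "scl m (edge_vec (flip e)) + h = g + scl m' (edge_vec ?e')"
    using m' by (auto simp: algebra_simps)
  define s where "s = vsize g + vsize h"
  define S where "S = form_size L + form_size M'"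
  have sS: "form_size (a # L) + form_size M = s + S" by (simp add: a M s_def S_def)
  have nn: "0 \<le> s" "0 \<le> S" by (simp_all add: s_def S_def)
  have B: "\<bar>real_of_int m\<bar> + (real p + 1) * s + (real p + 1) * S \<le> B"
    using Cons.prems(4) unfolding sS by (simp add: algebra_simps)
  have mB: "\<bar>real_of_int m\<bar> \<le> B" using B nn mult_nonneg_nonneg[of "real p + 1" s] mult_nonneg_nonneg[of "real p + 1" S] by linarith
  have "\<bar>real_of_int m'\<bar> \<le> \<bar>real_of_int m\<bar> + (real p + 1) * vsize (h - g)"
    by (rule edge_vec_step[OF rel(1)])
  moreover have "(real p + 1) * vsize (h - g) \<le> (real p + 1) * s"
    using vsize_diff_triangle[of h g] by (intro mult_left_mono) (auto simp: s_def)
  ultimately have m'B: "\<bar>real_of_int m'\<bar> + (real p + 1) * (form_size L + form_size M') \<le> B"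
    using B unfolding S_def by linarith
  have "cost \<bar>real_of_int m\<bar> (edge_pow e m @ form_word M)
     ([e] @ edge_pow (flip e) m @ plane_word h @ form_word M')"
    using rel_cost_context[OF cost_edge_pow[OF e(1), of m], of "[]" "plane_word h @ form_word M'"]
    by (simp add: M)
  also have "cost (2 * (real p + 2)\<^sup>2 * \<bar>real_of_int m\<bar> * s + 2 * rung_const\<^sup>2 * s\<^sup>2) \<dots>
     ([e] @ (plane_word g @ edge_pow ?e' m') @ form_word M')"
    using rel_cost_context[OF cost_rung[OF _ st rel(2)], of "[e]" "form_word M'"] e
    by (simp add: s_def)
  also have "cost (real (length L) * B + 2 * (real p + 2)\<^sup>2 * B * S + 2 * rung_const\<^sup>2 * S\<^sup>2) \<dots>
     (([e] @ plane_word g) @ form_word L @ edge_pow f n)"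
    using rel_cost_context[OF Cons.IH[OF l e(2) Cons.prems(3) m'B], of "[e] @ plane_word g" "[]"]
    by (simp add: S_def)
  finally have "cost (\<bar>real_of_int m\<bar> + (2 * (real p + 2)\<^sup>2 * \<bar>real_of_int m\<bar> * s + 2 * rung_const\<^sup>2 * s\<^sup>2) +
     (real (length L) * B + 2 * (real p + 2)\<^sup>2 * B * S + 2 * rung_const\<^sup>2 * S\<^sup>2))
     (edge_pow (next_letter (a # L) f) m @ form_word M) (form_word (a # L) @ edge_pow f n)"
    by (simp add: a)
  moreover have "2 * (real p + 2)\<^sup>2 * \<bar>real_of_int m\<bar> * s \<le> 2 * (real p + 2)\<^sup>2 * B * s"
    using mB nn by (intro mult_right_mono mult_left_mono) auto
  moreover have "2 * rung_const\<^sup>2 * (s\<^sup>2 + S\<^sup>2) \<le> 2 * rung_const\<^sup>2 * (s + S)\<^sup>2"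
    using nn by (intro mult_left_mono) (auto simp: power2_eq_square algebra_simps)
  ultimately show ?case unfolding sS
    by (elim rel_cost_mono) (use mB in \<open>simp add: algebra_simps\<close>)
qed

end


context snowflake
begin

section \<open>The upper bound\<close>

text \<open>Every edge group is conjugate to the one on the \<open>a\<close>-axis, by at most one stable letter.\<close>

lemma conj_cost_axis:
  assumes "stable_letter e"
  shows "conj_cost rels \<bar>real_of_int m\<bar> (edge_pow e m) (edge_pow (Gen_s, True) m)"
proof (cases "snd e")
  case True
  then have "edge_pow e m = edge_pow (Gen_s, True) m" by (simp add: edge_pow_def edge_word_def)
  then have "conj_cost rels 0 (edge_pow e m) (edge_pow (Gen_s, True) m)"
    by (simp add: conj_cost_rel_cost rel_cost_refl)
  then show ?thesis by (rule conj_cost_mono) simp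
next
  case False
  then have "edge_pow (flip e) m = edge_pow (Gen_s, True) m"
    by (simp add: edge_pow_def edge_word_def flip_def)
  then show ?thesis using cost_edge_pow[OF assms, of m] unfolding conj_cost_def
    by (intro exI[of _ "[e]"]) simp
qed

definition elliptic_const :: real
  where "elliptic_const = 2 * plane_const + 2 * dist_const\<^sup>2 + 4 * ((real p + 1) * dist_const)\<^sup>2"

lemma conj_cost_elliptic:
  assumes u: "plane_val u x" and v: "plane_val v y" and uv: "conj_cost rels c u v"
    and H: "len_pow u \<le> H" "len_pow v \<le> H"
  shows "conj_cost rels (elliptic_const * H\<^sup>2) u v"
proof -
  note cu = cost_plane_val[OF u] and cv = cost_plane_val[OF v]
  have H0: "0 \<le> H" using H(1) len_pow_nonneg[of u] by linarith
  have sq: "plane_const * (len_pow u)\<^sup>2 \<le> plane_const * H\<^sup>2" "plane_const * (len_pow v)\<^sup>2 \<le> plane_const * H\<^sup>2"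
    using H plane_const_nonneg by (auto intro!: mult_left_mono power_mono)
  have "conj_cost rels (plane_const * (len_pow u)\<^sup>2 + c + plane_const * (len_pow v)\<^sup>2) (plane_word x) (plane_word y)"
    using conj_cost_trans[OF conj_cost_trans[OF conj_cost_rel_cost[OF rel_cost_sym[OF cu]] uv] conj_cost_rel_cost[OF cv]] .
  then obtain w where "word_equiv rels (plane_word x @ w) (w @ plane_word y)"
    unfolding conj_cost_def using rel_cost_imp_word_equiv by blast
  then consider "x = y" | m e f where "stable_letter e" "stable_letter f"
    "x = scl m (edge_vec e)" "y = scl m (edge_vec f)"
    using plane_conjugate by blast
  then show ?thesis
  proof cases
    case 1
    have "conj_cost rels (plane_const * (len_pow u)\<^sup>2 + plane_const * (len_pow v)\<^sup>2) u v"
      by (rule conj_cost_rel_cost[OF rel_cost_trans[OF cu rel_cost_sym[OF cv[folded 1]]]])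
    moreover have "0 \<le> 2 * (dist_const\<^sup>2 * H\<^sup>2)" "0 \<le> 4 * (((real p + 1) * dist_const)\<^sup>2 * H\<^sup>2)" by simp_all
    moreover have "elliptic_const * H\<^sup>2 = 2 * (plane_const * H\<^sup>2) + 2 * (dist_const\<^sup>2 * H\<^sup>2) +
        4 * (((real p + 1) * dist_const)\<^sup>2 * H\<^sup>2)"
      by (simp only: elliptic_const_def distrib_right mult.assoc)
    ultimately show ?thesis using sq by (elim conj_cost_mono) linarith
  next
    case (2 m e f)
    have b: "0 \<le> dist_const" using dist_const_ge_1 by simp
    have xb: "vsize x \<le> dist_const * H" "vsize y \<le> dist_const * H"
      using plane_val_bounds(3)[OF u] plane_val_bounds(3)[OF v] mult_left_mono[OF H(1) b]
        mult_left_mono[OF H(2) b] by linarith+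
    have "\<bar>real_of_int m\<bar> \<le> vsize (scl m (edge_vec e))"
      using edge_vec_compare(2)[of 0 e "scl m (edge_vec e)" m e] by simp
    then have mb: "\<bar>real_of_int m\<bar> \<le> dist_const * H" using xb(1) 2 by simp
    \<comment> \<open>A corridor of length m is within the quadratic bound because m is an integer.\<close>
    have "\<bar>m\<bar> \<le> m * m" using abs_le_square_iff[of 1 m] mult_left_mono[of 1 "\<bar>m\<bar>" "\<bar>m\<bar>"]
      by (cases "m = 0") (auto simp: abs_mult_self_eq)
    then have "real_of_int \<bar>m\<bar> \<le> real_of_int (m * m)" by (simp only: of_int_le_iff)
    then have "\<bar>real_of_int m\<bar> \<le> \<bar>real_of_int m\<bar>\<^sup>2" by (simp add: power2_eq_square)
    also have "\<dots> \<le> (dist_const * H)\<^sup>2" using mb by (intro power_mono) auto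
    finally have mb2: "\<bar>real_of_int m\<bar> \<le> dist_const\<^sup>2 * H\<^sup>2" by (simp add: power_mult_distrib)
    have pw: "cost (2 * ((real p + 1) * (dist_const * H))\<^sup>2) (plane_word (scl m (edge_vec e'))) (edge_pow e' m)"
      if "vsize (scl m (edge_vec e')) \<le> dist_const * H" for e'
    proof (rule cost_base_words)
      have "0 \<le> real p * (dist_const * H)" using b H0 by simp
      then show "real (length (plane_word (scl m (edge_vec e')))) \<le> (real p + 1) * (dist_const * H)"
        using that by (simp add: length_plane_word distrib_right)
      show "real (length (edge_pow e' m)) \<le> (real p + 1) * (dist_const * H)"
        by (rule order_trans[OF length_edge_pow_le mult_left_mono[OF mb]]) simp
    qed simp_all
    let ?c = "2 * ((real p + 1) * (dist_const * H))\<^sup>2"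
    have "conj_cost rels (plane_const * (len_pow u)\<^sup>2 + ?c) u (edge_pow e m)"
      using rel_cost_trans[OF cu] pw[of e] xb 2 by (intro conj_cost_rel_cost) auto
    also have "conj_cost rels \<bar>real_of_int m\<bar> (edge_pow e m) (edge_pow (Gen_s, True) m)"
      by (rule conj_cost_axis[OF 2(1)])
    also have "conj_cost rels \<bar>real_of_int m\<bar> (edge_pow (Gen_s, True) m) (edge_pow f m)"
      by (rule conj_cost_sym[OF conj_cost_axis[OF 2(2)]])
    also have "conj_cost rels (plane_const * (len_pow v)\<^sup>2 + ?c) (edge_pow f m) v"
      using rel_cost_trans[OF cv] pw[of f] xb 2
      by (intro conj_cost_rel_cost) (auto intro: rel_cost_sym)
    finally have "conj_cost rels (plane_const * (len_pow u)\<^sup>2 + ?c + \<bar>real_of_int m\<bar> + \<bar>real_of_int m\<bar> +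
      (plane_const * (len_pow v)\<^sup>2 + ?c)) u v" .
    moreover have "?c = 2 * (((real p + 1) * dist_const)\<^sup>2 * H\<^sup>2)"
      by (simp only: power_mult_distrib mult.assoc)
    moreover have "elliptic_const * H\<^sup>2 = 2 * (plane_const * H\<^sup>2) + 2 * (dist_const\<^sup>2 * H\<^sup>2) +
        4 * (((real p + 1) * dist_const)\<^sup>2 * H\<^sup>2)"
      by (simp only: elliptic_const_def distrib_right mult.assoc)
    ultimately show ?thesis using sq mb2 by (elim conj_cost_mono) linarith
  qed
qed

definition hyperbolic_const :: real
  where "hyperbolic_const = 2 * plane_const + 2 * (real p + 1) * dist_const +
    4 * (real p + 2)\<^sup>2 * (real p + 1) * dist_const\<^sup>2 + 2 * rung_const\<^sup>2 * dist_const\<^sup>2"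

lemma length_le_len_pow: "real (length w) \<le> len_pow w"
proof (cases "w = []")
  case False
  then have "1 \<le> real (length w)" by (simp add: Suc_le_eq)
  then have "real (length w) powr 1 \<le> real (length w) powr alpha"
    using alpha_gt_1 by (intro powr_mono) auto
  then show ?thesis by (simp add: len_pow_def)
qed simp

lemma conj_cost_ladder:
  assumes "pieces P" "pieces Q" "ladder z (form_of P) (form_of Q) z" "reduced (form_of P)" "P \<noteq> []"
    and H: "len_pow (flat P) + len_pow (flat Q) \<le> H"
  shows "conj_cost rels (hyperbolic_const * H\<^sup>2) (flat P) (flat Q)"
proof -
  let ?L = "form_of P" and ?M = "form_of Q"
  let ?S = "form_size ?L + form_size ?M"
  have b: "0 \<le> dist_const" using dist_const_ge_1 by simp
  have H0: "0 \<le> H" using H len_pow_nonneg[of "flat P"] len_pow_nonneg[of "flat Q"] by linarith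
  have eH: "len_pow (flat P) \<le> H" "len_pow (flat Q) \<le> H"
    using H len_pow_nonneg[of "flat P"] len_pow_nonneg[of "flat Q"] by linarith+
  obtain e m where e: "stable_letter e" "next_letter ?L e = e"
    "\<bar>real_of_int m\<bar> \<le> (real p + 1) * ?S" "ladder (scl m (edge_vec e)) ?L ?M (scl m (edge_vec e))"
    using closed_ladder_bounded[OF assms(3,4)] assms(5) by auto
  let ?B = "2 * (real p + 1) * ?S"
  have "?B = (real p + 1) * ?S + (real p + 1) * ?S" by (simp add: algebra_simps)
  then have mB: "\<bar>real_of_int m\<bar> + (real p + 1) * ?S \<le> ?B" using e(3) by linarith
  have "cost (real (length ?L) * ?B + 2 * (real p + 2)\<^sup>2 * ?B * ?S + 2 * rung_const\<^sup>2 * ?S\<^sup>2)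
     (edge_pow (next_letter ?L e) m @ form_word ?M) (form_word ?L @ edge_pow e m)"
    using e assms(4) mB by (intro cost_ladder) auto
  then have lad: "conj_cost rels (real (length ?L) * ?B + 2 * (real p + 2)\<^sup>2 * ?B * ?S + 2 * rung_const\<^sup>2 * ?S\<^sup>2)
     (form_word ?L) (form_word ?M)"
    unfolding conj_cost_def e(2) using rel_cost_sym by blast
  have "conj_cost rels (plane_const * (len_pow (flat P))\<^sup>2) (flat P) (form_word ?L)"
    by (rule conj_cost_rel_cost[OF cost_flat[OF assms(1)]])
  also note lad
  also have "conj_cost rels (plane_const * (len_pow (flat Q))\<^sup>2) (form_word ?M) (flat Q)"
    by (rule conj_cost_rel_cost[OF rel_cost_sym[OF cost_flat[OF assms(2)]]])
  finally have total: "conj_cost rels (plane_const * (len_pow (flat P))\<^sup>2 +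
     (real (length ?L) * ?B + 2 * (real p + 2)\<^sup>2 * ?B * ?S + 2 * rung_const\<^sup>2 * ?S\<^sup>2) +
     plane_const * (len_pow (flat Q))\<^sup>2) (flat P) (flat Q)" .
  have sq: "plane_const * (len_pow (flat P))\<^sup>2 \<le> plane_const * H\<^sup>2" "plane_const * (len_pow (flat Q))\<^sup>2 \<le> plane_const * H\<^sup>2"
    using eH plane_const_nonneg by (auto intro!: mult_left_mono power_mono)
  have S: "?S \<le> dist_const * H" "0 \<le> ?S"
    using form_size_le[OF assms(1)] form_size_le[OF assms(2)] mult_left_mono[OF H b]
    by (auto simp: distrib_left)
  have "real (length P) \<le> real (length (flat P))" using length_le_flat by simp
  then have k: "real (length ?L) \<le> H" using length_le_len_pow[of "flat P"] eH(1) by simp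
  have B: "?B \<le> 2 * (real p + 1) * (dist_const * H)" "0 \<le> ?B" using S by (auto intro!: mult_left_mono)
  have 1: "real (length ?L) * ?B \<le> H * (2 * (real p + 1) * (dist_const * H))"
    using k B H0 by (intro mult_mono) auto
  have 2: "2 * (real p + 2)\<^sup>2 * ?B * ?S \<le> 2 * (real p + 2)\<^sup>2 * (2 * (real p + 1) * (dist_const * H)) * (dist_const * H)"
    using B S b H0 by (intro mult_mono mult_left_mono) auto
  have 3: "2 * rung_const\<^sup>2 * ?S\<^sup>2 \<le> 2 * rung_const\<^sup>2 * (dist_const * H)\<^sup>2"
    using S by (intro mult_left_mono power_mono) auto
  have "hyperbolic_const * H\<^sup>2 = 2 * (plane_const * H\<^sup>2) + H * (2 * (real p + 1) * (dist_const * H)) +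
    2 * (real p + 2)\<^sup>2 * (2 * (real p + 1) * (dist_const * H)) * (dist_const * H) + 2 * rung_const\<^sup>2 * (dist_const * H)\<^sup>2"
    by (simp add: hyperbolic_const_def power2_eq_square algebra_simps)
  with 1 2 3 sq show ?thesis by (intro conj_cost_mono[OF total]) linarith
qed

lemma conj_cost_hyperbolic:
  assumes P: "pieces P" "cyc_reduced (form_of P)" and Q: "pieces Q" "cyc_reduced (form_of Q)"
    and PQ: "conj_cost rels c (flat P) (flat Q)" and H: "len_pow (flat P) + len_pow (flat Q) \<le> H"
  shows "conj_cost rels (hyperbolic_const * H\<^sup>2) (flat P) (flat Q)"
proof -
  have "conj_cost rels (plane_const * (len_pow (flat P))\<^sup>2 + c + plane_const * (len_pow (flat Q))\<^sup>2)
     (form_word (form_of P)) (form_word (form_of Q))"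
    using conj_cost_trans[OF conj_cost_trans[OF conj_cost_rel_cost[OF rel_cost_sym[OF cost_flat[OF P(1)]]] PQ]
        conj_cost_rel_cost[OF cost_flat[OF Q(1)]]] .
  then obtain w where "word_equiv rels (form_word (form_of P) @ w) (w @ form_word (form_of Q))"
    unfolding conj_cost_def using rel_cost_imp_word_equiv by blast
  from hyperbolic_conjugate[OF P(2) Q(2) this]
  obtain i j z where lad: "ladder z (form_of (rotate i P)) (form_of (rotate j Q)) z"
    by (auto simp: form_of_rotate)
  obtain k l where kl: "flat (rotate i P) = rotate k (flat P)" "flat (rotate j Q) = rotate l (flat Q)"
    using flat_rotate by blast
  have "cyc_reduced (form_of (rotate i P))"
    unfolding form_of_rotate by (rule cyc_reduced_rotate[OF P(2)])
  then have red: "reduced (form_of (rotate i P))" "rotate i P \<noteq> []"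
    by (auto simp: cyc_reduced_def)
  have "len_pow (flat (rotate i P)) + len_pow (flat (rotate j Q)) \<le> H"
    using H len_pow_eq[of "rotate k (flat P)" "flat P"] len_pow_eq[of "rotate l (flat Q)" "flat Q"] by (simp add: kl)
  then have main: "conj_cost rels (hyperbolic_const * H\<^sup>2) (rotate k (flat P)) (rotate l (flat Q))"
    using conj_cost_ladder[OF _ _ lad red] P Q by (simp add: kl)
  show ?thesis
    using conj_cost_trans[OF conj_cost_trans[OF conj_cost_rotate_list[of rels "flat P" k] main]
        conj_cost_sym[OF conj_cost_rotate_list[of rels "flat Q" l]]] by simp
qed

lemma not_conj_plane_hyperbolic:
  assumes "plane_val u x" "pieces Q" "cyc_reduced (form_of Q)" "conj_cost rels c u (flat Q)"
  shows False
proof -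
  have "conj_cost rels (plane_const * (len_pow u)\<^sup>2 + c + plane_const * (len_pow (flat Q))\<^sup>2)
     (plane_word x) (form_word (form_of Q))"
    using conj_cost_trans[OF conj_cost_trans[OF conj_cost_rel_cost[OF rel_cost_sym[OF cost_plane_val[OF assms(1)]]] assms(4)]
        conj_cost_rel_cost[OF cost_flat[OF assms(2)]]] .
  then obtain w where "word_equiv rels (plane_word x @ w) (w @ form_word (form_of Q))"
    unfolding conj_cost_def using rel_cost_imp_word_equiv by blast
  then show False by (rule plane_hyperbolic_not_conjugate[OF assms(3)])
qed

definition upper_const :: real
  where "upper_const = elliptic_const + hyperbolic_const"

lemma const_nonneg: "0 \<le> elliptic_const" "0 \<le> hyperbolic_const"
  using plane_const_nonneg dist_const_ge_1 by (simp_all add: elliptic_const_def hyperbolic_const_def)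

text \<open>Rotations are free, so both words may be taken to be visibly planar or cyclically reduced, and a word of
the first kind is never conjugate to one of the second kind. The cost \<open>c\<close> serves only to say that the words are
conjugate.\<close>

lemma conj_cost_upper:
  assumes "conj_cost rels c u v"
  shows "conj_cost rels (upper_const * (len_pow (u @ v))\<^sup>2) u v"
proof -
  let ?H = "len_pow (u @ v)"
  have H: "len_pow u + len_pow v \<le> ?H" by (rule len_pow_append)
  then have H': "len_pow u \<le> ?H" "len_pow v \<le> ?H" using len_pow_nonneg[of u] len_pow_nonneg[of v] by linarith+
  have rot: "conj_cost rels (upper_const * ?H\<^sup>2) u v"
    if *: "conj_cost rels d (rotate k u) (rotate l v)" "d \<le> upper_const * ?H\<^sup>2" for d k l
    using conj_cost_trans[OF conj_cost_trans[OF conj_cost_rotate_list[of rels u k] *(1)]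
        conj_cost_sym[OF conj_cost_rotate_list[of rels v l]]] *(2) by (elim conj_cost_mono) simp
  have uv: "conj_cost rels c (rotate k u) (rotate l v)" for k l
    using conj_cost_trans[OF conj_cost_trans[OF conj_cost_sym[OF conj_cost_rotate_list[of rels u k]] assms]
        conj_cost_rotate_list[of rels v l]] by simp
  have er: "len_pow (rotate k w) = len_pow w" for k and w :: "gen wrd" by (rule len_pow_eq) simp
  have cb: "elliptic_const * ?H\<^sup>2 \<le> upper_const * ?H\<^sup>2" "hyperbolic_const * ?H\<^sup>2 \<le> upper_const * ?H\<^sup>2"
    using const_nonneg by (auto simp: upper_const_def intro!: mult_right_mono)
  from word_cyc_reduce[of u] word_cyc_reduce[of v] consider
      (pp) k x l y where "plane_val (rotate k u) x" "plane_val (rotate l v) y"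
    | (ph) k x l Q where "plane_val (rotate k u) x" "pieces Q" "cyc_reduced (form_of Q)" "flat Q = rotate l v"
    | (hp) k P l y where "pieces P" "cyc_reduced (form_of P)" "flat P = rotate k u" "plane_val (rotate l v) y"
    | (hh) k P l Q where "pieces P" "cyc_reduced (form_of P)" "flat P = rotate k u"
        "pieces Q" "cyc_reduced (form_of Q)" "flat Q = rotate l v"
    by blast
  then show ?thesis
  proof cases
    case pp
    show ?thesis
      by (rule rot[OF conj_cost_elliptic[OF pp uv] cb(1)]) (simp_all add: er H')
  next
    case ph
    then show ?thesis using not_conj_plane_hyperbolic[OF ph(1-3)] uv[of k l] by auto
  next
    case hp
    then show ?thesis using not_conj_plane_hyperbolic[OF hp(4,1,2)] conj_cost_sym[OF uv[of k l]] by auto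
  next
    case hh
    have "conj_cost rels c (flat P) (flat Q)" using uv[of k l] hh by simp
    from conj_cost_hyperbolic[OF hh(1,2,4,5) this, of ?H]
    have "conj_cost rels (hyperbolic_const * ?H\<^sup>2) (rotate k u) (rotate l v)"
      using H hh(3,6) by (simp add: er)
    then show ?thesis by (rule rot[OF _ cb(2)])
  qed
qed

lemma annular_dehn_upper:
  "real (annular_dehn rels n) \<le> upper_const * (real n powr alpha)\<^sup>2"
proof -
  have "annular_dehn rels n \<in> {ann rels u v |u v. length u + length v \<le> n \<and> conjugate_in rels u v}"
    unfolding annular_dehn_def by (rule Max_in[OF annular_dehn_set])
  then obtain u v where uv: "annular_dehn rels n = ann rels u v" "length u + length v \<le> n"
    "conjugate_in rels u v" by blast
  then obtain w where w: "word_equiv rels (u @ w) (w @ v)"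
    by (auto simp: conjugate_in_iff word_class_eq_iff)
  have "conj_cost rels (area rels ((u @ w) @ winv (w @ v))) u v"
    unfolding conj_cost_def using area_le_iff_rel_cost[OF w] by blast
  from ann_le_of_conj_cost[OF conj_cost_upper[OF this]]
  have "real (annular_dehn rels n) \<le> upper_const * (len_pow (u @ v))\<^sup>2" by (simp add: uv(1))
  also have "\<dots> \<le> upper_const * (real n powr alpha)\<^sup>2"
  proof -
    have "len_pow (u @ v) \<le> real n powr alpha"
      using uv(2) alpha_gt_1 unfolding len_pow_def by (intro powr_mono2) auto
    then show ?thesis using const_nonneg
      by (intro mult_left_mono power_mono) (auto simp: upper_const_def)
  qed
  finally show ?thesis .
qed

lemma annular_dehn_mono: "m \<le> n \<Longrightarrow> annular_dehn rels m \<le> annular_dehn rels n"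
  unfolding annular_dehn_def
  by (rule Max_mono[OF _ annular_dehn_set(2) annular_dehn_set(1)]) fastforce

lemma powr_twice: "(real n powr alpha)\<^sup>2 = real n powr (2 * alpha)"
  by (simp add: power2_eq_square powr_add[symmetric])

lemma annular_dehn_le_powr: "(\<lambda>n. real (annular_dehn rels n)) \<lesssim> (\<lambda>n. real n powr (2 * alpha))"
  unfolding growth_le_def
proof (intro exI conjI allI)
  let ?C = "nat \<lceil>upper_const\<rceil> + 1"
  show "0 < ?C" by simp
  fix n
  have C: "upper_const \<le> real ?C" by linarith
  have "real (annular_dehn rels n) \<le> upper_const * real n powr (2 * alpha)"
    using annular_dehn_upper[of n] by (simp add: powr_twice)
  also have "\<dots> \<le> real ?C * real (?C * n + n) powr (2 * alpha)"
    using C alpha_gt_1 by (intro mult_mono powr_mono2) auto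
  also have "\<dots> \<le> real ?C * real (?C * n + n) powr (2 * alpha) + real ?C * real n + real ?C" by simp
  finally show "real (annular_dehn rels n) \<le>
    real ?C * real (?C * n + n) powr (2 * alpha) + real ?C * real n + real ?C" .
qed

lemma powr_le_annular_dehn: "(\<lambda>n. real n powr (2 * alpha)) \<lesssim> (\<lambda>n. real (annular_dehn rels n))"
  unfolding growth_le_def
proof (intro exI conjI allI)
  let ?C = "(8 * q + 20) + (2 * p)\<^sup>2"
  let ?f = "\<lambda>n. real (annular_dehn rels n)"
  show "0 < ?C" by simp
  fix n
  show "real n powr (2 * alpha) \<le> real ?C * ?f (?C * n + n) + real ?C * real n + real ?C"
  proof (cases "n = 0")
    case False
    \<comment> \<open>Round n down to a power of 2, to compare with the snowflake word of that generation.\<close>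
    then obtain k where k: "2 ^ k \<le> n" "n < 2 ^ (k + 1)" using ex_power_ivl1[of 2 n] by auto
    let ?l = "2 * real p / real q"
    have "real n \<le> 2 ^ (k + 1)" using k(2) by (metis less_imp_le of_nat_le_iff of_nat_numeral of_nat_power)
    then have "real n powr alpha \<le> (2 ^ (k + 1)) powr alpha" using alpha_gt_1 by (intro powr_mono2) auto
    also have "(2 :: real) ^ (k + 1) = 2 powr real (k + 1)" by (rule powr_realpow[symmetric]) simp
    also have "(2 powr real (k + 1)) powr alpha = (2 powr alpha) powr real (k + 1)"
      by (simp only: powr_powr mult.commute)
    also have "\<dots> = (2 powr alpha) ^ (k + 1)" by (rule powr_realpow) simp
    also have "\<dots> = ?l ^ (k + 1)" by (simp only: two_powr_alpha)
    finally have "(real n powr alpha)\<^sup>2 \<le> (?l ^ (k + 1))\<^sup>2" by (intro power_mono) auto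
    also have "\<dots> = ?l\<^sup>2 * ?l ^ (2 * k)"
      by (simp add: power_mult[symmetric] power_add[symmetric] mult.commute del: power_Suc)
    also have "\<dots> \<le> (2 * real p)\<^sup>2 * ?f (?C * n + n)"
    proof (rule mult_mono)
      have "?l \<le> 2 * real p" using q_pos mult_left_mono[of 1 "real q" "real p"] by (simp add: divide_le_eq)
      then show "?l\<^sup>2 \<le> (2 * real p)\<^sup>2" by (intro power_mono) auto
      have "(8 * q + 20) * 2 ^ k \<le> (8 * q + 20) * n" using k(1) by (rule mult_le_mono2)
      also have "\<dots> \<le> ?C * n + n" by (simp add: algebra_simps)
      finally have "?f ((8 * q + 20) * 2 ^ k) \<le> ?f (?C * n + n)" using annular_dehn_mono by simp
      with annular_dehn_lower[of k] show "?l ^ (2 * k) \<le> ?f (?C * n + n)" by linarith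
    qed simp_all
    also have "\<dots> \<le> real ?C * ?f (?C * n + n)" by (intro mult_right_mono) auto
    also have "\<dots> \<le> real ?C * ?f (?C * n + n) + real ?C * real n + real ?C" by simp
    finally show ?thesis by (simp only: powr_twice)
  qed simp
qed

end

theorem theorem1p5:
  fixes p q :: nat and \<alpha> :: real
  assumes "0 < q" and "q < p"
    and "\<alpha> = log 2 (2 * real p / real q)"
  shows "(\<lambda>n. real (annular_dehn (B_relators p q) n)) \<simeq> (\<lambda>n. real n powr (2 * \<alpha>))"
proof -
  interpret snowflake p q using assms by unfold_locales
  have "\<alpha> = alpha" by (simp add: assms(3) alpha_def)
  then show ?thesis
    using annular_dehn_le_powr powr_le_annular_dehn by (simp add: growth_equiv_def)
qed

end
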